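(* Let $m\ge 0$ be an integer. For every $0\le k\le m$, the unitary representation $\rho$ of $\mathfrak{G}$ restricted to the invariant subspace $L^{2,\mathsf s}_k([0,1]^m)$ is irreducible, and these $m+1$ representations (for $k=0,\dots,m$) are pairwise non-equivalent. Furthermore, every closed subspace $M$ of $L^{2,\mathsf s}([0,1]^m)$ that is invariant under $\rho$ is of the form $$M=\bigoplus_{k\in K} L^{2,\mathsf s}_k([0,1]^m)$$ for some set $K\subseteq\{0,\dots,m\}$. In particular, if there exists a non-constant function $f\in M$, then there exists $k\in\{1,\dots,m\}$ such that $L^{2,\mathsf s}_k([0,1]^m)\subseteq M$.
   Context: Functions on $[0,1]^m$ are Lebesgue measurable and complex-valued, and are identified if equal a.e.; $L^2([0,1]^0)=\mathbb C$. Subspaces of $L^2([0,1]^m)$: $L^{2,\mathsf s}([0,1]^m)$ is the subspace of symmetric functions, i.e. those $f$ with $f(x_1,\dots,x_m)=f(x_{\sigma(1)},\dots,x_{\sigma(m)})$ for every permutation $\sigma$ of $\{1,\dots,m\}$. For $0\le k\le m$, $L^2_{\le k}([0,1]^m)$ is the closed linear span of the functions in $L^2([0,1]^m)$ that depend only on the coordinates $(x_i)_{i\in I}$ for some $I\subseteq\{1,\dots,m\}$ with $|I|\le k$; also $L^2_{\le -1}([0,1]^m)=\{0\}$. $L^{2,\mathsf s}_{\le k}([0,1]^m):=L^{2,\mathsf s}([0,1]^m)\cap L^2_{\le k}([0,1]^m)$, and $L^{2,\mathsf s}_k([0,1]^m)$ is the orthogonal complement of $L^{2,\mathsf s}_{\le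 k-1}([0,1]^m)$ in $L^{2,\mathsf s}_{\le k}([0,1]^m)$, for $0\le k\le m$. $\mathfrak{G}$ is the group of all measure-preserving bijections $\varphi:[0,1]\to[0,1]$. Its unitary representation $\rho$ on $L^2([0,1]^m)$ is $\rho_\varphi(f)(x_1,\dots,x_m)=f(\varphi^{-1}(x_1),\dots,\varphi^{-1}(x_m))$. All the subspaces above are $\rho$-invariant. A unitary representation on a Hilbert space $H$ is irreducible if its only closed invariant subspaces are $\{0\}$ and $H$. Two representations are equivalent if there is an invertible bounded linear operator between the spaces that intertwines them. *)

theory Defs
  imports "HOL-Analysis.Analysis" "HOL-Combinatorics.Permutations"
begin

text \<open>
  Lebesgue measure on $[0,1]^m$. A point is a function in
  \<open>{..<m} \<rightarrow>\<^sub>E {0..1}\<close>, so coordinates are numbered \<open>0, \<dots>, m - 1\<close>, and \<open>[0,1]\<^sup>0\<close> is a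
  single point of mass 1. The completion makes the measurable sets exactly the Lebesgue
  measurable ones.
\<close>

abbreviation unit_interval :: "real measure" where
  "unit_interval \<equiv> lebesgue_on {0..1}"

definition unit_cube :: "nat \<Rightarrow> (nat \<Rightarrow> real) measure" where
  "unit_cube m = completion (PiM {..<m} (\<lambda>_. unit_interval))"

type_synonym cube_fun = "(nat \<Rightarrow> real) \<Rightarrow> complex"

text \<open>
  Elements of $L^2([0,1]^m)$ are handled through representatives: the identification of
  a.e. equal functions is the relation \<open>ae_eq\<close>, and a set of functions stands for a set of
  classes when it is saturated under \<open>ae_eq\<close>. Closed subspaces as defined below are
  automatically saturated, since a.e. equal functions have distance 0. The
  subspace $\{0\}$ is \<open>L2_null\<close>.
\<close>

definition ae_eq :: "nat \<Rightarrow> cube_fun \<Rightarrow> cube_fun \<Rightarrow> bool" where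
  "ae_eq m f g \<longleftrightarrow> (AE x in unit_cube m. f x = g x)"

definition L2 :: "nat \<Rightarrow> cube_fun set" where
  "L2 m = {f \<in> borel_measurable (unit_cube m). integrable (unit_cube m) (\<lambda>x. (cmod (f x))\<^sup>2)}"

definition L2_null :: "nat \<Rightarrow> cube_fun set" where
  "L2_null m = {f \<in> L2 m. ae_eq m f (\<lambda>_. 0)}"

definition L2_inner :: "nat \<Rightarrow> cube_fun \<Rightarrow> cube_fun \<Rightarrow> complex" where
  "L2_inner m f g = (LINT x|unit_cube m. f x * cnj (g x))"

definition L2_norm :: "nat \<Rightarrow> cube_fun \<Rightarrow> real" where
  "L2_norm m f = sqrt (LINT x|unit_cube m. (cmod (f x))\<^sup>2)"

definition L2_subspace :: "nat \<Rightarrow> cube_fun set \<Rightarrow> bool" where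
  "L2_subspace m M \<longleftrightarrow> M \<subseteq> L2 m \<and> (\<lambda>_. 0) \<in> M \<and>
     (\<forall>f\<in>M. \<forall>g\<in>M. (\<lambda>x. f x + g x) \<in> M) \<and> (\<forall>c. \<forall>f\<in>M. (\<lambda>x. c * f x) \<in> M)"

definition L2_closed :: "nat \<Rightarrow> cube_fun set \<Rightarrow> bool" where
  "L2_closed m M \<longleftrightarrow>
     (\<forall>s f. (\<forall>n::nat. s n \<in> M) \<and> f \<in> L2 m \<and>
        (\<lambda>n. L2_norm m (\<lambda>x. s n x - f x)) \<longlonglongrightarrow> 0 \<longrightarrow> f \<in> M)"

definition closed_subspace :: "nat \<Rightarrow> cube_fun set \<Rightarrow> bool" where
  "closed_subspace m M \<longleftrightarrow> L2_subspace m M \<and> L2_closed m M"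

definition closed_span :: "nat \<Rightarrow> cube_fun set \<Rightarrow> cube_fun set" where
  "closed_span m S = \<Inter>{M. closed_subspace m M \<and> S \<subseteq> M}"

definition L2_sym :: "nat \<Rightarrow> cube_fun set" where
  "L2_sym m = {f \<in> L2 m. \<forall>\<sigma>. \<sigma> permutes {..<m} \<longrightarrow> ae_eq m f (\<lambda>x. f (x \<circ> \<sigma>))}"

definition depends_only_on :: "nat \<Rightarrow> nat set \<Rightarrow> cube_fun \<Rightarrow> bool" where
  "depends_only_on m I f \<longleftrightarrow>
     (\<forall>x\<in>space (unit_cube m). \<forall>y\<in>space (unit_cube m). (\<forall>i\<in>I. x i = y i) \<longrightarrow> f x = f y)"

text \<open>
  The bound is an integer so that the case \<open>k = -1\<close> is covered: then no \<open>I\<close> qualifies and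
  the closed span of the empty set is \<open>L2_null m\<close>.
\<close>

definition L2_le :: "nat \<Rightarrow> int \<Rightarrow> cube_fun set" where
  "L2_le m k = closed_span m
     {f \<in> L2 m. \<exists>I\<subseteq>{..<m}. int (card I) \<le> k \<and> depends_only_on m I f}"

definition L2_sym_le :: "nat \<Rightarrow> int \<Rightarrow> cube_fun set" where
  "L2_sym_le m k = L2_sym m \<inter> L2_le m k"

definition L2_sym_comp :: "nat \<Rightarrow> nat \<Rightarrow> cube_fun set" where
  "L2_sym_comp m k =
     {f \<in> L2_sym_le m (int k). \<forall>g\<in>L2_sym_le m (int k - 1). L2_inner m f g = 0}"

text \<open>
  The values of \<open>\<phi>\<close> outside \<open>{0..1}\<close> are irrelevant, here and in \<open>rho\<close>.
\<close>

definition mp_bijections :: "(real \<Rightarrow> real) set" where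
  "mp_bijections = {\<phi>. bij_betw \<phi> {0..1} {0..1} \<and>
     \<phi> \<in> unit_interval \<rightarrow>\<^sub>M unit_interval \<and>
     inv_into {0..1} \<phi> \<in> unit_interval \<rightarrow>\<^sub>M unit_interval \<and>
     distr unit_interval unit_interval \<phi> = unit_interval}"

definition rho :: "nat \<Rightarrow> (real \<Rightarrow> real) \<Rightarrow> cube_fun \<Rightarrow> cube_fun" where
  "rho m \<phi> f = (\<lambda>x. f (\<lambda>i\<in>{..<m}. inv_into {0..1} \<phi> (x i)))"

definition rho_invariant :: "nat \<Rightarrow> cube_fun set \<Rightarrow> bool" where
  "rho_invariant m M \<longleftrightarrow> (\<forall>\<phi>\<in>mp_bijections. \<forall>f\<in>M. rho m \<phi> f \<in> M)"

definition closed_invariant_subspace :: "nat \<Rightarrow> cube_fun set \<Rightarrow> bool" where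
  "closed_invariant_subspace m M \<longleftrightarrow> closed_subspace m M \<and> rho_invariant m M"

definition rho_irreducible_on :: "nat \<Rightarrow> cube_fun set \<Rightarrow> bool" where
  "rho_irreducible_on m H \<longleftrightarrow> closed_invariant_subspace m H \<and>
     (\<forall>N. closed_invariant_subspace m N \<and> N \<subseteq> H \<longrightarrow> N = L2_null m \<or> N = H)"

text \<open>
  Operators act on representatives, with linearity required up to \<open>ae_eq\<close>; together with
  boundedness this makes them respect \<open>ae_eq\<close>.
\<close>

definition bounded_operator :: "nat \<Rightarrow> cube_fun set \<Rightarrow> cube_fun set \<Rightarrow> (cube_fun \<Rightarrow> cube_fun) \<Rightarrow> bool"
  where "bounded_operator m H1 H2 T \<longleftrightarrow>
     (\<forall>f\<in>H1. T f \<in> H2) \<and>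
     (\<forall>f\<in>H1. \<forall>g\<in>H1. ae_eq m (T (\<lambda>x. f x + g x)) (\<lambda>x. T f x + T g x)) \<and>
     (\<forall>c. \<forall>f\<in>H1. ae_eq m (T (\<lambda>x. c * f x)) (\<lambda>x. c * T f x)) \<and>
     (\<exists>C. \<forall>f\<in>H1. L2_norm m (T f) \<le> C * L2_norm m f)"

definition rho_equivalent :: "nat \<Rightarrow> cube_fun set \<Rightarrow> cube_fun set \<Rightarrow> bool" where
  "rho_equivalent m H1 H2 \<longleftrightarrow> (\<exists>T S.
     bounded_operator m H1 H2 T \<and> bounded_operator m H2 H1 S \<and>
     (\<forall>f\<in>H1. ae_eq m (S (T f)) f) \<and> (\<forall>g\<in>H2. ae_eq m (T (S g)) g) \<and>
     (\<forall>\<phi>\<in>mp_bijections. \<forall>f\<in>H1. ae_eq m (T (rho m \<phi> f)) (rho m \<phi> (T f))))"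

definition orthogonal_direct_sum :: "nat \<Rightarrow> cube_fun set \<Rightarrow> nat set \<Rightarrow> (nat \<Rightarrow> cube_fun set) \<Rightarrow> bool"
  where "orthogonal_direct_sum m M K V \<longleftrightarrow>
     (\<forall>k\<in>K. \<forall>l\<in>K. k \<noteq> l \<longrightarrow> (\<forall>f\<in>V k. \<forall>g\<in>V l. L2_inner m f g = 0)) \<and>
     M = {f \<in> L2 m. \<exists>g. (\<forall>k\<in>K. g k \<in> V k) \<and> ae_eq m f (\<lambda>x. \<Sum>k\<in>K. g k x)}"

end

theory Submission imports Defs "HOL-Probability.Infinite_Product_Measure" begin

text \<open>
  Let \<open>g\<close>, \<open>h\<close> be integer-valued step functions with integral zero. For large \<open>q\<close> the kernel
  \<open>1 + g(x) h(y) / q\<close> is doubly stochastic, and by permuting cells of ever finer partitions one finds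
  measure-preserving bijections \<open>\<phi>\<^sub>n\<close> whose operators on \<open>L\<^sup>2([0,1])\<close> converge weakly to the integral
  operator with this kernel. On \<open>L\<^sup>2([0,1]\<^sup>m)\<close> the limit of \<open>\<rho>\<close> is its tensor power, which sends a symmetric
  \<open>f\<close> to \<open>\<Sum>\<^sub>k q\<^sup>-\<^sup>k c\<^sub>k(f) e\<^sub>k(g)\<close>, where \<open>e\<^sub>k(g)\<close> is the \<open>k\<close>-th elementary symmetric polynomial in
  \<open>g(x\<^sub>1), \<dots>, g(x\<^sub>m)\<close> and \<open>c\<^sub>k(f)\<close> is proportional to the inner product of \<open>f\<close> with \<open>e\<^sub>k(h)\<close>.
  A closed invariant \<open>M\<close> is weakly closed, and a polynomial in \<open>1/q\<close> with infinitely many zeros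
  vanishes; hence if some \<open>f\<close> in \<open>M\<close> is not orthogonal to some \<open>e\<^sub>k(h)\<close>, then \<open>M\<close> contains every
  \<open>e\<^sub>k(g)\<close>. By polarization (Ryser's formula) the \<open>e\<^sub>k(g)\<close> are total in the \<open>k\<close>-th component, so \<open>M\<close>
  contains all of it. An intertwining operator between the components \<open>k\<close> and \<open>l\<close> commutes with the
  weak limits, which forces \<open>q\<^sup>-\<^sup>k = q\<^sup>-\<^sup>l\<close>.
\<close>

section \<open>The Hilbert space of the cube\<close>

text \<open>The obstacle is to reach the kernel with actual bijections. A kernel on an
  \<open>R\<close> by \<open>R\<close> grid is realized exactly by a permutation of finer cells once
  its entries, suitably scaled, are nonnegative integers with constant row and column sums. For
  integer-valued \<open>g\<close>, \<open>h\<close> the entry \<open>q + h(a) g(b)\<close> is an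
  integer; it is nonnegative when \<open>q\<close> bounds \<open>\<bar>h(a) g(b)\<bar>\<close>, and
  the zero integrals make every row and column sum equal to \<open>R q\<close>. This is the origin
  of integer values, mean zero and large \<open>q\<close>. The degree \<open>k\<close> is read off
  as the exponent of \<open>1/q\<close>, and symmetry of \<open>f\<close> gives all terms of one
  degree a common coefficient. Refining the grid by \<open>n!\<close> eventually accommodates any
  two given step functions, so on them the limit is attained exactly; density and uniform bounds
  extend it to all of \<open>L2\<close>. Integer values are still enough for totality: indicators
  are integer valued, and centering multiplies by the number of cells instead of dividing by it.
  Weak closedness of \<open>M\<close> enters as the equality of \<open>M\<close> with its double
  orthogonal complement.\<close>

lemma prob_space_unit_interval: "prob_space unit_interval"
  by (rule prob_spaceI) (simp add: emeasure_restrict_space)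

lemma prob_space_unit_cube: "prob_space (unit_cube m)"
proof -
  interpret product_prob_space "\<lambda>_. unit_interval" "{..<m}"
    by (intro product_prob_spaceI prob_space_unit_interval)
  interpret prob_space "PiM {..<m} (\<lambda>_. unit_interval)"
    by (rule prob_space_PiM) (rule prob_space_unit_interval)
  show ?thesis unfolding unit_cube_def by (rule prob_space_completion)
qed

lemma space_unit_cube: "space (unit_cube m) = {..<m} \<rightarrow>\<^sub>E {0..1}"
  by (simp add: unit_cube_def space_PiM space_restrict_space)

lemma sets_PiM_unit_cube: "A \<in> sets (PiM {..<m} (\<lambda>_. unit_interval)) \<Longrightarrow> A \<in> sets (unit_cube m)"
  by (simp add: unit_cube_def)

lemma measurable_unit_cubeI:
  "f \<in> PiM {..<m} (\<lambda>_. unit_interval) \<rightarrow>\<^sub>M N \<Longrightarrow> f \<in> unit_cube m \<rightarrow>\<^sub>M N"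
  unfolding unit_cube_def by (rule measurable_completion)

lemma L2_measurable: "f \<in> L2 m \<Longrightarrow> f \<in> borel_measurable (unit_cube m)"
  by (simp add: L2_def)

lemma L2_square_integrable: "f \<in> L2 m \<Longrightarrow> integrable (unit_cube m) (\<lambda>x. (cmod (f x))\<^sup>2)"
  by (simp add: L2_def)

lemma borel_measurable_cnj [measurable (raw)]:
  "f \<in> borel_measurable M \<Longrightarrow> (\<lambda>x. cnj (f x)) \<in> borel_measurable M"
  by (rule measurable_compose[OF _ borel_measurable_continuous_onI[OF continuous_on_cnj[OF continuous_on_id]]])

lemma L2_integrable_mult_cnj:
  assumes "f \<in> L2 m" "g \<in> L2 m"
  shows "integrable (unit_cube m) (\<lambda>x. f x * cnj (g x))"
proof (rule Bochner_Integration.integrable_bound)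
  show "integrable (unit_cube m) (\<lambda>x. (cmod (f x))\<^sup>2 + (cmod (g x))\<^sup>2)"
    using assms by (intro Bochner_Integration.integrable_add L2_square_integrable)
  show "(\<lambda>x. f x * cnj (g x)) \<in> borel_measurable (unit_cube m)"
    using assms[THEN L2_measurable] by measurable
  have "a * b \<le> a\<^sup>2 + b\<^sup>2" for a b :: real
  proof -
    have "0 \<le> (a - b)\<^sup>2 + a\<^sup>2 + b\<^sup>2" by simp
    then show ?thesis by (simp add: power2_diff)
  qed
  then show "AE x in unit_cube m. norm (f x * cnj (g x)) \<le> norm ((cmod (f x))\<^sup>2 + (cmod (g x))\<^sup>2)"
    by (simp add: norm_mult)
qed

text \<open>Domination is the common integrability argument for multiples, moduli and bounded
  functions.\<close>

lemma L2_cong_bound: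
  assumes "f \<in> borel_measurable (unit_cube m)" "g \<in> L2 m"
    and "\<And>x. x \<in> space (unit_cube m) \<Longrightarrow> (cmod (f x))\<^sup>2 \<le> C * (cmod (g x))\<^sup>2"
  shows "f \<in> L2 m"
  unfolding L2_def
proof (intro CollectI conjI)
  show "integrable (unit_cube m) (\<lambda>x. (cmod (f x))\<^sup>2)"
  proof (rule Bochner_Integration.integrable_bound)
    show "integrable (unit_cube m) (\<lambda>x. C * (cmod (g x))\<^sup>2)"
      using assms(2) by (intro integrable_mult_right L2_square_integrable)
    show "(\<lambda>x. (cmod (f x))\<^sup>2) \<in> borel_measurable (unit_cube m)"
      using assms(1) by measurable
    show "AE x in unit_cube m. norm ((cmod (f x))\<^sup>2) \<le> norm (C * (cmod (g x))\<^sup>2)"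
      using assms(3) by (intro AE_I2) (smt (verit) real_norm_def zero_le_power2)
  qed
qed (use assms in auto)

lemma L2_scale: "f \<in> L2 m \<Longrightarrow> (\<lambda>x. c * f x) \<in> L2 m"
  by (rule L2_cong_bound[where C="(cmod c)\<^sup>2"])
     (auto simp: norm_mult power_mult_distrib dest: L2_measurable)

lemma L2_bounded:
  assumes "f \<in> borel_measurable (unit_cube m)" "\<And>x. x \<in> space (unit_cube m) \<Longrightarrow> cmod (f x) \<le> B"
  shows "f \<in> L2 m"
proof (rule L2_cong_bound[where C="B\<^sup>2" and g="\<lambda>_. 1"])
  interpret prob_space "unit_cube m" by (rule prob_space_unit_cube)
  show "(\<lambda>_. 1) \<in> L2 m" by (simp add: L2_def)
qed (use assms in \<open>auto intro: power_mono\<close>)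

lemma L2_const: "(\<lambda>_. c) \<in> L2 m"
  by (rule L2_bounded[where B="cmod c"]) auto

lemma L2_add:
  assumes "f \<in> L2 m" "g \<in> L2 m"
  shows "(\<lambda>x. f x + g x) \<in> L2 m"
  unfolding L2_def
proof (intro CollectI conjI)
  show meas: "(\<lambda>x. f x + g x) \<in> borel_measurable (unit_cube m)"
    using assms[THEN L2_measurable] by measurable
  show "integrable (unit_cube m) (\<lambda>x. (cmod (f x + g x))\<^sup>2)"
  proof (rule Bochner_Integration.integrable_bound)
    show "integrable (unit_cube m) (\<lambda>x. 2 * (cmod (f x))\<^sup>2 + 2 * (cmod (g x))\<^sup>2)"
      using assms by (intro Bochner_Integration.integrable_add integrable_mult_right L2_square_integrable)
    show "(\<lambda>x. (cmod (f x + g x))\<^sup>2) \<in> borel_measurable (unit_cube m)"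
      using meas by measurable
    have "(cmod (a + b))\<^sup>2 \<le> 2 * (cmod a)\<^sup>2 + 2 * (cmod b)\<^sup>2" for a b
    proof -
      have "(cmod (a + b))\<^sup>2 \<le> (cmod a + cmod b)\<^sup>2"
        by (intro power_mono norm_triangle_ineq) simp
      also have "\<dots> \<le> 2 * (cmod a)\<^sup>2 + 2 * (cmod b)\<^sup>2"
        using sum_squares_bound[of "cmod a" "cmod b"] by (simp add: power2_sum)
      finally show ?thesis .
    qed
    then show "AE x in unit_cube m.
        norm ((cmod (f x + g x))\<^sup>2) \<le> norm (2 * (cmod (f x))\<^sup>2 + 2 * (cmod (g x))\<^sup>2)"
      by simp
  qed
qed

lemma L2_diff: "f \<in> L2 m \<Longrightarrow> g \<in> L2 m \<Longrightarrow> (\<lambda>x. f x - g x) \<in> L2 m"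
  using L2_add[OF _ L2_scale[of g m "-1"]] by simp

lemma L2_sum: "(\<And>i. i \<in> A \<Longrightarrow> F i \<in> L2 m) \<Longrightarrow> (\<lambda>x. \<Sum>i\<in>A. F i x) \<in> L2 m"
  by (induction A rule: infinite_finite_induct) (auto intro: L2_const L2_add)

lemma L2_inner_add_left: "f \<in> L2 m \<Longrightarrow> g \<in> L2 m \<Longrightarrow> h \<in> L2 m \<Longrightarrow>
    L2_inner m (\<lambda>x. f x + g x) h = L2_inner m f h + L2_inner m g h"
  by (simp add: L2_inner_def distrib_right L2_integrable_mult_cnj)

lemma L2_inner_add_right: "f \<in> L2 m \<Longrightarrow> g \<in> L2 m \<Longrightarrow> h \<in> L2 m \<Longrightarrow>
    L2_inner m h (\<lambda>x. f x + g x) = L2_inner m h f + L2_inner m h g"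
  by (simp add: L2_inner_def distrib_left L2_integrable_mult_cnj)

lemma L2_inner_diff_left: "f \<in> L2 m \<Longrightarrow> g \<in> L2 m \<Longrightarrow> h \<in> L2 m \<Longrightarrow>
    L2_inner m (\<lambda>x. f x - g x) h = L2_inner m f h - L2_inner m g h"
  by (simp add: L2_inner_def left_diff_distrib L2_integrable_mult_cnj)

lemma L2_inner_diff_right: "f \<in> L2 m \<Longrightarrow> g \<in> L2 m \<Longrightarrow> h \<in> L2 m \<Longrightarrow>
    L2_inner m h (\<lambda>x. f x - g x) = L2_inner m h f - L2_inner m h g"
  by (simp add: L2_inner_def right_diff_distrib L2_integrable_mult_cnj)

lemma L2_inner_scale_left: "L2_inner m (\<lambda>x. c * f x) h = c * L2_inner m f h"
  by (simp add: L2_inner_def mult.assoc)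

lemma L2_inner_scale_right: "L2_inner m h (\<lambda>x. c * f x) = cnj c * L2_inner m h f"
  by (simp add: L2_inner_def mult.left_commute)

lemma L2_inner_cnj: "cnj (L2_inner m f g) = L2_inner m g f"
proof -
  have "cnj (L2_inner m f g) = (LINT x|unit_cube m. cnj (f x * cnj (g x)))"
    unfolding L2_inner_def 
    by (rule integral_bounded_linear'[OF bounded_linear_cnj bounded_linear_cnj, symmetric]) simp
  then show ?thesis by (simp add: L2_inner_def mult.commute)
qed

lemma L2_inner_zero_left [simp]: "L2_inner m (\<lambda>_. 0) g = 0"
  by (simp add: L2_inner_def)

lemma L2_inner_zero_right [simp]: "L2_inner m g (\<lambda>_. 0) = 0"
  by (simp add: L2_inner_def)

lemma L2_inner_sum_left: "(\<And>i. i \<in> A \<Longrightarrow> F i \<in> L2 m) \<Longrightarrow> g \<in> L2 m \<Longrightarrow>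
    L2_inner m (\<lambda>x. \<Sum>i\<in>A. F i x) g = (\<Sum>i\<in>A. L2_inner m (F i) g)"
  by (induction A rule: infinite_finite_induct) (simp_all add: L2_inner_add_left L2_sum)

lemma L2_inner_sum_right: "(\<And>i. i \<in> A \<Longrightarrow> F i \<in> L2 m) \<Longrightarrow> g \<in> L2 m \<Longrightarrow>
    L2_inner m g (\<lambda>x. \<Sum>i\<in>A. F i x) = (\<Sum>i\<in>A. L2_inner m g (F i))"
  by (induction A rule: infinite_finite_induct) (simp_all add: L2_inner_add_right L2_sum)

lemma L2_norm_nonneg [simp]: "0 \<le> L2_norm m f"
  by (simp add: L2_norm_def)

lemma L2_norm_square: "(L2_norm m f)\<^sup>2 = (LINT x|unit_cube m. (cmod (f x))\<^sup>2)"
  by (simp add: L2_norm_def)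

lemma L2_inner_self: "L2_inner m f f = of_real ((L2_norm m f)\<^sup>2)"
  unfolding L2_norm_square L2_inner_def
  by (subst integral_complex_of_real[symmetric]) (intro Bochner_Integration.integral_cong refl complex_norm_square[symmetric])

lemma ae_eq_iff_norm:
  assumes "f \<in> L2 m"
  shows "ae_eq m f (\<lambda>_. 0) \<longleftrightarrow> L2_norm m f = 0"
proof -
  have "L2_norm m f = 0 \<longleftrightarrow> (AE x in unit_cube m. (cmod (f x))\<^sup>2 = 0)"
    unfolding L2_norm_def real_sqrt_eq_0_iff
    by (rule integral_nonneg_eq_0_iff_AE) (use assms in \<open>auto dest: L2_square_integrable\<close>)
  then show ?thesis by (simp add: ae_eq_def)
qed

lemma ae_eq_refl: "ae_eq m f f"
  by (simp add: ae_eq_def)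

lemma ae_eq_sym: "ae_eq m f g \<Longrightarrow> ae_eq m g f"
  by (auto simp: ae_eq_def)

lemma ae_eq_trans: "ae_eq m f g \<Longrightarrow> ae_eq m g h \<Longrightarrow> ae_eq m f h"
  unfolding ae_eq_def by (elim eventually_rev_mp) (auto intro: AE_I2)

lemma ae_eq_diff_iff: "ae_eq m (\<lambda>x. f x - g x) (\<lambda>_. 0) \<longleftrightarrow> ae_eq m f g"
  by (simp add: ae_eq_def)

lemma L2_inner_ae_cong:
  assumes "f \<in> L2 m" "f' \<in> L2 m" "g \<in> L2 m" "g' \<in> L2 m" "ae_eq m f f'" "ae_eq m g g'"
  shows "L2_inner m f g = L2_inner m f' g'"
  unfolding L2_inner_def
proof (rule integral_cong_AE)
  show "AE x in unit_cube m. f x * cnj (g x) = f' x * cnj (g' x)"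
    using assms(5,6) unfolding ae_eq_def by eventually_elim simp
qed (intro borel_measurable_times borel_measurable_cnj L2_measurable assms)+

lemma L2_norm_diff_square:
  assumes "f \<in> L2 m" "g \<in> L2 m"
  shows "(L2_norm m (\<lambda>x. f x - g x))\<^sup>2 =
    (L2_norm m f)\<^sup>2 + (L2_norm m g)\<^sup>2 - 2 * Re (L2_inner m f g)"
proof -
  have "L2_inner m (\<lambda>x. f x - g x) (\<lambda>x. f x - g x) =
     L2_inner m f f - L2_inner m f g - (cnj (L2_inner m f g) - L2_inner m g g)"
    using assms by (simp add: L2_inner_diff_left L2_inner_diff_right L2_diff L2_inner_cnj)
  then have "Re (L2_inner m (\<lambda>x. f x - g x) (\<lambda>x. f x - g x)) =
     Re (L2_inner m f f) + Re (L2_inner m g g) - 2 * Re (L2_inner m f g)"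
    by simp
  then show ?thesis unfolding L2_inner_self by simp
qed

lemma L2_norm_add_square:
  assumes "f \<in> L2 m" "g \<in> L2 m"
  shows "(L2_norm m (\<lambda>x. f x + g x))\<^sup>2 =
    (L2_norm m f)\<^sup>2 + (L2_norm m g)\<^sup>2 + 2 * Re (L2_inner m f g)"
proof -
  have "L2_inner m (\<lambda>x. f x + g x) (\<lambda>x. f x + g x) =
     L2_inner m f f + L2_inner m f g + (cnj (L2_inner m f g) + L2_inner m g g)"
    using assms by (simp add: L2_inner_add_left L2_inner_add_right L2_add L2_inner_cnj)
  then have "Re (L2_inner m (\<lambda>x. f x + g x) (\<lambda>x. f x + g x)) =
     Re (L2_inner m f f) + Re (L2_inner m g g) + 2 * Re (L2_inner m f g)"
    by simp
  then show ?thesis unfolding L2_inner_self by simp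
qed

lemma L2_norm_scale: "L2_norm m (\<lambda>x. c * f x) = cmod c * L2_norm m f"
  by (simp add: L2_norm_def norm_mult power_mult_distrib real_sqrt_mult)

lemma L2_norm_minus_commute: "L2_norm m (\<lambda>x. f x - g x) = L2_norm m (\<lambda>x. g x - f x)"
  by (simp add: L2_norm_def norm_minus_commute)

lemma L2_Cauchy_Schwarz:
  assumes f: "f \<in> L2 m" and g: "g \<in> L2 m"
  shows "cmod (L2_inner m f g) \<le> L2_norm m f * L2_norm m g"
proof (cases "L2_norm m g = 0")
  case True
  then have "L2_inner m f g = L2_inner m f (\<lambda>_. 0)"
    using f g by (intro L2_inner_ae_cong) (simp_all add: ae_eq_iff_norm L2_const, simp add: ae_eq_def)
  then show ?thesis by simp
next
  case False
  define N where "N = (L2_norm m g)\<^sup>2"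
  define a where "a = L2_inner m f g"
  have N: "N > 0" using False by (simp add: N_def)
  \<comment> \<open>The coefficient of the orthogonal projection of \<open>f\<close> onto
    \<open>g\<close>; the inequality says that the remainder has nonnegative squared norm.\<close>
  define c where "c = a / of_real N"
  have "0 \<le> (L2_norm m (\<lambda>x. f x - c * g x))\<^sup>2" by simp
  also have "\<dots> = (L2_norm m f)\<^sup>2 + (cmod c)\<^sup>2 * N - 2 * Re (cnj c * a)"
    using f g by (simp add: L2_norm_diff_square L2_scale L2_norm_scale power_mult_distrib
      N_def L2_inner_scale_right a_def)
  also have "cnj c * a = of_real ((cmod a)\<^sup>2 / N)"
    using complex_norm_square[of a] by (simp add: c_def mult.commute)
  also have "(cmod c)\<^sup>2 * N = (cmod a)\<^sup>2 / N"
    using N by (simp add: c_def norm_divide power_divide power2_eq_square)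
  finally have "(cmod a)\<^sup>2 / N \<le> (L2_norm m f)\<^sup>2" by simp
  then have "(cmod a)\<^sup>2 \<le> (L2_norm m f * L2_norm m g)\<^sup>2"
    using N by (simp add: divide_le_eq power_mult_distrib N_def)
  then show ?thesis unfolding a_def by (rule power2_le_imp_le) simp
qed

lemma L2_norm_triangle:
  assumes "f \<in> L2 m" "g \<in> L2 m"
  shows "L2_norm m (\<lambda>x. f x + g x) \<le> L2_norm m f + L2_norm m g"
proof (rule power2_le_imp_le)
  have "Re (L2_inner m f g) \<le> L2_norm m f * L2_norm m g"
    using L2_Cauchy_Schwarz[OF assms] complex_Re_le_cmod order_trans by blast
  then show "(L2_norm m (\<lambda>x. f x + g x))\<^sup>2 \<le> (L2_norm m f + L2_norm m g)\<^sup>2"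
    using assms by (simp add: L2_norm_add_square power2_sum)
qed simp

lemma L2_norm_ae_cong:
  assumes "f \<in> L2 m" "g \<in> L2 m" "ae_eq m f g"
  shows "L2_norm m f = L2_norm m g"
proof -
  have "complex_of_real ((L2_norm m f)\<^sup>2) = of_real ((L2_norm m g)\<^sup>2)"
    using L2_inner_ae_cong[OF assms(1,2,1,2,3,3)] by (simp add: L2_inner_self)
  then have "(L2_norm m f)\<^sup>2 = (L2_norm m g)\<^sup>2" using of_real_eq_iff by blast
  then show ?thesis by simp
qed

lemma L2_inner_tendsto:
  assumes s: "\<And>n. s n \<in> L2 m" and f: "f \<in> L2 m" and g: "g \<in> L2 m"
    and lim: "(\<lambda>n. L2_norm m (\<lambda>x. s n x - f x)) \<longlonglongrightarrow> 0"
  shows "(\<lambda>n. L2_inner m (s n) g) \<longlonglongrightarrow> L2_inner m f g"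
proof (rule LIM_zero_cancel, rule Lim_null_comparison)
  show "\<forall>\<^sub>F n in sequentially. norm (L2_inner m (s n) g - L2_inner m f g)
      \<le> L2_norm m (\<lambda>x. s n x - f x) * L2_norm m g"
    using L2_Cauchy_Schwarz[OF L2_diff[OF s f] g] s f g by (simp add: L2_inner_diff_left)
  show "(\<lambda>n. L2_norm m (\<lambda>x. s n x - f x) * L2_norm m g) \<longlonglongrightarrow> 0"
    using tendsto_mult_right[OF lim, of "L2_norm m g"] by simp
qed

lemma L2_inner_cong: "(\<And>x. x \<in> space (unit_cube m) \<Longrightarrow> f x = f' x) \<Longrightarrow>
    (\<And>x. x \<in> space (unit_cube m) \<Longrightarrow> g x = g' x) \<Longrightarrow> L2_inner m f g = L2_inner m f' g'"
  unfolding L2_inner_def by (rule Bochner_Integration.integral_cong) auto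

text \<open>Riesz-Fischer: a subsequence with increments below \<open>(1/2)^k\<close> in norm
  converges absolutely almost everywhere, and Fatou's lemma turns the pointwise limit into a norm
  limit of the whole sequence.\<close>

lemma L2_complete:
  assumes s: "\<And>n. s n \<in> L2 m"
    and Cauchy: "\<And>e. e > 0 \<Longrightarrow> \<exists>N. \<forall>i\<ge>N. \<forall>j\<ge>N. L2_norm m (\<lambda>x. s i x - s j x) < e"
  obtains f where "f \<in> L2 m" "(\<lambda>n. L2_norm m (\<lambda>x. s n x - f x)) \<longlonglongrightarrow> 0"
proof -
  interpret prob_space "unit_cube m" by (rule prob_space_unit_cube)
  note [measurable] = s[THEN L2_measurable]
  have "\<forall>k. \<exists>N. \<forall>i\<ge>N. \<forall>j\<ge>N. L2_norm m (\<lambda>x. s i x - s j x) < (1/2)^k"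
    using Cauchy by simp
  then obtain N where N: "\<And>k i j. i \<ge> N k \<Longrightarrow> j \<ge> N k \<Longrightarrow> L2_norm m (\<lambda>x. s i x - s j x) < (1/2)^k"
    by metis
  \<comment> \<open>The partial sums push both \<open>r k\<close> and \<open>r (Suc k)\<close>
    beyond \<open>N k\<close>; the summand \<open>k\<close> makes \<open>r\<close> pass every fixed
    threshold, as the Fatou step requires.\<close>
  define r where "r k = (\<Sum>i\<le>k. N i) + k" for k
  have r_ge: "r k \<ge> N k" "r k \<ge> k" "r (Suc k) \<ge> N k" for k
    unfolding r_def using member_le_sum[of k "{..k}" N] by (auto intro: order_trans)
  define d where "d k x = s (r (Suc k)) x - s (r k) x" for k x
  have dL2: "d k \<in> L2 m" for k unfolding d_def using s by (rule L2_diff) (rule s)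
  have [measurable]: "d k \<in> borel_measurable (unit_cube m)" for k
    using dL2 by (rule L2_measurable)
  have d_norm: "L2_norm m (d k) < (1/2)^k" for k
    unfolding d_def by (rule N) (use r_ge in auto)
  \<comment> \<open>On a probability space the L1 norm is at most the L2 norm, by Cauchy-Schwarz
    against the constant 1.\<close>
  have d_int: "(\<integral>\<^sup>+x. ennreal (cmod (d k x)) \<partial>unit_cube m) \<le> ennreal ((1/2)^k)" for k
  proof -
    have abs_L2: "(\<lambda>x. complex_of_real (cmod (d k x))) \<in> L2 m"
      using dL2 by (rule L2_cong_bound[where C=1, rotated]) auto
    have int: "integrable (unit_cube m) (\<lambda>x. cmod (d k x))"
      using integrable_norm[OF L2_integrable_mult_cnj[OF dL2 L2_const[of 1]]] by simp
    have "(LINT x|unit_cube m. cmod (d k x)) = cmod (L2_inner m (\<lambda>x. complex_of_real (cmod (d k x))) (\<lambda>_. 1))"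
      unfolding L2_inner_def by simp
    also have "\<dots> \<le> L2_norm m (\<lambda>x. complex_of_real (cmod (d k x))) * L2_norm m (\<lambda>_. 1)"
      by (rule L2_Cauchy_Schwarz[OF abs_L2 L2_const])
    also have "\<dots> = L2_norm m (d k)" by (simp add: L2_norm_def prob_space)
    finally have "(LINT x|unit_cube m. cmod (d k x)) \<le> (1/2)^k" using d_norm[of k] by simp
    then show ?thesis using int by (simp add: nn_integral_eq_integral ennreal_leI)
  qed
  have "(\<integral>\<^sup>+x. (\<Sum>k. ennreal (cmod (d k x))) \<partial>unit_cube m) = (\<Sum>k. \<integral>\<^sup>+x. ennreal (cmod (d k x)) \<partial>unit_cube m)"
    by (rule nn_integral_suminf) measurable
  also have "\<dots> \<le> (\<Sum>k. ennreal ((1/2)^k))" by (intro suminf_le d_int summableI)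
  also have "\<dots> = ennreal (\<Sum>k. (1/2)^k)" by (intro suminf_ennreal2 summable_geometric) auto
  also have "\<dots> < \<infinity>" by simp
  finally have "AE x in unit_cube m. (\<Sum>k. ennreal (cmod (d k x))) \<noteq> \<infinity>"
    by (intro nn_integral_PInf_AE) auto
  then have AE_conv: "AE x in unit_cube m. convergent (\<lambda>k. s (r k) x)"
  proof eventually_elim
    case (elim x)
    then have "summable (\<lambda>k. cmod (d k x))"
      by (intro summable_suminf_not_top) auto
    then have "summable (\<lambda>k. d k x)" by (rule summable_norm_cancel)
    then have "convergent (\<lambda>n. \<Sum>k<n. d k x)" by (simp add: summable_iff_convergent)
    moreover have "(\<Sum>k<n. d k x) = s (r n) x - s (r 0) x" for n
      unfolding d_def by (rule sum_lessThan_telescope)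
    ultimately have "convergent (\<lambda>n. (s (r n) x - s (r 0) x) + s (r 0) x)"
      by (intro convergent_add convergent_const) simp
    then show ?case by simp
  qed
  \<comment> \<open>Where the subsequence diverges, \<open>lim\<close> is an unspecified value; this
    happens only on a null set.\<close>
  define f where "f x = lim (\<lambda>k. s (r k) x)" for x
  have [measurable]: "f \<in> borel_measurable (unit_cube m)"
    unfolding f_def by (rule borel_measurable_lim_metric) measurable
  have AE_lim: "AE x in unit_cube m. (\<lambda>k. s (r k) x) \<longlonglongrightarrow> f x"
    using AE_conv by eventually_elim (simp add: f_def convergent_LIMSEQ_iff)
  have bound: "(\<integral>\<^sup>+x. ennreal ((cmod (s n x - f x))\<^sup>2) \<partial>unit_cube m) \<le> ennreal (e\<^sup>2)"
    if e: "e > 0" and n: "\<forall>i\<ge>K. \<forall>j\<ge>K. L2_norm m (\<lambda>x. s i x - s j x) < e" "n \<ge> K" for e n K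
  proof -
    have "(\<integral>\<^sup>+x. ennreal ((cmod (s n x - f x))\<^sup>2) \<partial>unit_cube m) =
        (\<integral>\<^sup>+x. liminf (\<lambda>k. ennreal ((cmod (s n x - s (r k) x))\<^sup>2)) \<partial>unit_cube m)"
    proof (rule nn_integral_cong_AE)
      show "AE x in unit_cube m. ennreal ((cmod (s n x - f x))\<^sup>2) =
          liminf (\<lambda>k. ennreal ((cmod (s n x - s (r k) x))\<^sup>2))"
        using AE_lim
      proof eventually_elim
        case (elim x)
        then have "(\<lambda>k. ennreal ((cmod (s n x - s (r k) x))\<^sup>2)) \<longlonglongrightarrow> ennreal ((cmod (s n x - f x))\<^sup>2)"
          by (intro tendsto_intros tendsto_ennrealI)
        then show ?case by (rule lim_imp_Liminf[OF trivial_limit_sequentially, symmetric])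
      qed
    qed
    also have "\<dots> \<le> liminf (\<lambda>k. \<integral>\<^sup>+x. ennreal ((cmod (s n x - s (r k) x))\<^sup>2) \<partial>unit_cube m)"
      by (rule nn_integral_liminf) measurable
    also have "\<dots> \<le> ennreal (e\<^sup>2)"
    proof (rule order_trans[OF Liminf_mono])
      show "\<forall>\<^sub>F k in sequentially. (\<integral>\<^sup>+x. ennreal ((cmod (s n x - s (r k) x))\<^sup>2) \<partial>unit_cube m) \<le> ennreal (e\<^sup>2)"
      proof (rule eventually_sequentiallyI[of K])
        fix k assume "K \<le> k"
        then have "r k \<ge> K" using r_ge(2)[of k] by linarith
        then have "L2_norm m (\<lambda>x. s n x - s (r k) x) < e" using n by blast
        then have "(L2_norm m (\<lambda>x. s n x - s (r k) x))\<^sup>2 \<le> e\<^sup>2"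
          by (intro power_mono) auto
        moreover have "integrable (unit_cube m) (\<lambda>x. (cmod (s n x - s (r k) x))\<^sup>2)"
          by (intro L2_square_integrable L2_diff s)
        ultimately show "(\<integral>\<^sup>+x. ennreal ((cmod (s n x - s (r k) x))\<^sup>2) \<partial>unit_cube m) \<le> ennreal (e\<^sup>2)"
          by (simp add: nn_integral_eq_integral L2_norm_square ennreal_leI)
      qed
      show "liminf (\<lambda>k. ennreal (e\<^sup>2)) \<le> ennreal (e\<^sup>2)" by (simp add: Liminf_const)
    qed
    finally show ?thesis .
  qed
  have diff_L2: "(\<lambda>x. s n x - f x) \<in> L2 m" and diff_norm: "L2_norm m (\<lambda>x. s n x - f x) \<le> e"
    if e: "e > 0" and n: "\<forall>i\<ge>K. \<forall>j\<ge>K. L2_norm m (\<lambda>x. s i x - s j x) < e" "n \<ge> K" for e n K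
  proof -
    have int: "integrable (unit_cube m) (\<lambda>x. (cmod (s n x - f x))\<^sup>2)"
      by (rule integrableI_bounded)
         (use bound[OF that] in \<open>auto simp: less_top intro: le_less_trans\<close>)
    then show "(\<lambda>x. s n x - f x) \<in> L2 m" by (simp add: L2_def)
    have "(LINT x|unit_cube m. (cmod (s n x - f x))\<^sup>2) \<le> e\<^sup>2"
      using bound[OF that] int by (simp add: nn_integral_eq_integral)
    then show "L2_norm m (\<lambda>x. s n x - f x) \<le> e"
      unfolding L2_norm_def using e by (intro real_le_lsqrt) auto
  qed
  obtain K where K: "\<forall>i\<ge>K. \<forall>j\<ge>K. L2_norm m (\<lambda>x. s i x - s j x) < 1"
    using Cauchy[of 1] by auto
  have "(\<lambda>x. s K x - (s K x - f x)) \<in> L2 m"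
    by (intro L2_diff s diff_L2[OF _ K]) auto
  then have fL2: "f \<in> L2 m" by simp
  have "(\<lambda>n. L2_norm m (\<lambda>x. s n x - f x)) \<longlonglongrightarrow> 0"
  proof (rule LIMSEQ_I)
    fix e :: real assume e: "e > 0"
    obtain K where K: "\<forall>i\<ge>K. \<forall>j\<ge>K. L2_norm m (\<lambda>x. s i x - s j x) < e / 2"
      using Cauchy[of "e/2"] e by auto
    then have "\<forall>n\<ge>K. norm (L2_norm m (\<lambda>x. s n x - f x) - 0) < e"
      using diff_norm[OF _ K] e by fastforce
    then show "\<exists>K. \<forall>n\<ge>K. norm (L2_norm m (\<lambda>x. s n x - f x) - 0) < e" ..
  qed
  with fL2 show thesis by (rule that)
qed

section \<open>Closed subspaces, orthogonal projection and Riesz representation\<close>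

lemma
  assumes "closed_subspace m M"
  shows closed_subspace_subset: "M \<subseteq> L2 m"
    and closed_subspace_zero: "(\<lambda>_. 0) \<in> M"
    and closed_subspace_add: "\<And>f g. f \<in> M \<Longrightarrow> g \<in> M \<Longrightarrow> (\<lambda>x. f x + g x) \<in> M"
    and closed_subspace_scale: "\<And>c f. f \<in> M \<Longrightarrow> (\<lambda>x. c * f x) \<in> M"
    and closed_subspace_limit: "\<And>s f. (\<And>n::nat. s n \<in> M) \<Longrightarrow> f \<in> L2 m \<Longrightarrow>
        (\<lambda>n. L2_norm m (\<lambda>x. s n x - f x)) \<longlonglongrightarrow> 0 \<Longrightarrow> f \<in> M"
  using assms unfolding closed_subspace_def L2_subspace_def L2_closed_def by blast+

lemma closed_subspaceI:
  assumes "M \<subseteq> L2 m" "(\<lambda>_. 0) \<in> M"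
    and "\<And>f g. f \<in> M \<Longrightarrow> g \<in> M \<Longrightarrow> (\<lambda>x. f x + g x) \<in> M"
    and "\<And>c f. f \<in> M \<Longrightarrow> (\<lambda>x. c * f x) \<in> M"
    and "\<And>s f. (\<And>n::nat. s n \<in> M) \<Longrightarrow> f \<in> L2 m \<Longrightarrow>
        (\<lambda>n. L2_norm m (\<lambda>x. s n x - f x)) \<longlonglongrightarrow> 0 \<Longrightarrow> f \<in> M"
  shows "closed_subspace m M"
  using assms unfolding closed_subspace_def L2_subspace_def L2_closed_def by blast

lemma closed_subspace_diff:
  "closed_subspace m M \<Longrightarrow> f \<in> M \<Longrightarrow> g \<in> M \<Longrightarrow> (\<lambda>x. f x - g x) \<in> M"
  using closed_subspace_add[of m M f "\<lambda>x. - 1 * g x"] closed_subspace_scale[of m M g "-1"] by simp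

lemma closed_subspace_sum:
  "closed_subspace m M \<Longrightarrow> (\<And>i. i \<in> A \<Longrightarrow> F i \<in> M) \<Longrightarrow> (\<lambda>x. \<Sum>i\<in>A. F i x) \<in> M"
  by (induction A rule: infinite_finite_induct)
     (auto intro: closed_subspace_zero closed_subspace_add)

text \<open>The constant sequence \<open>f\<close> converges in norm to every function a.e. equal to
  it, so closedness alone forces saturation.\<close>

lemma closed_subspace_ae_cong:
  assumes M: "closed_subspace m M" and f: "f \<in> M" and g: "g \<in> L2 m" and eq: "ae_eq m f g"
  shows "g \<in> M"
proof (rule closed_subspace_limit[OF M])
  have "f \<in> L2 m" using closed_subspace_subset[OF M] f by auto
  then have "L2_norm m (\<lambda>x. f x - g x) = 0"
    using g eq by (simp add: ae_eq_diff_iff flip: ae_eq_iff_norm[OF L2_diff])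
  then show "(\<lambda>n::nat. L2_norm m (\<lambda>x. f x - g x)) \<longlonglongrightarrow> 0" by simp
qed (use f g in auto)

lemma closed_subspace_L2: "closed_subspace m (L2 m)"
  by (rule closed_subspaceI) (auto intro: L2_const L2_add L2_scale)

lemma closed_subspace_Inter:
  assumes "\<F> \<noteq> {}" "\<And>M. M \<in> \<F> \<Longrightarrow> closed_subspace m M"
  shows "closed_subspace m (\<Inter>\<F>)"
proof (rule closed_subspaceI)
  show "\<Inter>\<F> \<subseteq> L2 m" using assms closed_subspace_subset by blast
  show "(\<lambda>_. 0) \<in> \<Inter>\<F>" using assms closed_subspace_zero by blast
  show "(\<lambda>x. f x + g x) \<in> \<Inter>\<F>" if "f \<in> \<Inter>\<F>" "g \<in> \<Inter>\<F>" for f g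
    using that assms closed_subspace_add by blast
  show "(\<lambda>x. c * f x) \<in> \<Inter>\<F>" if "f \<in> \<Inter>\<F>" for c f
    using that assms closed_subspace_scale by blast
  show "f \<in> \<Inter>\<F>" if "\<And>n::nat. s n \<in> \<Inter>\<F>" "f \<in> L2 m"
    "(\<lambda>n. L2_norm m (\<lambda>x. s n x - f x)) \<longlonglongrightarrow> 0" for s f
  proof
    fix M assume "M \<in> \<F>"
    with that(1) have "s n \<in> M" for n by blast
    then show "f \<in> M" by (rule closed_subspace_limit[OF assms(2)[OF \<open>M \<in> \<F>\<close>] _ that(2,3)])
  qed
qed

lemma closed_subspace_Int:
  "closed_subspace m M \<Longrightarrow> closed_subspace m N \<Longrightarrow> closed_subspace m (M \<inter> N)"
  using closed_subspace_Inter[of "{M, N}" m] by auto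

lemma closed_subspace_span: "S \<subseteq> L2 m \<Longrightarrow> closed_subspace m (closed_span m S)"
  unfolding closed_span_def by (rule closed_subspace_Inter) (use closed_subspace_L2 in auto)

lemma closed_span_superset: "S \<subseteq> closed_span m S"
  by (auto simp: closed_span_def)

lemma closed_span_least: "closed_subspace m M \<Longrightarrow> S \<subseteq> M \<Longrightarrow> closed_span m S \<subseteq> M"
  by (auto simp: closed_span_def)

lemma closed_subspace_orthogonal:
  assumes "S \<subseteq> L2 m"
  shows "closed_subspace m {f \<in> L2 m. \<forall>g\<in>S. L2_inner m f g = 0}"
proof (rule closed_subspaceI)
  fix s f assume s: "\<And>n::nat. s n \<in> {f \<in> L2 m. \<forall>g\<in>S. L2_inner m f g = 0}" and f: "f \<in> L2 m"
    and lim: "(\<lambda>n. L2_norm m (\<lambda>x. s n x - f x)) \<longlonglongrightarrow> 0"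
  have "L2_inner m f g = 0" if g: "g \<in> S" for g
  proof -
    have "(\<lambda>n. L2_inner m (s n) g) \<longlonglongrightarrow> L2_inner m f g"
      using s f g assms lim by (intro L2_inner_tendsto) auto
    then show ?thesis using s g by (simp add: LIMSEQ_const_iff)
  qed
  then show "f \<in> {f \<in> L2 m. \<forall>g\<in>S. L2_inner m f g = 0}" using f by simp
qed (use assms in \<open>auto simp: L2_const L2_add L2_scale subset_iff L2_inner_add_left L2_inner_scale_left\<close>)

lemma L2_inner_eq_0_commute: "L2_inner m f g = 0 \<longleftrightarrow> L2_inner m g f = 0"
  using L2_inner_cnj[of m f g] L2_inner_cnj[of m g f] by auto

text \<open>Completeness provides a nearest point of \<open>M\<close>, and its residual is
  orthogonal to \<open>M\<close> because no move along a vector of \<open>M\<close> can shorten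
  it.\<close>

lemma orthogonal_projection:
  assumes M: "closed_subspace m M" and f: "f \<in> L2 m"
  obtains p where "p \<in> M" "(\<lambda>x. f x - p x) \<in> L2 m"
    "\<And>g. g \<in> M \<Longrightarrow> L2_inner m (\<lambda>x. f x - p x) g = 0"
proof -
  have ML2: "g \<in> L2 m" if "g \<in> M" for g using closed_subspace_subset[OF M] that by auto
  define D where "D = (\<lambda>g. (L2_norm m (\<lambda>x. f x - g x))\<^sup>2) ` M"
  define d where "d = Inf D"
  have D: "D \<noteq> {}" "bdd_below D"
    using closed_subspace_zero[OF M] by (auto simp: D_def intro!: bdd_belowI[of _ 0])
  have d_le: "d \<le> (L2_norm m (\<lambda>x. f x - g x))\<^sup>2" if "g \<in> M" for g
    unfolding d_def using that D by (intro cInf_lower) (auto simp: D_def)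
  have "\<exists>g\<in>M. (L2_norm m (\<lambda>x. f x - g x))\<^sup>2 < d + 1 / Suc n" for n
  proof -
    have "Inf D < d + 1 / Suc n" by (simp add: d_def)
    from cInf_lessD[OF D(1) this] show ?thesis by (auto simp: D_def)
  qed
  then obtain s where s: "\<And>n. s n \<in> M" and s_d: "\<And>n. (L2_norm m (\<lambda>x. f x - s n x))\<^sup>2 < d + 1 / Suc n"
    by metis
  have s_L2: "s n \<in> L2 m" for n using s ML2 by blast
  \<comment> \<open>By the parallelogram law a minimizing sequence is Cauchy.\<close>
  have close: "(L2_norm m (\<lambda>x. s i x - s j x))\<^sup>2 \<le> 2 / Suc i + 2 / Suc j" for i j
  proof -
    let ?a = "\<lambda>x. f x - s i x" and ?b = "\<lambda>x. f x - s j x"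
    have ab: "?a \<in> L2 m" "?b \<in> L2 m" using f s_L2 by (auto intro: L2_diff)
    have mid: "(\<lambda>x. (1/2) * (s i x + s j x)) \<in> M"
      using M s by (intro closed_subspace_scale closed_subspace_add)
    have "(L2_norm m (\<lambda>x. ?a x + ?b x))\<^sup>2 = (L2_norm m (\<lambda>x. 2 * (f x - (1/2) * (s i x + s j x))))\<^sup>2"
      by (simp add: algebra_simps)
    also have "\<dots> = 4 * (L2_norm m (\<lambda>x. f x - (1/2) * (s i x + s j x)))\<^sup>2"
      unfolding L2_norm_scale by (simp add: power_mult_distrib)
    also have "\<dots> \<ge> 4 * d" using d_le[OF mid] by simp
    finally have "4 * d \<le> (L2_norm m (\<lambda>x. ?a x + ?b x))\<^sup>2" .
    moreover have "(L2_norm m (\<lambda>x. ?b x - ?a x))\<^sup>2 = (L2_norm m (\<lambda>x. s i x - s j x))\<^sup>2"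
      by simp
    moreover have "(L2_norm m (\<lambda>x. ?a x - ?b x))\<^sup>2 + (L2_norm m (\<lambda>x. ?a x + ?b x))\<^sup>2 =
        2 * (L2_norm m ?a)\<^sup>2 + 2 * (L2_norm m ?b)\<^sup>2"
      using ab by (simp only: L2_norm_diff_square L2_norm_add_square)
    moreover have "L2_norm m (\<lambda>x. ?a x - ?b x) = L2_norm m (\<lambda>x. ?b x - ?a x)"
      by (rule L2_norm_minus_commute)
    ultimately show ?thesis using s_d[of i] s_d[of j] by simp
  qed
  have "\<exists>N. \<forall>i\<ge>N. \<forall>j\<ge>N. L2_norm m (\<lambda>x. s i x - s j x) < e" if e: "e > 0" for e
  proof -
    obtain N where N: "4 / e\<^sup>2 < real (Suc N)" using reals_Archimedean2[of "4 / e\<^sup>2"]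
      by (metis less_Suc_eq_le of_nat_le_iff order_le_less_trans less_imp_le order_less_le_trans lessI of_nat_less_iff)
    have "L2_norm m (\<lambda>x. s i x - s j x) < e" if "i \<ge> N" "j \<ge> N" for i j
    proof -
      have "2 / real (Suc i) \<le> 2 / Suc N" "2 / real (Suc j) \<le> 2 / Suc N"
        using that by (auto intro!: divide_left_mono)
      then have "(L2_norm m (\<lambda>x. s i x - s j x))\<^sup>2 \<le> 4 / Suc N" using close[of i j] by simp
      also have "\<dots> < e\<^sup>2" using N e by (simp add: divide_less_eq mult.commute)
      finally show ?thesis using e by (simp add: power2_less_imp_less)
    qed
    then show ?thesis by blast
  qed
  from L2_complete[OF s_L2 this] obtain p where p: "p \<in> L2 m"
    and lim: "(\<lambda>n. L2_norm m (\<lambda>x. s n x - p x)) \<longlonglongrightarrow> 0"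
    by blast
  have pM: "p \<in> M" by (rule closed_subspace_limit[OF M s p lim])
  define q where "q x = f x - p x" for x
  have q: "q \<in> L2 m" unfolding q_def using f p by (rule L2_diff)
  have q_d: "(L2_norm m q)\<^sup>2 \<le> d"
  proof -
    have "L2_norm m q \<le> sqrt (d + 1 / Suc n) + L2_norm m (\<lambda>x. s n x - p x)" for n
    proof -
      have "L2_norm m (\<lambda>x. (f x - s n x) + (s n x - p x)) \<le>
          L2_norm m (\<lambda>x. f x - s n x) + L2_norm m (\<lambda>x. s n x - p x)"
        by (intro L2_norm_triangle L2_diff f p s_L2)
      moreover have "L2_norm m (\<lambda>x. f x - s n x) \<le> sqrt (d + 1 / Suc n)"
        using s_d[of n] by (intro real_le_rsqrt) simp
      ultimately show ?thesis by (simp add: q_def[abs_def])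
    qed
    moreover have "(\<lambda>n. sqrt (d + 1 / Suc n) + L2_norm m (\<lambda>x. s n x - p x)) \<longlonglongrightarrow> sqrt (d + 0) + 0"
      by (intro tendsto_intros lim LIMSEQ_Suc[OF lim_1_over_n])
    ultimately have "L2_norm m q \<le> sqrt d"
      by (intro LIMSEQ_le_const) auto
    moreover have "0 \<le> d" unfolding d_def using D by (intro cInf_greatest) (auto simp: D_def)
    ultimately show ?thesis using power_mono[of "L2_norm m q" "sqrt d" 2] by simp
  qed
  have orth: "L2_inner m q g = 0" if g: "g \<in> M" for g
  proof (rule ccontr)
    assume nz: "L2_inner m q g \<noteq> 0"
    define a where "a = L2_inner m q g"
    \<comment> \<open>Minimality would force \<open>t * (L2_norm m g)\<^sup>2\<close> to be at least
      2, while this \<open>t\<close> keeps it at most 1; the added 1 keeps the denominator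
      positive.\<close>
    define t where "t = 1 / ((L2_norm m g)\<^sup>2 + 1)"
    define c where "c = of_real t * a"
    have tpos: "t > 0" unfolding t_def by (simp add: add_nonneg_pos)
    have gL2: "g \<in> L2 m" using g by (rule ML2)
    have "(\<lambda>x. p x + c * g x) \<in> M" using M pM g by (intro closed_subspace_add closed_subspace_scale)
    then have "d \<le> (L2_norm m (\<lambda>x. q x - c * g x))\<^sup>2"
      using d_le by (fastforce simp: q_def[abs_def] algebra_simps)
    also have "\<dots> = (L2_norm m q)\<^sup>2 + (cmod c)\<^sup>2 * (L2_norm m g)\<^sup>2 - 2 * Re (cnj c * a)"
      using q gL2 by (simp add: L2_norm_diff_square L2_scale L2_norm_scale power_mult_distrib
        L2_inner_scale_right a_def)
    also have "cnj c * a = of_real (t * (cmod a)\<^sup>2)"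
      using complex_norm_square[of a] by (simp add: c_def mult.commute mult.left_commute)
    also have "(cmod c)\<^sup>2 = t\<^sup>2 * (cmod a)\<^sup>2" by (simp add: c_def norm_mult power_mult_distrib)
    finally have "2 * (t * (cmod a)\<^sup>2) \<le> t * (cmod a)\<^sup>2 * (t * (L2_norm m g)\<^sup>2)"
      using q_d by (simp add: power2_eq_square ac_simps)
    then have "2 \<le> t * (L2_norm m g)\<^sup>2"
      using tpos nz by (simp add: a_def)
    moreover have "t * (L2_norm m g)\<^sup>2 \<le> 1" by (simp add: t_def divide_le_eq add_nonneg_pos)
    ultimately show False by simp
  qed
  show thesis by (rule that[OF pM]) (use q orth in \<open>auto simp: q_def[abs_def]\<close>)
qed

text \<open>The residual of the projection of \<open>f\<close> is orthogonal to \<open>M\<close>,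
  hence to \<open>f\<close>, hence to itself. This is the form in which weak closedness of
  \<open>M\<close> is used: limits of inner products suffice to place \<open>f\<close> in
  \<open>M\<close>.\<close>

lemma closed_subspace_biorthogonal:
  assumes M: "closed_subspace m M" and f: "f \<in> L2 m"
    and orth: "\<And>q. q \<in> L2 m \<Longrightarrow> (\<And>g. g \<in> M \<Longrightarrow> L2_inner m g q = 0) \<Longrightarrow> L2_inner m f q = 0"
  shows "f \<in> M"
proof -
  obtain p where p: "p \<in> M" "(\<lambda>x. f x - p x) \<in> L2 m"
    "\<And>g. g \<in> M \<Longrightarrow> L2_inner m (\<lambda>x. f x - p x) g = 0"
    using orthogonal_projection[OF M f] by blast
  let ?q = "\<lambda>x. f x - p x"
  have pL2: "p \<in> L2 m" using closed_subspace_subset[OF M] p(1) by auto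
  have 1: "L2_inner m g ?q = 0" if "g \<in> M" for g
    using p(3)[OF that] L2_inner_eq_0_commute by blast
  have "L2_inner m ?q ?q = 0"
    using orth[OF p(2) 1] 1[OF p(1)] L2_inner_diff_left[OF f pL2 p(2)] by simp
  then have "ae_eq m ?q (\<lambda>_. 0)"
    using ae_eq_iff_norm[OF p(2)] by (simp add: L2_inner_self)
  then have "ae_eq m f p" by (simp add: ae_eq_diff_iff)
  then show ?thesis using closed_subspace_ae_cong[OF M p(1) f] ae_eq_sym by blast
qed

text \<open>Needed for intertwining operators: applied to
  \<open>f \<mapsto> L2_inner m (T f) w\<close> it produces the value at \<open>w\<close> of the
  adjoint of \<open>T\<close>.\<close>

lemma Riesz_representation:
  assumes H: "closed_subspace m H"
    and add: "\<And>f g. f \<in> H \<Longrightarrow> g \<in> H \<Longrightarrow> L (\<lambda>x. f x + g x) = L f + L g"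
    and scale: "\<And>c f. f \<in> H \<Longrightarrow> L (\<lambda>x. c * f x) = c * L f"
    and bound: "\<And>f. f \<in> H \<Longrightarrow> cmod (L f) \<le> C * L2_norm m f"
  obtains r where "r \<in> L2 m" "\<And>f. f \<in> H \<Longrightarrow> L f = L2_inner m f r"
proof (cases "\<forall>f\<in>H. L f = 0")
  case True
  then show thesis using that[of "\<lambda>_. 0"] by (auto simp: L2_const)
next
  case False
  then obtain f0 where f0: "f0 \<in> H" "L f0 \<noteq> 0" by auto
  have HL2: "f \<in> L2 m" if "f \<in> H" for f using closed_subspace_subset[OF H] that by auto
  have diff: "L (\<lambda>x. f x - g x) = L f - L g" if "f \<in> H" "g \<in> H" for f g
    using add[OF that(1) closed_subspace_scale[OF H that(2), of "-1"]] scale[OF that(2), of "-1"] by simp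
  define N where "N = {f \<in> H. L f = 0}"
  have N: "closed_subspace m N"
  proof (rule closed_subspaceI)
    show "N \<subseteq> L2 m" using HL2 by (auto simp: N_def)
    show "(\<lambda>_. 0) \<in> N"
      using closed_subspace_zero[OF H] scale[OF closed_subspace_zero[OF H], of 0] by (simp add: N_def)
    fix s f assume s: "\<And>n::nat. s n \<in> N" and f: "f \<in> L2 m"
      and lim: "(\<lambda>n. L2_norm m (\<lambda>x. s n x - f x)) \<longlonglongrightarrow> 0"
    have sH: "s n \<in> H" "L (s n) = 0" for n using s by (auto simp: N_def)
    have fH: "f \<in> H" by (rule closed_subspace_limit[OF H sH(1) f lim])
    have "cmod (L f) \<le> C * L2_norm m (\<lambda>x. s n x - f x)" for n
      using bound[OF closed_subspace_diff[OF H sH(1) fH]] diff[OF sH(1) fH] sH(2) by simp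
    moreover have "(\<lambda>n. C * L2_norm m (\<lambda>x. s n x - f x)) \<longlonglongrightarrow> C * 0"
      by (intro tendsto_intros lim)
    ultimately have "cmod (L f) \<le> C * 0" by (intro LIMSEQ_le_const) auto
    then show "f \<in> N" using fH by (simp add: N_def)
  qed (auto simp: N_def add scale intro: closed_subspace_add[OF H] closed_subspace_scale[OF H])
  obtain p where p: "p \<in> N" "(\<lambda>x. f0 x - p x) \<in> L2 m"
    "\<And>g. g \<in> N \<Longrightarrow> L2_inner m (\<lambda>x. f0 x - p x) g = 0"
    using orthogonal_projection[OF N HL2[OF f0(1)]] by blast
  define q where "q = (\<lambda>x. f0 x - p x)"
  have pH: "p \<in> H" "L p = 0" using p(1) by (auto simp: N_def)
  have qH: "q \<in> H" unfolding q_def by (rule closed_subspace_diff[OF H f0(1) pH(1)])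
  have Lq: "L q \<noteq> 0" unfolding q_def using diff[OF f0(1) pH(1)] pH f0 by simp
  have q_nz: "L2_norm m q \<noteq> 0" using bound[OF qH] Lq by auto
  have qL2: "q \<in> L2 m" using qH by (rule HL2)
  have orth: "L2_inner m g q = 0" if "g \<in> N" for g
    using p(3)[OF that] L2_inner_eq_0_commute by (auto simp: q_def)
  \<comment> \<open>The kernel of \<open>L\<close> has codimension one in \<open>H\<close> and
    \<open>q\<close> is orthogonal to it; subtracting the multiple \<open>L f / L q\<close> of
    \<open>q\<close> from \<open>f\<close> lands in the kernel, which fixes the scalar.\<close>
  have "L f = L2_inner m f (\<lambda>x. cnj (L q / of_real ((L2_norm m q)\<^sup>2)) * q x)" if f: "f \<in> H" for f
  proof -
    have "(\<lambda>x. f x - L f / L q * q x) \<in> N"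
    proof -
      have "L (\<lambda>x. f x - L f / L q * q x) = L f - L f / L q * L q"
        using diff[OF f closed_subspace_scale[OF H qH, of "L f / L q"]] scale[OF qH, of "L f / L q"] by simp
      then show ?thesis
        unfolding N_def using closed_subspace_diff[OF H f closed_subspace_scale[OF H qH, of "L f / L q"]] Lq
        by simp
    qed
    from orth[OF this] have "L2_inner m f q = L f / L q * L2_inner m q q"
      unfolding L2_inner_diff_left[OF HL2[OF f] L2_scale[OF qL2] qL2] L2_inner_scale_left
      by (simp only: right_minus_eq)
    then have "L2_inner m f q = L f / L q * of_real ((L2_norm m q)\<^sup>2)" by (simp add: L2_inner_self)
    then show ?thesis using Lq q_nz unfolding L2_inner_scale_right by simp
  qed
  then show thesis by (intro that[of "\<lambda>x. cnj (L q / of_real ((L2_norm m q)\<^sup>2)) * q x"] L2_scale qL2)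
qed

section \<open>Measure-preserving maps\<close>

lemma sets_unit_interval: "A \<in> sets unit_interval \<longleftrightarrow> A \<subseteq> {0..1} \<and> A \<in> sets lebesgue"
  by (simp add: sets_restrict_space_iff)

lemma space_unit_interval [simp]: "space unit_interval = {0..1}"
  by simp

lemma emeasure_unit_interval: "A \<in> sets unit_interval \<Longrightarrow> emeasure unit_interval A = emeasure lebesgue A"
  by (subst emeasure_restrict_space) (auto simp: sets_unit_interval)

definition mp_map :: "(real \<Rightarrow> real) \<Rightarrow> bool" where
  "mp_map \<psi> \<longleftrightarrow> \<psi> \<in> unit_interval \<rightarrow>\<^sub>M unit_interval \<and> distr unit_interval unit_interval \<psi> = unit_interval"

definition cube_mp :: "nat \<Rightarrow> ((nat \<Rightarrow> real) \<Rightarrow> nat \<Rightarrow> real) \<Rightarrow> bool" where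
  "cube_mp m \<Psi> \<longleftrightarrow> \<Psi> \<in> unit_cube m \<rightarrow>\<^sub>M unit_cube m \<and> distr (unit_cube m) (unit_cube m) \<Psi> = unit_cube m"

lemma mp_map_measurable: "mp_map \<psi> \<Longrightarrow> \<psi> \<in> unit_interval \<rightarrow>\<^sub>M unit_interval"
  by (simp add: mp_map_def)

lemma mp_map_emeasure:
  "mp_map \<psi> \<Longrightarrow> A \<in> sets unit_interval \<Longrightarrow>
    emeasure unit_interval (\<psi> -` A \<inter> {0..1}) = emeasure unit_interval A"
  using emeasure_distr[of \<psi> unit_interval unit_interval A] by (simp add: mp_map_def)

lemma mp_map_id: "mp_map (\<lambda>x. x)"
  by (simp add: mp_map_def distr_id[unfolded id_def])

lemma mp_bijections_mp_map: "\<phi> \<in> mp_bijections \<Longrightarrow> mp_map \<phi>"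
  by (simp add: mp_bijections_def mp_map_def)

lemma mp_bijections_inv:
  assumes "\<phi> \<in> mp_bijections"
  shows "inv_into {0..1} \<phi> \<in> mp_bijections"
proof -
  let ?i = "inv_into {0..1} \<phi>"
  from assms have bij: "bij_betw \<phi> {0..1} {0..1}" and meas: "\<phi> \<in> unit_interval \<rightarrow>\<^sub>M unit_interval"
    and imeas: "?i \<in> unit_interval \<rightarrow>\<^sub>M unit_interval" and d: "distr unit_interval unit_interval \<phi> = unit_interval"
    by (auto simp: mp_bijections_def)
  have ibij: "bij_betw ?i {0..1} {0..1}" by (rule bij_betw_inv_into[OF bij])
  have inv_inv: "inv_into {0..1} ?i x = \<phi> x" if "x \<in> {0..1}" for x
    using bij that by (metis bij_betw_def bij_betw_inv_into_left ibij inv_into_f_eq bij_betwE)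
  have "distr unit_interval unit_interval ?i = distr (distr unit_interval unit_interval \<phi>) unit_interval ?i"
    by (simp add: d)
  also have "\<dots> = distr unit_interval unit_interval (?i \<circ> \<phi>)"
    by (rule distr_distr[OF imeas meas])
  also have "\<dots> = distr unit_interval unit_interval (\<lambda>x. x)"
    by (rule distr_cong) (use bij in \<open>auto simp: bij_betw_inv_into_left\<close>)
  finally have "distr unit_interval unit_interval ?i = unit_interval"
    by (simp add: distr_id[unfolded id_def])
  moreover have "inv_into {0..1} ?i \<in> unit_interval \<rightarrow>\<^sub>M unit_interval"
    using meas by (rule measurable_cong[THEN iffD2, rotated]) (auto intro: inv_inv)
  ultimately show ?thesis using ibij imeas by (simp add: mp_bijections_def)
qed

lemma mp_bijections_inv_mp_map: "\<phi> \<in> mp_bijections \<Longrightarrow> mp_map (inv_into {0..1} \<phi>)"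
  by (intro mp_bijections_mp_map mp_bijections_inv)

lemma mp_bijections_inv_right:
  "\<phi> \<in> mp_bijections \<Longrightarrow> x \<in> {0..1} \<Longrightarrow> \<phi> (inv_into {0..1} \<phi> x) = x"
  unfolding mp_bijections_def using bij_betw_inv_into_right by fastforce

lemma product_prob_space_unit_interval: "product_prob_space (\<lambda>_. unit_interval)"
  by (intro product_prob_spaceI prob_space_unit_interval)

text \<open>The preimage of a box is again a box, with sides of the same measures in permuted order.
  One statement covers three uses: the same map in every coordinate (for \<open>rho\<close>), a pure
  permutation of coordinates, and a map moving a single coordinate.\<close>

lemma cube_mp_coordinatewise:
  assumes \<sigma>: "\<sigma> permutes {..<m}" and \<psi>: "\<And>i. i < m \<Longrightarrow> mp_map (\<psi> i)"
  shows "cube_mp m (\<lambda>x. \<lambda>i\<in>{..<m}. \<psi> i (x (\<sigma> i)))"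
proof -
  interpret product_prob_space "\<lambda>_. unit_interval" "{..<m}"
    by (rule product_prob_space_unit_interval)
  let ?P = "PiM {..<m} (\<lambda>_. unit_interval)"
  let ?\<Psi> = "\<lambda>x. \<lambda>i\<in>{..<m}. \<psi> i (x (\<sigma> i))"
  have \<sigma>_lt: "\<sigma> i < m \<longleftrightarrow> i < m" for i using permutes_in_image[OF \<sigma>, of i] by simp
  have meas: "?\<Psi> \<in> ?P \<rightarrow>\<^sub>M ?P"
  proof (rule measurable_restrict)
    fix i assume "i \<in> {..<m}"
    then show "(\<lambda>x. \<psi> i (x (\<sigma> i))) \<in> ?P \<rightarrow>\<^sub>M unit_interval"
      by (intro measurable_compose[OF _ mp_map_measurable[OF \<psi>, of i]] measurable_component_singleton)
        (auto simp: \<sigma>_lt)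
  qed
  have "distr ?P ?P ?\<Psi> = ?P"
  proof (rule PiM_eqI)
    fix A :: "nat \<Rightarrow> real set" assume A: "\<And>i. i \<in> {..<m} \<Longrightarrow> A i \<in> sets unit_interval"
    \<comment> \<open>Coordinate \<open>j\<close> of the argument is read by output coordinate
      \<open>inv \<sigma> j\<close>, which therefore determines the side of the preimage
      box.\<close>
    define B where "B j = \<psi> (inv \<sigma> j) -` A (inv \<sigma> j) \<inter> {0..1}" for j
    have inv_lt: "inv \<sigma> j < m \<longleftrightarrow> j < m" for j
      using permutes_in_image[OF permutes_inv[OF \<sigma>], of j] by simp
    have B: "B j \<in> sets unit_interval" if "j < m" for j
      unfolding B_def using measurable_sets[OF mp_map_measurable[OF \<psi>] A] that by (simp add: inv_lt)
    have "?\<Psi> -` Pi\<^sub>E {..<m} A \<inter> space ?P = Pi\<^sub>E {..<m} B"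
    proof (intro set_eqI iffI)
      fix x assume x: "x \<in> ?\<Psi> -` Pi\<^sub>E {..<m} A \<inter> space ?P"
      then have "\<psi> i (x (\<sigma> i)) \<in> A i" if "i < m" for i using that by (auto simp: PiE_def Pi_def)
      from this[OF inv_lt[THEN iffD2]] x show "x \<in> Pi\<^sub>E {..<m} B"
        by (auto simp: B_def space_PiM PiE_def Pi_def permutes_inverses[OF \<sigma>])
    next
      fix x assume x: "x \<in> Pi\<^sub>E {..<m} B"
      have "\<psi> i (x (\<sigma> i)) \<in> A i" if "i < m" for i
      proof -
        have "x (\<sigma> i) \<in> B (\<sigma> i)" using x that by (auto simp: PiE_def Pi_def \<sigma>_lt)
        then show ?thesis by (simp add: B_def permutes_inverses[OF \<sigma>])
      qed
      then show "x \<in> ?\<Psi> -` Pi\<^sub>E {..<m} A \<inter> space ?P"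
        using x by (auto simp: B_def space_PiM PiE_def Pi_def)
    qed
    then have "emeasure (distr ?P ?P ?\<Psi>) (Pi\<^sub>E {..<m} A) = emeasure ?P (Pi\<^sub>E {..<m} B)"
      using A by (subst emeasure_distr[OF meas]) (auto intro!: sets_PiM_I_finite)
    also have "\<dots> = (\<Prod>j<m. emeasure unit_interval (B j))"
      by (rule emeasure_PiM) (use B in auto)
    also have "\<dots> = (\<Prod>j<m. emeasure unit_interval (A (inv \<sigma> j)))"
      unfolding B_def using A by (intro prod.cong refl mp_map_emeasure \<psi>) (auto simp: inv_lt)
    also have "\<dots> = (\<Prod>i<m. emeasure unit_interval (A i))"
      using prod.permute[OF permutes_inv[OF \<sigma>], of "\<lambda>i. emeasure unit_interval (A i)"]
      by (simp add: comp_def)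
    finally show "emeasure (distr ?P ?P ?\<Psi>) (Pi\<^sub>E {..<m} A) = (\<Prod>i<m. emeasure unit_interval (A i))" .
  qed auto
  note distr = this
  \<comment> \<open>Measurability into the completed cube requires preimages of null sets to be
    null; preservation of the uncompleted product measure provides this.\<close>
  have dc: "distr (completion ?P) ?P ?\<Psi> = ?P"
    using distr_completion[OF meas] distr by simp
  have "completion (distr (completion ?P) ?P ?\<Psi>) = distr (completion ?P) (completion ?P) ?\<Psi>"
    by (rule completion.completion_distr_eq[OF measurable_completion[OF meas]]) (simp add: dc)
  then have "distr (completion ?P) (completion ?P) ?\<Psi> = completion ?P" by (simp add: dc)
  moreover have "?\<Psi> \<in> completion ?P \<rightarrow>\<^sub>M completion ?P"
    by (rule completion.measurable_completion2[OF measurable_completion[OF meas]]) (simp add: dc)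
  ultimately show ?thesis by (simp add: cube_mp_def unit_cube_def)
qed

lemma cube_mp_space: "cube_mp m \<Psi> \<Longrightarrow> x \<in> space (unit_cube m) \<Longrightarrow> \<Psi> x \<in> space (unit_cube m)"
  by (auto simp: cube_mp_def dest: measurable_space)

lemma cube_mp_integral:
  fixes f :: "(nat \<Rightarrow> real) \<Rightarrow> 'b::{banach, second_countable_topology}"
  assumes "cube_mp m \<Psi>" "f \<in> borel_measurable (unit_cube m)"
  shows "(LINT x|unit_cube m. f (\<Psi> x)) = (LINT x|unit_cube m. f x)"
  using integral_distr[of \<Psi> "unit_cube m" "unit_cube m" f] assms by (simp add: cube_mp_def)

lemma cube_mp_L2:
  assumes "cube_mp m \<Psi>" "f \<in> L2 m"
  shows "(\<lambda>x. f (\<Psi> x)) \<in> L2 m"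
proof -
  have \<Psi>: "\<Psi> \<in> unit_cube m \<rightarrow>\<^sub>M unit_cube m" using assms(1) by (simp add: cube_mp_def)
  have "integrable (distr (unit_cube m) (unit_cube m) \<Psi>) (\<lambda>x. (cmod (f x))\<^sup>2)"
    using assms by (simp add: cube_mp_def L2_square_integrable)
  then show ?thesis unfolding L2_def
    using measurable_compose[OF \<Psi> L2_measurable[OF assms(2)]]
      integrable_distr[OF \<Psi>, of "\<lambda>x. (cmod (f x))\<^sup>2"] by simp
qed

lemma cube_mp_inner:
  assumes "cube_mp m \<Psi>" "f \<in> L2 m" "g \<in> L2 m"
  shows "L2_inner m (\<lambda>x. f (\<Psi> x)) (\<lambda>x. g (\<Psi> x)) = L2_inner m f g"
  unfolding L2_inner_def
  by (rule cube_mp_integral[OF assms(1), of "\<lambda>x. f x * cnj (g x)"])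
    (intro borel_measurable_times borel_measurable_cnj L2_measurable assms)

lemma cube_mp_norm:
  assumes "cube_mp m \<Psi>" "f \<in> L2 m"
  shows "L2_norm m (\<lambda>x. f (\<Psi> x)) = L2_norm m f"
  unfolding L2_norm_def
  using cube_mp_integral[OF assms(1), of "\<lambda>x. (cmod (f x))\<^sup>2"] L2_measurable[OF assms(2)] by simp

lemma cube_mp_ae_eq:
  assumes "cube_mp m \<Psi>" "f \<in> L2 m" "g \<in> L2 m" "ae_eq m f g"
  shows "ae_eq m (\<lambda>x. f (\<Psi> x)) (\<lambda>x. g (\<Psi> x))"
proof -
  have "L2_norm m (\<lambda>x. f x - g x) = 0"
    using assms by (simp add: ae_eq_diff_iff flip: ae_eq_iff_norm[OF L2_diff])
  then have "L2_norm m (\<lambda>x. f (\<Psi> x) - g (\<Psi> x)) = 0"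
    using cube_mp_norm[OF assms(1) L2_diff[OF assms(2,3)]] by simp
  then show ?thesis
    using assms by (simp add: ae_eq_diff_iff cube_mp_L2 flip: ae_eq_iff_norm[OF L2_diff])
qed

text \<open>Composition with \<open>\<Psi>\<close> is isometric, so limits pull back. Invariance of
  a closed span can thereby be checked on its generators.\<close>

lemma closed_subspace_pullback:
  assumes \<Psi>: "cube_mp m \<Psi>" and M: "closed_subspace m M"
  shows "closed_subspace m {f \<in> L2 m. (\<lambda>x. f (\<Psi> x)) \<in> M}"
proof (rule closed_subspaceI)
  fix s f assume s: "\<And>n::nat. s n \<in> {f \<in> L2 m. (\<lambda>x. f (\<Psi> x)) \<in> M}" and f: "f \<in> L2 m"
    and lim: "(\<lambda>n. L2_norm m (\<lambda>x. s n x - f x)) \<longlonglongrightarrow> 0"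
  have "(\<lambda>x. f (\<Psi> x)) \<in> M"
  proof (rule closed_subspace_limit[OF M])
    show "(\<lambda>n. L2_norm m (\<lambda>x. s n (\<Psi> x) - f (\<Psi> x))) \<longlonglongrightarrow> 0"
      using lim cube_mp_norm[OF \<Psi> L2_diff[OF _ f]] s by simp
  qed (use s f cube_mp_L2[OF \<Psi>] in auto)
  then show "f \<in> {f \<in> L2 m. (\<lambda>x. f (\<Psi> x)) \<in> M}" using f by simp
qed (auto simp: L2_const L2_add L2_scale closed_subspace_zero[OF M]
  closed_subspace_add[OF M] closed_subspace_scale[OF M])

section \<open>Step functions on uniform grids and exchanges of their cells\<close>

text \<open>At \<open>x = 1\<close> the index is \<open>R\<close>, one past the last cell: pointwise
  bounds therefore run over \<open>a \<le> R\<close>, whereas integrals ignore this point and sum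
  over \<open>a < R\<close>. The value type is free so that complex, integer and Boolean data share
  one notion.\<close>

definition step :: "nat \<Rightarrow> (nat \<Rightarrow> 'a) \<Rightarrow> real \<Rightarrow> 'a" where
  "step R v x = v (nat \<lfloor>real R * x\<rfloor>)"

text \<open>The coarse cell index is the fine index divided by \<open>s\<close>. This is how
  functions on different grids are brought to a common one.\<close>

lemma step_refine:
  assumes "s > 0"
  shows "step R v x = step (R * s) (\<lambda>a. v (a div s)) x"
proof -
  have "\<lfloor>real R * x\<rfloor> = \<lfloor>real (R * s) * x / real_of_int (int s)\<rfloor>"
    using assms by simp
  also have "\<dots> = \<lfloor>real (R * s) * x\<rfloor> div int s"
    by (rule floor_divide_real_eq_div) simp
  finally have "nat \<lfloor>real R * x\<rfloor> = nat (\<lfloor>real (R * s) * x\<rfloor> div int s)" by simp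
  also have "\<dots> = nat \<lfloor>real (R * s) * x\<rfloor> div s"
    by (metis nat_div_distrib' nat_int of_nat_0_le_iff)
  finally show ?thesis by (simp add: step_def)
qed

lemma borel_measurable_unit_interval:
  "f \<in> borel_measurable borel \<Longrightarrow> f \<in> unit_interval \<rightarrow>\<^sub>M borel"
  by (intro measurable_restrict_space1 measurable_completion) simp

lemma step_measurable: "step R v \<in> unit_interval \<rightarrow>\<^sub>M borel"
proof (rule borel_measurable_unit_interval)
  have "(\<lambda>x::real. \<lfloor>real R * x\<rfloor>) \<in> borel \<rightarrow>\<^sub>M count_space UNIV" by measurable
  then have "(\<lambda>x. (\<lambda>k. v (nat k)) \<lfloor>real R * x\<rfloor>) \<in> borel \<rightarrow>\<^sub>M borel"
    by (rule measurable_compose) simp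
  then show "step R v \<in> borel_measurable borel" by (simp add: step_def[abs_def])
qed

lemma step_index_le: "x \<in> {0..1} \<Longrightarrow> nat \<lfloor>real R * x\<rfloor> \<le> R"
  using mult_left_le[of x "real R"] by (simp add: nat_le_iff floor_le_iff)

lemma step_bounded:
  fixes v :: "nat \<Rightarrow> 'a::real_normed_vector"
  shows "x \<in> {0..1} \<Longrightarrow> norm (step R v x) \<le> (\<Sum>a\<le>R. norm (v a))"
  unfolding step_def by (rule member_le_sum) (use step_index_le in auto)

definition cell :: "nat \<Rightarrow> nat \<Rightarrow> real set" where
  "cell N a = {real a / real N..<(real a + 1) / real N}"

lemma in_cell_iff: "N > 0 \<Longrightarrow> x \<ge> 0 \<Longrightarrow> x \<in> cell N a \<longleftrightarrow> nat \<lfloor>real N * x\<rfloor> = a"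
  by (simp add: cell_def divide_le_eq less_divide_eq mult.commute nat_eq_iff floor_eq_iff)

lemma cell_subset: "a < N \<Longrightarrow> cell N a \<subseteq> {0..<1}"
  by (auto simp: cell_def field_simps intro: order_trans less_le_trans) 

lemma cell_sets: "cell N a \<in> sets lebesgue"
  by (simp add: cell_def)

lemma cell_cover: "N > 0 \<Longrightarrow> {0..<1} = (\<Union>a<N. cell N a)"
proof (intro set_eqI iffI)
  fix x :: real assume N: "N > 0" and x: "x \<in> {0..<1}"
  then have "real N * x < real N" by simp
  then have "nat \<lfloor>real N * x\<rfloor> < N" using x by (simp add: nat_less_iff floor_less_iff)
  moreover have "x \<in> cell N (nat \<lfloor>real N * x\<rfloor>)" using N x by (simp add: in_cell_iff)
  ultimately show "x \<in> (\<Union>a<N. cell N a)" by blast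
qed (use cell_subset in blast)

lemma AE_unit_interval_less_1: "AE x in unit_interval. x < 1"
proof -
  have "AE x in lebesgue. x \<noteq> (1::real)"
    by (rule AE_I'[of "{1}"]) auto
  then show ?thesis
    by (simp add: AE_restrict_space_iff) (auto elim: eventually_mono)
qed

lemma integral_step:
  fixes v :: "nat \<Rightarrow> complex"
  assumes N: "N > 0"
  shows "(LINT x|unit_interval. step N v x) = (\<Sum>a<N. v a) / of_nat N"
proof -
  have cell_U: "cell N a \<in> sets unit_interval" if "a < N" for a
    using cell_subset[OF that] cell_sets by (auto simp: sets_unit_interval)
  interpret prob_space unit_interval by (rule prob_space_unit_interval)
  have "(LINT x|unit_interval. step N v x) =
      (LINT x|unit_interval. (\<Sum>a<N. indicat_real (cell N a) x *\<^sub>R v a))"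
  proof (rule integral_cong_AE)
    show "AE x in unit_interval. step N v x = (\<Sum>a<N. indicat_real (cell N a) x *\<^sub>R v a)"
      using AE_unit_interval_less_1 AE_space
    proof eventually_elim
      case (elim x)
      then have x: "x \<in> {0..<1}" by auto
      define b where "b = nat \<lfloor>real N * x\<rfloor>"
      have ind: "indicat_real (cell N a) x = (if a = b then 1 else 0)" for a
        using in_cell_iff[OF N, of x a] x by (auto simp: b_def indicator_def)
      obtain a where "a < N" "x \<in> cell N a" using x cell_cover[OF N] by auto
      then have b: "b < N" using in_cell_iff[OF N, of x a] x by (simp add: b_def)
      show ?case using b by (simp add: ind if_distrib[of "\<lambda>t. t *\<^sub>R _"] sum.delta step_def b_def cong: if_cong)
    qed
    show "(\<lambda>x. \<Sum>a<N. indicat_real (cell N a) x *\<^sub>R v a) \<in> borel_measurable unit_interval"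
      using cell_U by measurable
  qed (rule step_measurable)
  also have "\<dots> = (\<Sum>a<N. measure unit_interval (cell N a) *\<^sub>R v a)"
  proof -
    have eq: "cell N a \<inter> {0..1} = cell N a" if "a < N" for a using cell_subset[OF that] by auto
    have int: "integrable unit_interval (\<lambda>x. indicat_real (cell N a) x)" if "a < N" for a
      using cell_U[OF that] by (simp add: integrable_indicator_iff emeasure_eq_measure eq[OF that])
    have "(LINT x|unit_interval. indicat_real (cell N a) x *\<^sub>R v a) = measure unit_interval (cell N a) *\<^sub>R v a"
      if "a < N" for a
      using integral_scaleR_left[OF int[OF that], of "v a"] that by (simp add: eq)
    moreover have "(LINT x|unit_interval. (\<Sum>a<N. indicat_real (cell N a) x *\<^sub>R v a)) =
        (\<Sum>a<N. LINT x|unit_interval. indicat_real (cell N a) x *\<^sub>R v a)"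
      by (rule Bochner_Integration.integral_sum) (intro integrable_scaleR_left int, simp)
    ultimately show ?thesis by simp
  qed
  also have "\<dots> = (\<Sum>a<N. (1 / real N) *\<^sub>R v a)"
  proof (intro sum.cong refl arg_cong2[of _ _ _ _ scaleR])
    fix a assume a: "a \<in> {..<N}"
    then have "emeasure unit_interval (cell N a) = emeasure lborel (cell N a)"
      using emeasure_unit_interval[OF cell_U] by (simp add: cell_def)
    also have "\<dots> = ennreal ((real a + 1) / real N - real a / real N)"
      unfolding cell_def by (rule emeasure_lborel_Ico) (simp add: divide_right_mono)
    also have "\<dots> = ennreal (1 / real N)" by (simp flip: diff_divide_distrib)
    finally show "measure unit_interval (cell N a) = 1 / real N" by (simp add: measure_def)
  qed
  also have "\<dots> = (\<Sum>a<N. v a) / of_nat N"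
    by (simp add: scaleR_conv_of_real sum_divide_distrib)
  finally show ?thesis .
qed

text \<open>Translates cell \<open>a\<close> onto cell \<open>\<pi> a\<close>: the cell index is
  permuted and the position inside the cell, \<open>frac (N x)\<close>, is kept.\<close>

definition exch :: "nat \<Rightarrow> (nat \<Rightarrow> nat) \<Rightarrow> real \<Rightarrow> real" where
  "exch N \<pi> x = (real (\<pi> (nat \<lfloor>real N * x\<rfloor>)) + frac (real N * x)) / real N"

lemma step_exch: "N > 0 \<Longrightarrow> step N v (exch N \<pi> x) = step N (\<lambda>a. v (\<pi> a)) x"
  using frac_lt_1[of "real N * x"] frac_ge_0[of "real N * x"]
  by (simp add: step_def exch_def floor_add2[symmetric] floor_eq_iff)

lemma exch_in:
  assumes N: "N > 0" and \<pi>: "\<pi> permutes {..<N}" and x: "x \<in> {0..1}"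
  shows "exch N \<pi> x \<in> {0..1}"
proof (cases "x = 1")
  \<comment> \<open>The index of the endpoint is \<open>N\<close>, which \<open>\<pi>\<close> fixes,
    so the endpoint is a fixed point.\<close>
  case True
  then show ?thesis using N permutes_not_in[OF \<pi>, of N] by (simp add: exch_def frac_def)
next
  case False
  then have "real N * x < real N" using x N by simp
  then have "nat \<lfloor>real N * x\<rfloor> < N" using x N by (simp add: nat_less_iff floor_less_iff)
  then have "\<pi> (nat \<lfloor>real N * x\<rfloor>) < N" using permutes_in_image[OF \<pi>] by auto
  then have "real (\<pi> (nat \<lfloor>real N * x\<rfloor>)) + 1 \<le> real N" by linarith
  then have "real (\<pi> (nat \<lfloor>real N * x\<rfloor>)) + frac (real N * x) \<le> real N"
    using frac_lt_1[of "real N * x"] by linarith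
  then show ?thesis using N frac_ge_0[of "real N * x"] by (simp add: exch_def)
qed

lemma exch_inverse:
  assumes N: "N > 0" and \<pi>: "\<And>a. \<rho> (\<pi> a) = a" and x: "x \<ge> 0"
  shows "exch N \<rho> (exch N \<pi> x) = x"
proof -
  have fl: "\<lfloor>real N * exch N \<pi> x\<rfloor> = int (\<pi> (nat \<lfloor>real N * x\<rfloor>))"
    using N frac_lt_1[of "real N * x"] frac_ge_0[of "real N * x"] by (simp add: exch_def floor_eq_iff)
  then have fr: "frac (real N * exch N \<pi> x) = frac (real N * x)"
    using N by (simp add: frac_def) (simp add: exch_def frac_def)
  have "exch N \<rho> (exch N \<pi> x) = (real (nat \<lfloor>real N * x\<rfloor>) + frac (real N * x)) / real N"
    by (subst exch_def) (simp add: fl fr \<pi>)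
  also have "\<dots> = x" using N x by (simp add: frac_def)
  finally show ?thesis .
qed

text \<open>Up to the endpoint 1, which lies in no cell, the preimage of \<open>E\<close> is a
  disjoint union of translates of the pieces of \<open>E\<close> in the cells; translation
  invariance and reindexing by \<open>\<pi>\<close> give the measure.\<close>

lemma exch_mp_map:
  assumes N: "N > 0" and \<pi>: "\<pi> permutes {..<N}"
  shows "mp_map (exch N \<pi>)"
proof -
  \<comment> \<open>The shift that carries cell \<open>\<pi> a\<close> back to cell
    \<open>a\<close>; \<open>T E a\<close> is the part of the preimage of \<open>E\<close> inside
    cell \<open>a\<close>.\<close>
  define c where "c a = (real a - real (\<pi> a)) / real N" for a
  define T where "T E a = (\<lambda>x. c a + x) ` (E \<inter> cell N (\<pi> a))" for E a
  have \<pi>_lt: "\<pi> a < N \<longleftrightarrow> a < N" for a using permutes_in_image[OF \<pi>, of a] by simp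
  have exch_cell: "exch N \<pi> x = x - c a" if "x \<in> cell N a" for x a
  proof -
    have "x \<ge> 0" using that N by (auto simp: cell_def intro: order_trans[rotated])
    then have "nat \<lfloor>real N * x\<rfloor> = a" "real_of_int \<lfloor>real N * x\<rfloor> = real a"
      using that in_cell_iff[OF N, of x a] by (auto simp: N)
    then show ?thesis using N by (simp add: exch_def c_def frac_def field_simps)
  qed
  have cell_shift: "x - c a \<in> cell N (\<pi> a) \<longleftrightarrow> x \<in> cell N a" for x a
    by (auto simp: cell_def c_def diff_divide_distrib add_divide_distrib)
  have exch1: "exch N \<pi> 1 = 1" using N permutes_not_in[OF \<pi>, of N] by (simp add: exch_def frac_def)
  have vim: "exch N \<pi> -` E \<inter> {0..1} = (\<Union>a<N. T E a) \<union> (E \<inter> {1})" if "E \<subseteq> {0..1}" for E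
  proof (intro set_eqI iffI)
    fix x assume x: "x \<in> exch N \<pi> -` E \<inter> {0..1}"
    show "x \<in> (\<Union>a<N. T E a) \<union> (E \<inter> {1})"
    proof (cases "x = 1")
      case True then show ?thesis using x exch1 by simp
    next
      case False
      then have "x \<in> (\<Union>a<N. cell N a)" using x cell_cover[OF N] by auto
      then obtain a where a: "a < N" "x \<in> cell N a" by blast
      then have "x - c a \<in> E \<inter> cell N (\<pi> a)" using x exch_cell cell_shift by auto
      then have "x \<in> T E a" unfolding T_def by (intro image_eqI[of _ _ "x - c a"]) auto
      then show ?thesis using a by auto
    qed
  next
    fix x assume "x \<in> (\<Union>a<N. T E a) \<union> (E \<inter> {1})"
    then show "x \<in> exch N \<pi> -` E \<inter> {0..1}"
    proof
      assume "x \<in> (\<Union>a<N. T E a)"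
      then obtain a where a: "a < N" "x - c a \<in> E \<inter> cell N (\<pi> a)" by (auto simp: T_def)
      then have "x \<in> cell N a" by (simp add: cell_shift)
      then show ?thesis using a exch_cell[of x a] cell_subset[OF a(1)] by auto
    qed (use exch1 in auto)
  qed
  have T_sets: "T E a \<in> sets lebesgue" if "E \<in> sets lebesgue" for E a
    unfolding T_def using that cell_sets by (intro lebesgue_sets_translation) auto
  have T_cell: "T E a \<subseteq> cell N a" for E a using cell_shift[of _ a] by (fastforce simp: T_def)
  have cell_disj: "disjoint_family_on (cell N) {..<N}"
    unfolding disjoint_family_on_def
  proof (intro ballI impI equals0I)
    fix a b x assume ab: "a \<noteq> b" and x: "x \<in> cell N a \<inter> cell N b"
    then have "x \<ge> 0" by (auto simp: cell_def intro: order_trans[rotated])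
    then show False using in_cell_iff[OF N, of x a] in_cell_iff[OF N, of x b] x ab by auto
  qed
  have meas: "exch N \<pi> \<in> unit_interval \<rightarrow>\<^sub>M unit_interval"
  proof (rule measurableI)
    show "exch N \<pi> x \<in> space unit_interval" if "x \<in> space unit_interval" for x
      using exch_in[OF N \<pi>, of x] that by simp
    fix E assume "E \<in> sets unit_interval"
    then have E: "E \<subseteq> {0..1}" "E \<in> sets lebesgue" by (auto simp: sets_unit_interval)
    then have "(\<Union>a<N. T E a) \<union> (E \<inter> {1}) \<in> sets lebesgue"
      by (intro sets.Un sets.finite_UN) (auto intro: T_sets)
    then show "exch N \<pi> -` E \<inter> space unit_interval \<in> sets unit_interval"
      using vim[OF E(1)] by (auto simp: sets_unit_interval)
  qed
  have "distr unit_interval unit_interval (exch N \<pi>) = unit_interval"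
  proof (rule measure_eqI)
    fix E assume "E \<in> sets (distr unit_interval unit_interval (exch N \<pi>))"
    then have EU: "E \<in> sets unit_interval" by simp
    then have E: "E \<subseteq> {0..1}" "E \<in> sets lebesgue" by (auto simp: sets_unit_interval)
    have null1: "E \<inter> {1} \<in> null_sets lebesgue"
      by (rule null_sets_subset[of "{1}"]) (use E in auto)
    have "emeasure (distr unit_interval unit_interval (exch N \<pi>)) E =
        emeasure unit_interval (exch N \<pi> -` E \<inter> {0..1})"
      using emeasure_distr[OF meas EU] by simp
    also have "\<dots> = emeasure lebesgue ((\<Union>a<N. T E a) \<union> (E \<inter> {1}))"
      using measurable_sets[OF meas EU] by (simp add: emeasure_unit_interval vim[OF E(1)])
    also have "\<dots> = emeasure lebesgue (\<Union>a<N. T E a)"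
      by (rule emeasure_Un_null_set[OF _ null1]) (auto intro: T_sets E)
    also have "\<dots> = (\<Sum>a<N. emeasure lebesgue (T E a))"
    proof (rule sum_emeasure[symmetric])
      show "disjoint_family_on (T E) {..<N}"
        using cell_disj T_cell unfolding disjoint_family_on_def by blast
    qed (use T_sets E in auto)
    also have "\<dots> = (\<Sum>a<N. emeasure lebesgue (E \<inter> cell N (\<pi> a)))"
    proof (rule sum.cong[OF refl])
      fix a
      show "emeasure lebesgue (T E a) = emeasure lebesgue (E \<inter> cell N (\<pi> a))"
        unfolding T_def using emeasure_lebesgue_affine[of 1 "c a" "E \<inter> cell N (\<pi> a)"]
        by (simp add: add.commute)
    qed
    also have "\<dots> = (\<Sum>a<N. emeasure lebesgue (E \<inter> cell N a))"
      using sum.permute[OF \<pi>, of "\<lambda>a. emeasure lebesgue (E \<inter> cell N a)"] by (simp add: comp_def)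
    also have "\<dots> = emeasure lebesgue (\<Union>a<N. E \<inter> cell N a)"
    proof (rule sum_emeasure)
      show "disjoint_family_on (\<lambda>a. E \<inter> cell N a) {..<N}"
        using cell_disj unfolding disjoint_family_on_def by blast
    qed (use cell_sets E in auto)
    also have "\<dots> = emeasure lebesgue ((\<Union>a<N. E \<inter> cell N a) \<union> (E \<inter> {1}))"
      by (rule emeasure_Un_null_set[OF _ null1, symmetric]) (auto intro: cell_sets E)
    also have "(\<Union>a<N. E \<inter> cell N a) \<union> (E \<inter> {1}) = E"
      using E(1) cell_cover[OF N] by (auto simp: set_eq_iff) (metis antisym_conv2 atLeastAtMost_iff subsetD)
    finally show "emeasure (distr unit_interval unit_interval (exch N \<pi>)) E = emeasure unit_interval E"
      by (simp add: emeasure_unit_interval[OF EU])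
  qed simp
  with meas show ?thesis by (simp add: mp_map_def)
qed

lemma exch_mp_bijection:
  assumes N: "N > 0" and \<pi>: "\<pi> permutes {..<N}"
  shows "exch N \<pi> \<in> mp_bijections"
    and "x \<in> {0..1} \<Longrightarrow> inv_into {0..1} (exch N \<pi>) x = exch N (inv \<pi>) x"
proof -
  note inv_perm = permutes_inv[OF \<pi>]
  have inv1: "exch N (inv \<pi>) (exch N \<pi> x) = x" "exch N \<pi> (exch N (inv \<pi>) x) = x" if "x \<in> {0..1}" for x
    using that N by (auto intro!: exch_inverse simp: permutes_inverses[OF \<pi>])
  have bij: "bij_betw (exch N \<pi>) {0..1} {0..1}"
    by (rule bij_betw_byWitness[where f'="exch N (inv \<pi>)"])
      (use inv1 exch_in[OF N \<pi>] exch_in[OF N inv_perm] in auto)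
  show inv_eq: "inv_into {0..1} (exch N \<pi>) x = exch N (inv \<pi>) x" if "x \<in> {0..1}" for x
    by (rule inv_into_f_eq) (use that bij inv1 exch_in[OF N inv_perm] in \<open>auto simp: bij_betw_def\<close>)
  have "inv_into {0..1} (exch N \<pi>) \<in> unit_interval \<rightarrow>\<^sub>M unit_interval"
    using mp_map_measurable[OF exch_mp_map[OF N inv_perm]]
    by (rule measurable_cong[THEN iffD2, rotated]) (simp add: inv_eq)
  with bij exch_mp_map[OF N \<pi>] show "exch N \<pi> \<in> mp_bijections"
    by (simp add: mp_bijections_def mp_map_def)
qed

section \<open>Totality of step functions\<close>

definition step_box :: "nat \<Rightarrow> nat \<Rightarrow> (nat \<Rightarrow> nat \<Rightarrow> complex) \<Rightarrow> cube_fun" where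
  "step_box m R v x = (\<Prod>i<m. step R (v i) (x i))"

lemma component_in_unit: "x \<in> space (unit_cube m) \<Longrightarrow> i < m \<Longrightarrow> x i \<in> {0..1}"
  unfolding space_unit_cube by (erule PiE_mem) simp

lemma box_measurable_PiM: "step_box m R v \<in> borel_measurable (PiM {..<m} (\<lambda>_. unit_interval))"
  unfolding step_box_def[abs_def]
  by (intro borel_measurable_prod measurable_compose[OF _ step_measurable] measurable_component_singleton)

lemma L2_box: "step_box m R v \<in> L2 m"
proof (rule L2_bounded)
  show "step_box m R v \<in> borel_measurable (unit_cube m)"
    by (rule measurable_unit_cubeI[OF box_measurable_PiM])
  show "cmod (step_box m R v x) \<le> (\<Prod>i<m. \<Sum>a\<le>R. cmod (v i a))" if "x \<in> space (unit_cube m)" for x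
    unfolding step_box_def prod_norm[symmetric]
    by (intro prod_mono conjI norm_ge_zero step_bounded component_in_unit[OF that]) simp
qed

lemma box_mult_cnj: "step_box m R v x * cnj (step_box m R w x) = step_box m R (\<lambda>i a. v i a * cnj (w i a)) x"
  by (simp add: step_box_def step_def prod.distrib)

lemma integral_box:
  assumes "R > 0"
  shows "(LINT x|unit_cube m. step_box m R v x) = (\<Prod>i<m. (\<Sum>a<R. v i a) / of_nat R)"
proof -
  interpret product_prob_space "\<lambda>_. unit_interval" "{..<m}"
    by (rule product_prob_space_unit_interval)
  have int: "integrable unit_interval (step R (v i))" for i
    by (rule M.integrable_const_bound[where B="\<Sum>a\<le>R. cmod (v i a)"])
      (auto intro!: AE_I2 step_bounded step_measurable)
  have "(LINT x|unit_cube m. step_box m R v x) = (LINT x|PiM {..<m} (\<lambda>_. unit_interval). step_box m R v x)"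
    unfolding unit_cube_def by (rule integral_completion[OF box_measurable_PiM])
  also have "\<dots> = (\<Prod>i<m. LINT x|unit_interval. step R (v i) x)"
    unfolding step_box_def by (rule product_integral_prod) (use int in auto)
  finally show ?thesis by (simp add: integral_step[OF assms])
qed

lemma L2_inner_box:
  assumes "R > 0"
  shows "L2_inner m (step_box m R v) (step_box m R w) = (\<Prod>i<m. (\<Sum>a<R. v i a * cnj (w i a)) / of_nat R)"
  unfolding L2_inner_def box_mult_cnj by (rule integral_box[OF assms])

lemma box_refine: "s > 0 \<Longrightarrow> step_box m R v = step_box m (R * s) (\<lambda>i a. v i (a div s))"
  unfolding step_box_def fun_eq_iff by (intro allI prod.cong refl) (rule step_refine)

section \<open>An intersection-stable generator of the Lebesgue sets and totality of boxes\<close>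

text \<open>Agreement with a union of cells is required only almost everywhere. All null sets then
  belong to the generator, so it generates the Lebesgue sets and not merely the Borel sets.\<close>

definition step_sets :: "real set set" where
  "step_sets = {E \<in> sets unit_interval. \<exists>R>0. \<exists>S. AE x in unit_interval. x \<in> E \<longleftrightarrow> step R (\<lambda>a. a \<in> S) x}"

lemma Int_stable_step_sets: "Int_stable step_sets"
proof (rule Int_stableI)
  fix E F assume "E \<in> step_sets" "F \<in> step_sets"
  then obtain R S R' S' where "E \<in> sets unit_interval" "F \<in> sets unit_interval"
    and R: "R > 0" "AE x in unit_interval. x \<in> E \<longleftrightarrow> step R (\<lambda>a. a \<in> S) x"
    and R': "R' > 0" "AE x in unit_interval. x \<in> F \<longleftrightarrow> step R' (\<lambda>a. a \<in> S') x"
    unfolding step_sets_def by auto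
  moreover have "AE x in unit_interval. x \<in> E \<inter> F \<longleftrightarrow>
      step (R * R') (\<lambda>a. a \<in> {a. a div R' \<in> S \<and> a div R \<in> S'}) x"
    using R(2) R'(2)
  proof eventually_elim
    case (elim x)
    then show ?case
      using step_refine[OF R'(1), of R "\<lambda>a. a \<in> S" x] step_refine[OF R(1), of R' "\<lambda>a. a \<in> S'" x]
      by (simp add: step_def mult.commute)
  qed
  moreover have "R * R' > 0" using R R' by simp
  ultimately show "E \<inter> F \<in> step_sets" unfolding step_sets_def by blast
qed

lemma step_sets_Pow: "step_sets \<subseteq> Pow {0..1}"
  by (auto simp: step_sets_def sets_unit_interval)

text \<open>Half-lines are countable unions of step sets, which yields the Borel sets; a Lebesgue
  set is a Borel set together with a null set, and null sets are step sets with no cells.\<close>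

lemma sigma_step_sets: "sigma_sets {0..1} step_sets = sets unit_interval"
proof (rule antisym)
  show "sigma_sets {0..1} step_sets \<subseteq> sets unit_interval"
    using sets.sigma_sets_subset[of step_sets unit_interval] by (auto simp: step_sets_def)
  interpret sigma_algebra "{0..1}" "sigma_sets {0..1} step_sets"
    by (rule sigma_algebra_sigma_sets[OF step_sets_Pow])
  have interval: "{..<c} \<inter> {0..1} \<in> sigma_sets {0..1} step_sets" for c :: real
  proof -
    \<comment> \<open>The union of the cells of width \<open>1/(n+1)\<close> strictly left of the
      cell that contains \<open>c\<close>. A point \<open>x < c\<close> is caught once the width is
      below \<open>c - x\<close>, since then \<open>x\<close> and \<open>c\<close> lie in different
      cells.\<close>
    define A where "A n = {x \<in> {0..1}. nat \<lfloor>real (Suc n) * x\<rfloor> < nat \<lfloor>real (Suc n) * c\<rfloor>}" for n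
    have "A n \<in> step_sets" for n
    proof -
      have "step (Suc n) (\<lambda>a. of_bool (a < nat \<lfloor>real (Suc n) * c\<rfloor>) :: real) -` {1} \<inter> space unit_interval
          \<in> sets unit_interval"
        by (rule measurable_sets[OF step_measurable]) simp
      also have "step (Suc n) (\<lambda>a. of_bool (a < nat \<lfloor>real (Suc n) * c\<rfloor>) :: real) -` {1} \<inter> space unit_interval = A n"
        by (auto simp: A_def step_def)
      finally have "A n \<in> sets unit_interval" .
      moreover have "AE x in unit_interval. x \<in> A n \<longleftrightarrow> step (Suc n) (\<lambda>a. a \<in> {..<nat \<lfloor>real (Suc n) * c\<rfloor>}) x"
        by (rule AE_I2) (simp add: A_def step_def)
      ultimately show ?thesis unfolding step_sets_def by blast
    qed
    then have "(\<Union>n. A n) \<in> sigma_sets {0..1} step_sets" by (intro countable_UN) auto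
    also have "(\<Union>n. A n) = {..<c} \<inter> {0..1}"
    proof (intro set_eqI iffI)
      fix x assume "x \<in> (\<Union>n. A n)"
      then obtain n where "x \<in> {0..1}" "nat \<lfloor>real (Suc n) * x\<rfloor> < nat \<lfloor>real (Suc n) * c\<rfloor>"
        by (auto simp: A_def)
      then have "\<lfloor>real (Suc n) * x\<rfloor> < \<lfloor>real (Suc n) * c\<rfloor>" by linarith
      then have "real (Suc n) * x < real (Suc n) * c" using floor_less_cancel by blast
      then show "x \<in> {..<c} \<inter> {0..1}" using \<open>x \<in> {0..1}\<close> by simp
    next
      fix x assume x: "x \<in> {..<c} \<inter> {0..1}"
      then obtain n where n: "inverse (real (Suc n)) < c - x" using reals_Archimedean[of "c - x"] by auto
      then have "1 < real (Suc n) * (c - x)" by (simp add: inverse_eq_divide divide_less_eq mult.commute)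
      then have "real (Suc n) * x + 1 < real (Suc n) * c" by (simp add: right_diff_distrib)
      then have "\<lfloor>real (Suc n) * x\<rfloor> < \<lfloor>real (Suc n) * c\<rfloor>" by linarith
      moreover have "0 \<le> \<lfloor>real (Suc n) * x\<rfloor>" using x by simp
      ultimately have "nat \<lfloor>real (Suc n) * x\<rfloor> < nat \<lfloor>real (Suc n) * c\<rfloor>" by linarith
      then have "x \<in> A n" using x by (simp add: A_def del: of_nat_Suc)
      then show "x \<in> (\<Union>n. A n)" by blast
    qed
    finally show ?thesis .
  qed
  have borel: "B \<inter> {0..1} \<in> sigma_sets {0..1} step_sets" if "B \<in> sigma_sets UNIV (range (lessThan :: real \<Rightarrow> _))" for B
    using that
  proof induction
    case (Basic B) then show ?case using interval by auto
  next
    case Empty show ?case by simp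
  next
    case (Compl B)
    have "(UNIV - B) \<inter> {0..1} = {0..1} - (B \<inter> {0..1})" by auto
    then show ?case using Compl.IH compl_sets by simp
  next
    case (Union B)
    have "\<Union> (range B) \<inter> {0..1} = (\<Union>n. B n \<inter> {0..1})" by auto
    also have "\<dots> \<in> sigma_sets {0..1} step_sets" using Union.IH by (intro countable_UN) auto
    finally show ?case .
  qed
  show "sets unit_interval \<subseteq> sigma_sets {0..1} step_sets"
  proof
    fix E assume EU: "E \<in> sets unit_interval"
    then have E: "E \<subseteq> {0..1}" "E \<in> sets lebesgue" by (auto simp: sets_unit_interval)
    then obtain B N N' where B: "E = B \<union> N" "N \<subseteq> N'" "N' \<in> null_sets lborel" "B \<in> sets lborel"
      using sets_completionE[of E lborel] by metis
    have "N \<in> null_sets lebesgue"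
      by (rule null_sets_completion_subset[OF B(2)]) (use B(3) in \<open>simp add: null_sets_completionI\<close>)
    then have N: "N \<in> null_sets unit_interval"
      using E B by (subst null_sets_restrict_space) auto
    then have "AE x in unit_interval. x \<in> N \<longleftrightarrow> step 1 (\<lambda>a. a \<in> {}) x"
      by (auto simp: step_def dest: AE_not_in)
    then have "N \<in> step_sets" unfolding step_sets_def using N by (blast intro: zero_less_one)
    moreover have "B \<in> sigma_sets UNIV (range lessThan)"
      using B(4) unfolding sets_lborel by (subst (asm) borel_Iio) simp
    then have "B \<inter> {0..1} \<in> sigma_sets {0..1} step_sets" by (rule borel)
    moreover have "B \<inter> {0..1} = B" using E B by auto
    ultimately show "E \<in> sigma_sets {0..1} step_sets" unfolding B(1) by (intro Un) auto
  qed
qed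

lemma PiE_step_sets_subset:
  assumes "E \<in> {..<m} \<rightarrow> step_sets"
  shows "Pi\<^sub>E {..<m} E \<subseteq> {..<m} \<rightarrow>\<^sub>E {0..1}"
  by (rule PiE_mono) (use assms step_sets_Pow in blast)

text \<open>Boxes with sides in \<open>step_sets\<close> become a generator of the product
  sigma-algebra, which starts the Dynkin argument in \<open>L2_box_total\<close>.\<close>

lemma sets_PiM_step_sets:
  fixes m :: nat
  shows "sets (PiM {..<m} (\<lambda>_. unit_interval)) =
    sigma_sets ({..<m} \<rightarrow>\<^sub>E {0..1}) {Pi\<^sub>E {..<m} E |E. E \<in> {..<m} \<rightarrow> step_sets}"
proof -
  have top: "{0..1} \<in> step_sets"
  proof -
    have "AE x in unit_interval. x \<in> {0..1} \<longleftrightarrow> step 1 (\<lambda>a. a \<in> UNIV) x"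
      by (rule AE_I2) (simp add: step_def)
    moreover have "{0..1} \<in> sets unit_interval" by (simp add: sets_unit_interval)
    ultimately show ?thesis unfolding step_sets_def by (blast intro: zero_less_one)
  qed
  have eq: "{{f \<in> {..<m} \<rightarrow>\<^sub>E {0..1}. \<forall>i\<in>j. f i \<in> A i} |A j. j \<in> {{..<m}} \<and> A \<in> Pi j (\<lambda>_. step_sets)} =
      {Pi\<^sub>E {..<m} E |E. E \<in> {..<m} \<rightarrow> step_sets}"
  proof -
    have "{f \<in> {..<m} \<rightarrow>\<^sub>E {0..1}. \<forall>i\<in>{..<m}. f i \<in> A i} = Pi\<^sub>E {..<m} A"
      if "A \<in> {..<m} \<rightarrow> step_sets" for A
    proof (intro set_eqI iffI)
      fix f assume "f \<in> Pi\<^sub>E {..<m} A"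
      then show "f \<in> {f \<in> {..<m} \<rightarrow>\<^sub>E {0..1}. \<forall>i\<in>{..<m}. f i \<in> A i}"
        using subsetD[OF PiE_step_sets_subset[OF that]] PiE_mem[of f "{..<m}" A] by simp
    qed (simp add: PiE_iff)
    note F = this
    show ?thesis
    proof (rule set_eqI)
      fix X
      have "X \<in> {{f \<in> {..<m} \<rightarrow>\<^sub>E {0..1}. \<forall>i\<in>j. f i \<in> A i} |A j. j \<in> {{..<m}} \<and> A \<in> Pi j (\<lambda>_. step_sets)}
          \<longleftrightarrow> (\<exists>A. X = {f \<in> {..<m} \<rightarrow>\<^sub>E {0..1}. \<forall>i\<in>{..<m}. f i \<in> A i} \<and> A \<in> {..<m} \<rightarrow> step_sets)"
        by simp
      also have "\<dots> \<longleftrightarrow> (\<exists>A. X = Pi\<^sub>E {..<m} A \<and> A \<in> {..<m} \<rightarrow> step_sets)"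
        by (intro ex_cong1 conj_cong refl iffI) (simp_all add: F)
      finally show "X \<in> {{f \<in> {..<m} \<rightarrow>\<^sub>E {0..1}. \<forall>i\<in>j. f i \<in> A i} |A j. j \<in> {{..<m}} \<and> A \<in> Pi j (\<lambda>_. step_sets)}
          \<longleftrightarrow> X \<in> {Pi\<^sub>E {..<m} E |E. E \<in> {..<m} \<rightarrow> step_sets}"
        by simp
    qed
  qed
  have "sets (PiM {..<m} (\<lambda>_. unit_interval)) = sets (PiM {..<m} (\<lambda>_. sigma {0..1} step_sets))"
    by (rule sets_PiM_cong) (auto simp: sigma_step_sets step_sets_Pow)
  also have "\<dots> = sets (sigma ({..<m} \<rightarrow>\<^sub>E {0..1})
      {{f \<in> {..<m} \<rightarrow>\<^sub>E {0..1}. \<forall>i\<in>j. f i \<in> A i} |A j. j \<in> {{..<m}} \<and> A \<in> Pi j (\<lambda>_. step_sets)})"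
    by (rule sets_PiM_sigma) (use top step_sets_Pow in \<open>auto intro!: exI[of _ "{{0..1}}"]\<close>)
  also have "\<dots> = sigma_sets ({..<m} \<rightarrow>\<^sub>E {0..1}) {Pi\<^sub>E {..<m} E |E. E \<in> {..<m} \<rightarrow> step_sets}"
    unfolding eq by (rule sets_measure_of) (use PiE_step_sets_subset in blast)
  finally show ?thesis .
qed

lemma indicator_step_box:
  assumes E: "E \<in> {..<m} \<rightarrow> step_sets"
  obtains R S where "R > 0"
    "AE x in unit_cube m. indicator (Pi\<^sub>E {..<m} E) x = step_box m R (\<lambda>i a. of_bool (a \<in> S i)) x"
proof -
  have "\<forall>i\<in>{..<m}. \<exists>R S. R > 0 \<and> (AE x in unit_interval. x \<in> E i \<longleftrightarrow> step R (\<lambda>a. a \<in> S) x)"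
    using E by (auto simp: step_sets_def Pi_def)
  then obtain R S where R: "\<And>i. i < m \<Longrightarrow> R i > 0"
    and S: "\<And>i. i < m \<Longrightarrow> AE x in unit_interval. x \<in> E i \<longleftrightarrow> step (R i) (\<lambda>a. a \<in> S i) x"
    by (metis lessThan_iff)
  \<comment> \<open>The sides come with individual grids \<open>R i\<close>; their product is a
    common grid, refining the one of coordinate \<open>i\<close> by the factor
    \<open>s i\<close>.\<close>
  define Q where "Q = (\<Prod>i<m. R i)"
  define s where "s i = Q div R i" for i
  have Q: "Q > 0" unfolding Q_def using R by (intro prod_pos) auto
  have dvd: "R i * s i = Q" if "i < m" for i
    unfolding s_def Q_def using that by (intro dvd_mult_div_cancel dvd_prodI) auto
  have s: "s i > 0" if "i < m" for i using dvd[OF that] Q by (metis gr0I mult_0_right less_irrefl)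
  define v :: "nat \<Rightarrow> nat \<Rightarrow> complex" where "v i a = of_bool (a \<in> {a. a div s i \<in> S i})" for i a
  have "AE x in PiM {..<m} (\<lambda>_. unit_interval). \<forall>i\<in>{..<m}. x i \<in> E i \<longleftrightarrow> step (R i) (\<lambda>a. a \<in> S i) (x i)"
    by (intro AE_finite_allI finite_lessThan AE_PiM_component prob_space_unit_interval S) auto
  then have "AE x in unit_cube m. \<forall>i\<in>{..<m}. x i \<in> E i \<longleftrightarrow> step (R i) (\<lambda>a. a \<in> S i) (x i)"
    unfolding unit_cube_def by (rule AE_completion)
  then have "AE x in unit_cube m. indicator (Pi\<^sub>E {..<m} E) x = step_box m Q v x"
    using AE_space
  proof eventually_elim
    case (elim x)
    have "step Q (v i) (x i) = of_bool (x i \<in> E i)" if "i < m" for i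
    proof -
      have "step Q (v i) (x i) = of_bool (step (R i) (\<lambda>a. a \<in> S i) (x i))"
        using step_refine[OF s[OF that], of "R i" "\<lambda>a. a \<in> S i" "x i"]
        by (simp add: dvd[OF that] step_def v_def)
      then show ?thesis using elim(1) that by simp
    qed
    then have "step_box m Q v x = (\<Prod>i<m. of_bool (x i \<in> E i))"
      unfolding step_box_def by (intro prod.cong) auto
    also have "\<dots> = of_bool (\<forall>i<m. x i \<in> E i)"
    proof (cases "\<forall>i<m. x i \<in> E i")
      case False
      then show ?thesis by (auto simp: prod_zero_iff)
    qed simp
    also have "\<dots> = indicator (Pi\<^sub>E {..<m} E) x"
      using elim(2) by (auto simp: indicator_def space_unit_cube PiE_def Pi_def)
    finally show ?case by simp
  qed
  with Q show thesis unfolding v_def[abs_def] by (rule that)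
qed

text \<open>The sets over which \<open>f\<close> integrates to zero include all step boxes and are
  closed under complements and disjoint unions. By the Dynkin argument they include all
  product-measurable sets, then all Lebesgue sets, and a density with vanishing integrals is
  null.\<close>

lemma L2_box_total:
  assumes f: "f \<in> L2 m"
    and orth: "\<And>R S. R > 0 \<Longrightarrow> L2_inner m f (step_box m R (\<lambda>i a. of_bool (a \<in> S i))) = 0"
  shows "ae_eq m f (\<lambda>_. 0)"
proof -
  interpret prob_space "unit_cube m" by (rule prob_space_unit_cube)
  let ?P = "PiM {..<m} (\<lambda>_. unit_interval)" and ?C = "unit_cube m"
  let ?\<Omega> = "{..<m} \<rightarrow>\<^sub>E {0..1::real}" and ?G = "{Pi\<^sub>E {..<m} E |E. E \<in> {..<m} \<rightarrow> step_sets}"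
  have int_f: "integrable ?C f" using L2_integrable_mult_cnj[OF f L2_const[of 1]] by simp
  have f_meas: "f \<in> borel_measurable ?C" using f by (rule L2_measurable)
  have set_int: "set_integrable ?C A f" if "A \<in> sets ?C" for A
    unfolding set_integrable_def using that int_f by (rule integrable_mult_indicator)
  have box0: "(LINT x|?C. f x * cnj (step_box m R (\<lambda>i a. of_bool (a \<in> S i)) x)) = 0" if "R > 0" for R S
    using orth[OF that] by (simp add: L2_inner_def)
  \<comment> \<open>The box with a single full cell in each coordinate is the constant 1; the
    complement case needs this.\<close>
  have total: "(LINT x|?C. f x) = 0"
    using box0[of 1 "\<lambda>_. UNIV"] by (simp add: step_box_def step_def)
  have Int_stable: "Int_stable ?G"
  proof (rule Int_stableI)
    fix A B assume "A \<in> ?G" "B \<in> ?G"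
    then obtain E F where EF: "A = Pi\<^sub>E {..<m} E" "B = Pi\<^sub>E {..<m} F"
      "E \<in> {..<m} \<rightarrow> step_sets" "F \<in> {..<m} \<rightarrow> step_sets" by blast
    then have "A \<inter> B = Pi\<^sub>E {..<m} (\<lambda>i. E i \<inter> F i)" by (simp add: PiE_Int)
    moreover have "(\<lambda>i. E i \<inter> F i) \<in> {..<m} \<rightarrow> step_sets"
      using EF Int_stable_step_sets by (auto simp: Int_stable_def Pi_def)
    ultimately show "A \<inter> B \<in> ?G" by blast
  qed
  have G_Pow: "?G \<subseteq> Pow ?\<Omega>" using PiE_step_sets_subset by blast
  have zero_P: "(LINT x:A|?C. f x) = 0" if A: "A \<in> sets ?P" for A
    using Int_stable G_Pow A[unfolded sets_PiM_step_sets]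
  proof (induction rule: sigma_sets_induct_disjoint)
    case (basic A)
    then obtain E where E: "A = Pi\<^sub>E {..<m} E" "E \<in> {..<m} \<rightarrow> step_sets" by blast
    obtain R S where R: "R > 0" "AE x in ?C. indicator (Pi\<^sub>E {..<m} E) x = step_box m R (\<lambda>i a. of_bool (a \<in> S i)) x"
      using indicator_step_box[OF E(2)] by blast
    have A_P: "A \<in> sets ?P" using basic unfolding sets_PiM_step_sets by (rule sigma_sets.Basic)
    have "(LINT x:A|?C. f x) = (LINT x|?C. f x * cnj (step_box m R (\<lambda>i a. of_bool (a \<in> S i)) x))"
      unfolding set_lebesgue_integral_def
    proof (rule integral_cong_AE)
      show "(\<lambda>x. indicat_real A x *\<^sub>R f x) \<in> borel_measurable ?C"
        using f_meas sets_PiM_unit_cube[OF A_P] by measurable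
      show "(\<lambda>x. f x * cnj (step_box m R (\<lambda>i a. of_bool (a \<in> S i)) x)) \<in> borel_measurable ?C"
        by (intro borel_measurable_times borel_measurable_cnj f_meas L2_measurable[OF L2_box])
      show "AE x in ?C. indicat_real A x *\<^sub>R f x = f x * cnj (step_box m R (\<lambda>i a. of_bool (a \<in> S i)) x)"
        using R(2)
      proof eventually_elim
        case (elim x)
        then show ?case by (simp flip: elim) (simp add: E(1) indicator_def)
      qed
    qed
    then show ?case using box0[OF R(1)] by simp
  next
    case empty
    show ?case by (simp add: set_lebesgue_integral_def)
  next
    case (compl A)
    have A: "A \<in> sets ?C"
      using compl(1) unfolding sets_PiM_step_sets[symmetric] by (rule sets_PiM_unit_cube)
    have "(LINT x:(?\<Omega> - A)|?C. f x) = (LINT x|?C. f x - indicat_real A x *\<^sub>R f x)"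
      unfolding set_lebesgue_integral_def
      by (rule Bochner_Integration.integral_cong) (auto simp: space_unit_cube indicator_def)
    also have "\<dots> = (LINT x|?C. f x) - (LINT x:A|?C. f x)"
      using set_int[OF A] int_f unfolding set_integrable_def set_lebesgue_integral_def
      by (intro Bochner_Integration.integral_diff)
    finally show ?case using total compl(2) by simp
  next
    case (union A)
    then have A: "A i \<in> sets ?C" for i
      unfolding sets_PiM_step_sets[symmetric] by (auto intro: sets_PiM_unit_cube)
    have "(LINT x:(\<Union>i. A i)|?C. f x) = (\<Sum>i. LINT x:A i|?C. f x)"
      by (rule lebesgue_integral_countable_add)
        (use A union(1) set_int in \<open>auto simp: disjoint_family_on_def\<close>)
    then show ?case using union(3) by simp
  qed
  have "AE x in ?C. f x = 0"
  proof (rule density_zero[OF int_f])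
    fix A assume A: "A \<in> sets ?C"
    then have A': "A \<in> sets (completion ?P)" by (simp add: unit_cube_def)
    \<comment> \<open>A set of the completed sigma-algebra differs from a product-measurable one by
      a null set, which the integral does not see.\<close>
    then obtain S N N' where S: "A = S \<union> N" "N \<subseteq> N'" "N' \<in> null_sets ?P" "S \<in> sets ?P"
      by (rule sets_completionE)
    have S_C: "S \<in> sets ?C" using S(4) by (rule sets_PiM_unit_cube)
    have "AE x in ?C. x \<notin> N'"
      unfolding unit_cube_def using AE_not_in[OF S(3)] by (rule AE_completion)
    then have "AE x in ?C. indicat_real A x *\<^sub>R f x = indicat_real S x *\<^sub>R f x"
      by eventually_elim (use S in \<open>auto simp: indicator_def\<close>)
    then have "(LINT x:A|?C. f x) = (LINT x:S|?C. f x)"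
      unfolding set_lebesgue_integral_def
      by (rule integral_cong_AE[rotated 2]) (use f_meas A S_C in measurable)
    then show "(LINT x:A|?C. f x) = 0" using zero_P[OF S(4)] by simp
  qed
  then show ?thesis by (simp add: ae_eq_def)
qed

section \<open>Weak limits of the representation operators\<close>

text \<open>Each fibre is enumerated separately and placed in its own block of \<open>L\<close>
  consecutive numbers, so division by \<open>L\<close> recovers the fibre.\<close>

lemma bij_betw_with_fibres:
  assumes X: "finite X" and p: "\<And>x. x \<in> X \<Longrightarrow> p x < R"
    and card: "\<And>a. a < R \<Longrightarrow> card {x \<in> X. p x = a} = L"
  obtains \<beta> where "bij_betw \<beta> X {..<R * L}" "\<And>x. x \<in> X \<Longrightarrow> \<beta> x div L = (p x :: nat)"
proof -
  have "\<forall>a\<in>{..<R}. \<exists>\<gamma>. bij_betw \<gamma> {x \<in> X. p x = a} {..<L}"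
    using card X by (auto intro!: finite_same_card_bij)
  then obtain \<gamma> where \<gamma>: "\<And>a. a < R \<Longrightarrow> bij_betw (\<gamma> a) {x \<in> X. p x = a} {..<L}"
    by (metis lessThan_iff)
  define \<beta> where "\<beta> x = p x * L + \<gamma> (p x) x" for x
  have \<gamma>_lt: "\<gamma> (p x) x < L" if "x \<in> X" for x
    using bij_betwE[OF \<gamma>[OF p[OF that]]] that by auto
  have div: "\<beta> x div L = p x" and mod: "\<beta> x mod L = \<gamma> (p x) x" if "x \<in> X" for x
    using \<gamma>_lt[OF that] by (auto simp: \<beta>_def)
  have inj: "inj_on \<beta> X"
  proof (rule inj_onI)
    fix x y assume xy: "x \<in> X" "y \<in> X" "\<beta> x = \<beta> y"
    then have "p x = p y" "\<gamma> (p x) x = \<gamma> (p y) y" using div mod by metis+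
    then show "x = y" using bij_betw_imp_inj_on[OF \<gamma>[OF p[OF xy(1)]]] xy by (auto dest: inj_onD)
  qed
  have "\<beta> ` X \<subseteq> {..<R * L}"
  proof
    fix y assume "y \<in> \<beta> ` X"
    then obtain x where x: "x \<in> X" "y = \<beta> x" by auto
    have "\<beta> x < (p x + 1) * L" using \<gamma>_lt[OF x(1)] by (simp add: \<beta>_def)
    also have "\<dots> \<le> R * L" using p[OF x(1)] by (intro mult_right_mono) auto
    finally show "y \<in> {..<R * L}" using x by simp
  qed
  moreover have "card X = R * L"
  proof -
    have "card X = (\<Sum>a<R. card {x \<in> X. p x = a})"
      using sum_fun_comp[OF X, of "{..<R}" p "\<lambda>_. 1::nat"] p by (simp add: image_subset_iff)
    then show ?thesis using card by simp
  qed
  ultimately have "\<beta> ` X = {..<R * L}"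
    using card_image[OF inj] by (intro card_subset_eq) auto
  with inj have "bij_betw \<beta> X {..<R * L}" by (simp add: bij_betw_def)
  then show thesis using div by (rule that)
qed

text \<open>A nonnegative integer matrix with constant row and column sums is a table of block
  counts: exactly \<open>n a b\<close> indices in block \<open>b\<close> are sent to block
  \<open>a\<close>. The sum over \<open>F\<close> encodes this count in the form used for inner
  products.\<close>

lemma permutation_of_contingency_table:
  fixes n :: "nat \<Rightarrow> nat \<Rightarrow> nat"
  assumes row: "\<And>a. a < R \<Longrightarrow> (\<Sum>b<R. n a b) = L" and col: "\<And>b. b < R \<Longrightarrow> (\<Sum>a<R. n a b) = L"
  shows "\<exists>\<pi>. \<pi> permutes {..<R * L} \<and> (\<forall>F :: nat \<Rightarrow> nat \<Rightarrow> complex.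
    (\<Sum>i<R * L. F (\<pi> i div L) (i div L)) = (\<Sum>a<R. \<Sum>b<R. of_nat (n a b) * F a b))"
proof -
  \<comment> \<open>A set of tokens, \<open>n a b\<close> of them for each pair. They are numbered
    once by rows (\<open>\<beta>\<close>) and once by columns (\<open>\<beta>'\<close>), and
    \<open>\<pi>\<close> passes from the second numbering to the first.\<close>
  define X where "X = (SIGMA a:{..<R}. SIGMA b:{..<R}. {..<n a b})"
  have fin: "finite X" by (auto simp: X_def)
  have row_card: "card {x \<in> X. fst x = a} = L" if "a < R" for a
  proof -
    have "{x \<in> X. fst x = a} = {a} \<times> (SIGMA b:{..<R}. {..<n a b})" using that by (auto simp: X_def)
    then show ?thesis using row[OF that] by (simp add: card_cartesian_product card_SigmaI)
  qed
  have col_card: "card {x \<in> X. fst (snd x) = b} = L" if "b < R" for b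
  proof -
    have "bij_betw (\<lambda>(a, t). (a, b, t)) (SIGMA a:{..<R}. {..<n a b}) {x \<in> X. fst (snd x) = b}"
      using that by (intro bij_betwI[where g="\<lambda>(a, b, t). (a, t)"]) (auto simp: X_def)
    from bij_betw_same_card[OF this] show ?thesis using col[OF that] by (simp add: card_SigmaI)
  qed
  obtain \<beta> where \<beta>: "bij_betw \<beta> X {..<R * L}" "\<And>x. x \<in> X \<Longrightarrow> \<beta> x div L = fst x"
    by (rule bij_betw_with_fibres[where p=fst, OF fin _ row_card]) (auto simp: X_def)
  obtain \<beta>' where \<beta>': "bij_betw \<beta>' X {..<R * L}" "\<And>x. x \<in> X \<Longrightarrow> \<beta>' x div L = fst (snd x)"
    by (rule bij_betw_with_fibres[where p="\<lambda>x. fst (snd x)", OF fin _ col_card]) (auto simp: X_def)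
  define \<pi> where "\<pi> i = (if i < R * L then \<beta> (inv_into X \<beta>' i) else i)" for i
  have "bij_betw (\<beta> \<circ> inv_into X \<beta>') {..<R * L} {..<R * L}"
    by (rule bij_betw_trans[OF bij_betw_inv_into[OF \<beta>'(1)] \<beta>(1)])
  then have "bij_betw \<pi> {..<R * L} {..<R * L}"
    by (rule bij_betw_cong[THEN iffD1, rotated]) (simp add: \<pi>_def)
  then have perm: "\<pi> permutes {..<R * L}"
    by (rule bij_imp_permutes) (simp add: \<pi>_def)
  have "(\<Sum>i<R * L. F (\<pi> i div L) (i div L)) = (\<Sum>a<R. \<Sum>b<R. of_nat (n a b) * F a b)"
    for F :: "nat \<Rightarrow> nat \<Rightarrow> complex"
  proof -
    have "(\<Sum>i<R * L. F (\<pi> i div L) (i div L)) = (\<Sum>x\<in>X. F (\<pi> (\<beta>' x) div L) (\<beta>' x div L))"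
      by (rule sum.reindex_bij_betw[OF \<beta>'(1), symmetric])
    also have "\<dots> = (\<Sum>x\<in>X. F (fst x) (fst (snd x)))"
    proof (rule sum.cong[OF refl])
      fix x assume x: "x \<in> X"
      then have "\<beta>' x < R * L" using bij_betwE[OF \<beta>'(1)] by auto
      then have "\<pi> (\<beta>' x) = \<beta> x"
        using bij_betw_inv_into_left[OF \<beta>'(1) x] by (simp add: \<pi>_def)
      then show "F (\<pi> (\<beta>' x) div L) (\<beta>' x div L) = F (fst x) (fst (snd x))"
        using \<beta>(2)[OF x] \<beta>'(2)[OF x] by simp
    qed
    also have "\<dots> = (\<Sum>a<R. \<Sum>b<R. \<Sum>t<n a b. F a b)"
      by (simp add: X_def sum.Sigma split_def del: sum_constant)
    finally show ?thesis by simp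
  qed
  with perm show ?thesis by blast
qed

lemma sum_div_blocks:
  fixes F :: "nat \<Rightarrow> 'a::comm_semiring_1"
  assumes "s > 0"
  shows "(\<Sum>b<R * s. F (b div s)) = of_nat s * (\<Sum>b<R. F b)"
proof -
  have "(\<Sum>b<R * s. F (b div s)) = (\<Sum>a<R. \<Sum>b=a * s..<a * s + s. F (b div s))"
    by (rule sum.nat_group[symmetric])
  also have "\<dots> = (\<Sum>a<R. \<Sum>b=a * s..<a * s + s. F a)"
  proof (intro sum.cong refl arg_cong[of _ _ F])
    fix a b assume "b \<in> {a * s..<a * s + s}"
    then show "b div s = a" using assms by (intro div_nat_eqI) (auto simp: mult.commute)
  qed
  finally show ?thesis by (simp add: sum_distrib_left)
qed

section \<open>Tensor powers and the limiting form\<close>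

definition tens :: "nat \<Rightarrow> (nat \<Rightarrow> int) \<Rightarrow> nat set \<Rightarrow> cube_fun" where
  "tens R h I x = (\<Prod>i\<in>I. of_int (step R h (x i)))"

lemma tens_eq_box:
  assumes "I \<subseteq> {..<m}"
  shows "tens R h I = step_box m R (\<lambda>i a. if i \<in> I then of_int (h a) else 1)"
proof
  fix x
  have "tens R h I x = (\<Prod>i\<in>{..<m} \<inter> I. of_int (step R h (x i)))"
    using assms by (simp add: tens_def Int_absorb1)
  also have "\<dots> = (\<Prod>i<m. if i \<in> I then of_int (step R h (x i)) else 1)"
    by (rule prod.inter_restrict) simp
  also have "\<dots> = step_box m R (\<lambda>i a. if i \<in> I then of_int (h a) else 1) x"
    unfolding step_box_def by (rule prod.cong) (auto simp: step_def)
  finally show "tens R h I x = step_box m R (\<lambda>i a. if i \<in> I then of_int (h a) else 1) x" .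
qed

lemma tens_L2: "I \<subseteq> {..<m} \<Longrightarrow> tens R h I \<in> L2 m"
  by (simp add: tens_eq_box L2_box)

lemma tens_refine: "s > 0 \<Longrightarrow> tens R h I = tens (R * s) (\<lambda>a. h (a div s)) I"
  unfolding tens_def fun_eq_iff
  by (intro allI prod.cong refl arg_cong[of _ _ of_int]) (rule step_refine)

definition rho_map :: "nat \<Rightarrow> (real \<Rightarrow> real) \<Rightarrow> (nat \<Rightarrow> real) \<Rightarrow> nat \<Rightarrow> real" where
  "rho_map m \<phi> x = (\<lambda>i\<in>{..<m}. inv_into {0..1} \<phi> (x i))"

lemma rho_eq: "rho m \<phi> f = (\<lambda>x. f (rho_map m \<phi> x))"
  by (simp add: rho_def rho_map_def)

lemma cube_mp_rho_map: "\<phi> \<in> mp_bijections \<Longrightarrow> cube_mp m (rho_map m \<phi>)"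
  using cube_mp_coordinatewise[OF permutes_id, of m "\<lambda>_. inv_into {0..1} \<phi>"]
  by (simp add: rho_map_def[abs_def] mp_bijections_inv_mp_map id_def)

lemma L2_rho: "\<phi> \<in> mp_bijections \<Longrightarrow> f \<in> L2 m \<Longrightarrow> rho m \<phi> f \<in> L2 m"
  unfolding rho_eq by (rule cube_mp_L2[OF cube_mp_rho_map])

lemma L2_norm_rho: "\<phi> \<in> mp_bijections \<Longrightarrow> f \<in> L2 m \<Longrightarrow> L2_norm m (rho m \<phi> f) = L2_norm m f"
  unfolding rho_eq by (rule cube_mp_norm[OF cube_mp_rho_map])

text \<open>The weak limit below is the tensor power of the Markov operator with kernel
  \<open>1 + g(x) h(y) / q\<close>.\<close>

definition rank_two_form ::
  "nat \<Rightarrow> nat \<Rightarrow> (nat \<Rightarrow> int) \<Rightarrow> (nat \<Rightarrow> int) \<Rightarrow> nat \<Rightarrow> cube_fun \<Rightarrow> cube_fun \<Rightarrow> complex" where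
  "rank_two_form m R g h q f w =
    (\<Sum>I\<in>Pow {..<m}. (1 / of_nat q) ^ card I * L2_inner m f (tens R h I) * L2_inner m (tens R g I) w)"

text \<open>On the grid \<open>R0 * s\<close> a single exchange of cells attains the limiting form
  exactly. Each coordinate contributes one block-count sum with table
  \<open>q + h' a * g' b\<close>.\<close>

lemma rho_box_form:
  assumes R0: "R0 > 0" and s: "s > 0" and q: "q > 0"
    and g0: "(\<Sum>a<R0. g a) = 0" and h0: "(\<Sum>a<R0. h a) = 0"
    and gh: "\<And>a b. a < R0 \<Longrightarrow> b < R0 \<Longrightarrow> \<bar>h a * g b\<bar> \<le> int q"
  obtains \<phi> where "\<phi> \<in> mp_bijections"
    "\<And>v w. L2_inner m (rho m \<phi> (step_box m (R0 * s) v)) (step_box m (R0 * s) w) =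
       rank_two_form m R0 g h q (step_box m (R0 * s) v) (step_box m (R0 * s) w)"
proof -
  define R where "R = R0 * s"
  \<comment> \<open>The common row and column sum: the \<open>h' a * g' b\<close> part sums to zero
    in both directions, leaving \<open>q\<close> once per cell. The permutation acts on
    \<open>R\<close> blocks of \<open>L\<close> cells.\<close>
  define L where "L = R * q"
  define N where "N = R * L"
  define g' where "g' a = g (a div s)" for a
  define h' where "h' a = h (a div s)" for a
  have R: "R > 0" using R0 s by (simp add: R_def)
  have L: "L > 0" using R q by (simp add: L_def)
  have N: "N > 0" using R L by (simp add: N_def)
  have g'0: "(\<Sum>a<R. g' a) = 0" and h'0: "(\<Sum>a<R. h' a) = 0"
    using sum_div_blocks[OF s, of g R0] sum_div_blocks[OF s, of h R0]
    by (auto simp: g'_def h'_def R_def g0 h0)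
  define n where "n a b = nat (int q + h' a * g' b)" for a b
  have n: "int (n a b) = int q + h' a * g' b" if "a < R" "b < R" for a b
  proof -
    have "a div s < R0" "b div s < R0" using that s by (auto simp: R_def less_mult_imp_div_less)
    from abs_le_D2[OF gh[OF this]] have "0 \<le> int q + h' a * g' b"
      unfolding h'_def g'_def by linarith
    then show ?thesis unfolding n_def by (rule int_nat_eq[THEN trans, OF if_P])
  qed
  have row: "(\<Sum>b<R. n a b) = L" if "a < R" for a
  proof -
    have "int (\<Sum>b<R. n a b) = (\<Sum>b<R. int q + h' a * g' b)" using n that by simp
    also have "\<dots> = int L" by (simp add: sum.distrib L_def g'0 flip: sum_distrib_left)
    finally show ?thesis by (simp only: of_nat_eq_iff)
  qed
  have col: "(\<Sum>a<R. n a b) = L" if "b < R" for b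
  proof -
    have "int (\<Sum>a<R. n a b) = (\<Sum>a<R. int q + h' a * g' b)" using n that by simp
    also have "\<dots> = int L" by (simp add: sum.distrib L_def h'0 flip: sum_distrib_right)
    finally show ?thesis by (simp only: of_nat_eq_iff)
  qed
  obtain \<pi> where \<pi>: "\<pi> permutes {..<R * L}"
    and sum_\<pi>: "\<And>F :: nat \<Rightarrow> nat \<Rightarrow> complex.
      (\<Sum>i<R * L. F (\<pi> i div L) (i div L)) = (\<Sum>a<R. \<Sum>b<R. of_nat (n a b) * F a b)"
    using permutation_of_contingency_table[of R n L, OF row col] by blast
  have \<pi>N: "inv \<pi> permutes {..<N}" using permutes_inv[OF \<pi>] by (simp add: N_def)
  \<comment> \<open>The inverse appears because \<open>rho\<close> composes with the inverse of
    \<open>\<phi>\<close>; the argument of the function is then moved by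
    \<open>exch N \<pi>\<close>.\<close>
  define \<phi> where "\<phi> = exch N (inv \<pi>)"
  have \<phi>: "\<phi> \<in> mp_bijections" unfolding \<phi>_def by (rule exch_mp_bijection(1)[OF N \<pi>N])
  have inv_\<phi>: "inv_into {0..1} \<phi> x = exch N \<pi> x" if "x \<in> {0..1}" for x
    using exch_mp_bijection(2)[OF N \<pi>N that] permutes_inv_inv[OF \<pi>] by (simp add: \<phi>_def)
  have "L2_inner m (rho m \<phi> (step_box m R v)) (step_box m R w) = rank_two_form m R0 g h q (step_box m R v) (step_box m R w)" for v w
  proof -
    \<comment> \<open>\<open>A\<close> and \<open>B\<close> are the means of the factors in
      coordinate \<open>i\<close>, \<open>C\<close> and \<open>D\<close> their correlations with
      \<open>h\<close> and \<open>g\<close>; the kernel pairs them as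
      \<open>A B + C D / q\<close>.\<close>
    define A where "A i = (\<Sum>a<R. v i a) / of_nat R" for i
    define B where "B i = (\<Sum>b<R. cnj (w i b)) / of_nat R" for i
    define C where "C i = (\<Sum>a<R. v i a * of_int (h' a)) / of_nat R" for i
    define D where "D i = (\<Sum>b<R. of_int (g' b) * cnj (w i b)) / of_nat R" for i
    have rho_box: "rho m \<phi> (step_box m R v) x = step_box m N (\<lambda>i a. v i (\<pi> a div L)) x"
      if x: "x \<in> space (unit_cube m)" for x
    proof -
      have "step R (v i) (inv_into {0..1} \<phi> (x i)) = step N (\<lambda>a. v i (\<pi> a div L)) (x i)" if i: "i < m" for i
      proof -
        have "step R (v i) (inv_into {0..1} \<phi> (x i)) = step N (\<lambda>a. v i (a div L)) (exch N \<pi> (x i))"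
          unfolding N_def using inv_\<phi>[OF component_in_unit[OF x i]] step_refine[OF L, of R "v i"]
          by (simp add: N_def)
        then show ?thesis by (simp add: step_exch[OF N])
      qed
      then show ?thesis by (simp add: rho_def step_box_def)
    qed
    have "L2_inner m (rho m \<phi> (step_box m R v)) (step_box m R w) =
        L2_inner m (step_box m N (\<lambda>i a. v i (\<pi> a div L))) (step_box m N (\<lambda>i a. w i (a div L)))"
      by (rule L2_inner_cong) (use rho_box box_refine[OF L, of m R w] in \<open>auto simp: N_def\<close>)
    also have "\<dots> = (\<Prod>i<m. (\<Sum>a<R. \<Sum>b<R. of_nat (n a b) * (v i a * cnj (w i b))) / of_nat N)"
      unfolding L2_inner_box[OF N]
      using sum_\<pi>[of "\<lambda>a b. v _ a * cnj (w _ b)"] by (simp add: N_def)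
    also have "\<dots> = (\<Prod>i<m. (1 / of_nat q) * (C i * D i) + A i * B i)"
    proof (rule prod.cong[OF refl])
      fix i
      have "(\<Sum>a<R. \<Sum>b<R. of_nat (n a b) * (v i a * cnj (w i b))) =
          (\<Sum>a<R. \<Sum>b<R. of_nat q * (v i a * cnj (w i b)) + v i a * of_int (h' a) * (of_int (g' b) * cnj (w i b)))"
      proof (intro sum.cong refl)
        fix a b assume "a \<in> {..<R}" "b \<in> {..<R}"
        then have "(of_nat (n a b) :: complex) = of_int (int q + h' a * g' b)"
          using n[of a b] by (metis lessThan_iff of_int_of_nat_eq)
        then show "of_nat (n a b) * (v i a * cnj (w i b)) =
            of_nat q * (v i a * cnj (w i b)) + v i a * of_int (h' a) * (of_int (g' b) * cnj (w i b))"
          by (simp add: algebra_simps)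
      qed
      also have "\<dots> = of_nat q * ((\<Sum>a<R. v i a) * (\<Sum>b<R. cnj (w i b))) +
          (\<Sum>a<R. v i a * of_int (h' a)) * (\<Sum>b<R. of_int (g' b) * cnj (w i b))"
        unfolding sum_product by (simp add: sum.distrib sum_distrib_left)
      finally show "(\<Sum>a<R. \<Sum>b<R. of_nat (n a b) * (v i a * cnj (w i b))) / of_nat N =
          (1 / of_nat q) * (C i * D i) + A i * B i"
        using R q by (simp add: A_def B_def C_def D_def N_def L_def field_simps)
    qed
    \<comment> \<open>Expanding the product over coordinates creates the sum over \<open>I\<close>:
      inside \<open>I\<close> the correlation term is chosen, outside it the means.\<close>
    also have "\<dots> = (\<Sum>I\<in>Pow {..<m}. (\<Prod>i\<in>I. (1 / of_nat q) * (C i * D i)) * (\<Prod>i\<in>{..<m} - I. A i * B i))"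
      by (rule prod_add) simp
    also have "\<dots> = rank_two_form m R0 g h q (step_box m R v) (step_box m R w)"
      unfolding rank_two_form_def
    proof (rule sum.cong[OF refl])
      fix I assume "I \<in> Pow {..<m}"
      then have I: "I \<subseteq> {..<m}" by simp
      have split: "(\<Prod>i<m. if i \<in> I then F i else G i) = (\<Prod>i\<in>I. F i) * (\<Prod>i\<in>{..<m} - I. G i)"
        for F G :: "nat \<Rightarrow> complex"
        using prod.If_cases[of "{..<m}" "\<lambda>i. i \<in> I" F G] I by (simp add: Int_absorb1 Diff_eq)
      have tens_R: "tens R0 u I = step_box m R (\<lambda>i a. if i \<in> I then of_int (u (a div s)) else 1)" for u
        using tens_refine[OF s, of R0 u I] tens_eq_box[OF I, of R "\<lambda>a. u (a div s)"] by (simp add: R_def)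
      have 1: "L2_inner m (step_box m R v) (tens R0 h I) = (\<Prod>i\<in>I. C i) * (\<Prod>i\<in>{..<m} - I. A i)"
        unfolding tens_R L2_inner_box[OF R] split[symmetric]
        by (intro prod.cong refl) (auto simp: C_def A_def h'_def)
      have 2: "L2_inner m (tens R0 g I) (step_box m R w) = (\<Prod>i\<in>I. D i) * (\<Prod>i\<in>{..<m} - I. B i)"
        unfolding tens_R L2_inner_box[OF R] split[symmetric]
        by (intro prod.cong refl) (auto simp: D_def B_def g'_def)
      show "(\<Prod>i\<in>I. (1 / of_nat q) * (C i * D i)) * (\<Prod>i\<in>{..<m} - I. A i * B i) =
        (1 / of_nat q) ^ card I * L2_inner m (step_box m R v) (tens R0 h I) * L2_inner m (tens R0 g I) (step_box m R w)"
        unfolding 1 2 prod.distrib by (simp add: ac_simps)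
    qed
    finally show ?thesis .
  qed
  with \<phi> show thesis unfolding R_def by (rule that)
qed

text \<open>Only null functions are orthogonal to all boxes, so the double orthogonal complement of
  \<open>M\<close> is the whole space.\<close>

lemma L2_box_dense:
  assumes M: "closed_subspace m M" and box: "\<And>R v. R > 0 \<Longrightarrow> step_box m R v \<in> M"
  shows "L2 m \<subseteq> M"
proof
  fix f assume f: "f \<in> L2 m"
  show "f \<in> M"
  proof (rule closed_subspace_biorthogonal[OF M f])
    fix q assume q: "q \<in> L2 m" "\<And>g. g \<in> M \<Longrightarrow> L2_inner m g q = 0"
    then have "ae_eq m q (\<lambda>_. 0)"
      using box L2_inner_eq_0_commute by (intro L2_box_total) blast+
    then have "L2_inner m f q = L2_inner m f (\<lambda>_. 0)"
      using f q by (intro L2_inner_ae_cong) (auto simp: L2_const ae_eq_def)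
    then show "L2_inner m f q = 0" by simp
  qed
qed

text \<open>The three-epsilon argument: with a bound uniform in \<open>n\<close>, convergence of
  linear functionals survives norm limits of the argument. Weak convergence then has to be checked
  only on boxes.\<close>

lemma closed_subspace_tendsto:
  assumes addA: "\<And>n f g. f \<in> L2 m \<Longrightarrow> g \<in> L2 m \<Longrightarrow> A n (\<lambda>x. f x + g x) = A n f + A n g"
    and scaleA: "\<And>n c f. f \<in> L2 m \<Longrightarrow> A n (\<lambda>x. c * f x) = c * A n f"
    and boundA: "\<And>n f. f \<in> L2 m \<Longrightarrow> cmod (A n f) \<le> C * L2_norm m f"
    and addB: "\<And>f g. f \<in> L2 m \<Longrightarrow> g \<in> L2 m \<Longrightarrow> B (\<lambda>x. f x + g x) = B f + B g"
    and scaleB: "\<And>c f. f \<in> L2 m \<Longrightarrow> B (\<lambda>x. c * f x) = c * B f"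
    and boundB: "\<And>f. f \<in> L2 m \<Longrightarrow> cmod (B f) \<le> D * L2_norm m f"
  shows "closed_subspace m {f \<in> L2 m. (\<lambda>n::nat. A n f) \<longlonglongrightarrow> B f}"
proof (rule closed_subspaceI)
  have "A n (\<lambda>x. 0) = 0" "B (\<lambda>x. 0) = 0" for n
    using scaleA[OF L2_const, of n 0] scaleB[OF L2_const, of 0] by auto
  then show "(\<lambda>_. 0) \<in> {f \<in> L2 m. (\<lambda>n. A n f) \<longlonglongrightarrow> B f}" by (simp add: L2_const)
next
  fix f g assume "f \<in> {f \<in> L2 m. (\<lambda>n. A n f) \<longlonglongrightarrow> B f}" "g \<in> {f \<in> L2 m. (\<lambda>n. A n f) \<longlonglongrightarrow> B f}"
  then show "(\<lambda>x. f x + g x) \<in> {f \<in> L2 m. (\<lambda>n. A n f) \<longlonglongrightarrow> B f}"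
    by (simp add: L2_add addA addB tendsto_add)
next
  fix c f assume "f \<in> {f \<in> L2 m. (\<lambda>n. A n f) \<longlonglongrightarrow> B f}"
  then show "(\<lambda>x. c * f x) \<in> {f \<in> L2 m. (\<lambda>n. A n f) \<longlonglongrightarrow> B f}"
    by (simp add: L2_scale scaleA scaleB tendsto_mult_left)
next
  fix s f assume s: "\<And>k::nat. s k \<in> {f \<in> L2 m. (\<lambda>n. A n f) \<longlonglongrightarrow> B f}" and f: "f \<in> L2 m"
    and lim: "(\<lambda>k. L2_norm m (\<lambda>x. s k x - f x)) \<longlonglongrightarrow> 0"
  have sL2: "s k \<in> L2 m" and sl: "(\<lambda>n. A n (s k)) \<longlonglongrightarrow> B (s k)" for k using s by auto
  have d: "(\<lambda>x. s k x - f x) \<in> L2 m" for k using sL2 f by (rule L2_diff)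
  have diffA: "A n (\<lambda>x. s k x - f x) = A n (s k) - A n f" for n k
    using addA[OF sL2 L2_scale[OF f, of "-1"], of n k] scaleA[OF f, of n "-1"] by simp
  have diffB: "B (\<lambda>x. s k x - f x) = B (s k) - B f" for k
    using addB[OF sL2 L2_scale[OF f, of "-1"], of k] scaleB[OF f, of "-1"] by simp
  have "(\<lambda>n. A n f) \<longlonglongrightarrow> B f"
  proof (rule LIMSEQ_I)
    fix e :: real assume e: "e > 0"
    \<comment> \<open>A positive number dominating both bounds, whatever their signs.\<close>
    define K where "K = \<bar>C\<bar> + \<bar>D\<bar> + 1"
    have K: "K > 0" by (simp add: K_def)
    obtain k where k: "L2_norm m (\<lambda>x. s k x - f x) < e / (3 * K)"
      using LIMSEQ_D[OF lim, of "e / (3 * K)"] e K by auto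
    have small: "t * L2_norm m (\<lambda>x. s k x - f x) < e / 3" if "t \<le> K" for t
    proof -
      have "t * L2_norm m (\<lambda>x. s k x - f x) \<le> K * L2_norm m (\<lambda>x. s k x - f x)"
        using that by (intro mult_right_mono) auto
      also have "\<dots> < K * (e / (3 * K))" using k K by (intro mult_strict_left_mono)
      finally show ?thesis using K by simp
    qed
    have C: "C \<le> K" and D: "D \<le> K" by (auto simp: K_def)
    obtain N where N: "\<And>n. n \<ge> N \<Longrightarrow> cmod (A n (s k) - B (s k)) < e / 3"
      using LIMSEQ_D[OF sl, of "e/3" k] e by auto
    have "cmod (A n f - B f) < e" if "n \<ge> N" for n
    proof -
      have "cmod (A n f - B f) = cmod ((A n (s k) - B (s k)) - A n (\<lambda>x. s k x - f x) + B (\<lambda>x. s k x - f x))"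
        by (simp add: diffA diffB)
      also have "\<dots> \<le> cmod (A n (s k) - B (s k)) + cmod (A n (\<lambda>x. s k x - f x)) + cmod (B (\<lambda>x. s k x - f x))"
        by (intro order_trans[OF norm_triangle_ineq] add_right_mono norm_triangle_ineq4)
      also have "\<dots> < e / 3 + e / 3 + e / 3"
        using N[OF that] order_le_less_trans[OF boundA[OF d[of k], of n] small[OF C]]
          order_le_less_trans[OF boundB[OF d[of k]] small[OF D]] by linarith
      finally show ?thesis by simp
    qed
    then show "\<exists>N. \<forall>n\<ge>N. norm (A n f - B f) < e" by blast
  qed
  then show "f \<in> {f \<in> L2 m. (\<lambda>n. A n f) \<longlonglongrightarrow> B f}" using f by simp
qed auto

lemma rank_two_form_bound:
  assumes "f \<in> L2 m" "w \<in> L2 m"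
  shows "cmod (rank_two_form m R g h q f w) \<le>
    (\<Sum>I\<in>Pow {..<m}. (1 / real q) ^ card I * L2_norm m (tens R h I) * L2_norm m (tens R g I)) *
      (L2_norm m f * L2_norm m w)"
  unfolding rank_two_form_def sum_distrib_right
proof (rule order_trans[OF norm_sum sum_mono])
  fix I assume "I \<in> Pow {..<m}"
  then have t: "tens R h I \<in> L2 m" "tens R g I \<in> L2 m" by (auto intro: tens_L2)
  have "cmod ((1 / of_nat q) ^ card I * L2_inner m f (tens R h I) * L2_inner m (tens R g I) w) =
      (1 / real q) ^ card I * (cmod (L2_inner m f (tens R h I)) * cmod (L2_inner m (tens R g I) w))"
    by (simp add: norm_mult norm_power norm_divide)
  also have "\<dots> \<le> (1 / real q) ^ card I * ((L2_norm m f * L2_norm m (tens R h I)) * (L2_norm m (tens R g I) * L2_norm m w))"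
    using assms t by (intro mult_left_mono mult_mono L2_Cauchy_Schwarz) auto
  finally show "cmod ((1 / of_nat q) ^ card I * L2_inner m f (tens R h I) * L2_inner m (tens R g I) w)
      \<le> (1 / real q) ^ card I * L2_norm m (tens R h I) * L2_norm m (tens R g I) * (L2_norm m f * L2_norm m w)"
    by (simp add: ac_simps)
qed

text \<open>One sequence \<open>\<phi>\<close> serves all \<open>f\<close> and \<open>w\<close>. For
  two boxes the identity is exact from some index on; it is extended by density first in
  \<open>f\<close> with \<open>w\<close> a box, then in \<open>w\<close>.\<close>

lemma rho_weak_limit:
  assumes R0: "R0 > 0" and q: "q > 0"
    and g0: "(\<Sum>a<R0. g a) = 0" and h0: "(\<Sum>a<R0. h a) = 0"
    and gh: "\<And>a b. a < R0 \<Longrightarrow> b < R0 \<Longrightarrow> \<bar>h a * g b\<bar> \<le> int q"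
  obtains \<phi> where "\<And>n::nat. \<phi> n \<in> mp_bijections"
    "\<And>f w. f \<in> L2 m \<Longrightarrow> w \<in> L2 m \<Longrightarrow>
       (\<lambda>n. L2_inner m (rho m (\<phi> n) f) w) \<longlonglongrightarrow> rank_two_form m R0 g h q f w"
proof -
  \<comment> \<open>The factorial makes every grid size \<open>Q \<le> n\<close> divide
    \<open>R0 * fact n\<close>, so each box eventually lives on the grid of
    \<open>\<phi> n\<close>.\<close>
  have "\<exists>\<phi>. \<phi> \<in> mp_bijections \<and> (\<forall>v w. L2_inner m (rho m \<phi> (step_box m (R0 * fact n) v)) (step_box m (R0 * fact n) w) =
       rank_two_form m R0 g h q (step_box m (R0 * fact n) v) (step_box m (R0 * fact n) w))" for n
    by (rule rho_box_form[OF R0 fact_gt_zero q g0 h0 gh]) auto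
  then obtain \<phi> where \<phi>: "\<And>n. \<phi> n \<in> mp_bijections"
    and exact: "\<And>n v w. L2_inner m (rho m (\<phi> n) (step_box m (R0 * fact n) v)) (step_box m (R0 * fact n) w) =
       rank_two_form m R0 g h q (step_box m (R0 * fact n) v) (step_box m (R0 * fact n) w)"
    by metis
  let ?B = "rank_two_form m R0 g h q"
  let ?lim = "\<lambda>f w. (\<lambda>n. L2_inner m (rho m (\<phi> n) f) w) \<longlonglongrightarrow> ?B f w"
  define c where "c = (\<Sum>I\<in>Pow {..<m}. (1 / real q) ^ card I * L2_norm m (tens R0 h I) * L2_norm m (tens R0 g I))"
  have B_bound: "cmod (?B f w) \<le> c * (L2_norm m f * L2_norm m w)" if "f \<in> L2 m" "w \<in> L2 m" for f w
    unfolding c_def by (rule rank_two_form_bound[OF that])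
  have tens: "tens R0 u I \<in> L2 m" if "I \<in> Pow {..<m}" for u I using that by (auto intro: tens_L2)
  note rho_L2 = L2_rho[OF \<phi>]
  have box_box: "?lim (step_box m R v) (step_box m R' w)" if R: "R > 0" "R' > 0" for R v R' w
  proof (rule tendsto_eventually, rule eventually_sequentiallyI[of "max R R'"])
    fix n assume n: "max R R' \<le> n"
    have refine: "\<exists>v'. step_box m Q v = step_box m (R0 * fact n) v'" if "Q > 0" "Q \<le> n" for Q v
    proof -
      have "Q dvd R0 * fact n" using that by (intro dvd_mult dvd_fact) auto
      then obtain s where s: "R0 * fact n = Q * s" by blast
      then have "s > 0" using R0 by (metis fact_gt_zero mult_pos_pos mult_0_right gr0I less_irrefl)
      then show ?thesis using box_refine[of s m Q v] s by auto
    qed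
    from refine[OF R(1)] refine[OF R(2)] n
    obtain v' w' where "step_box m R v = step_box m (R0 * fact n) v'" "step_box m R' w = step_box m (R0 * fact n) w'"
      by (metis max.boundedE)
    then show "L2_inner m (rho m (\<phi> n) (step_box m R v)) (step_box m R' w) = ?B (step_box m R v) (step_box m R' w)"
      using exact by simp
  qed
  have f_box: "?lim f (step_box m R w)" if f: "f \<in> L2 m" and R: "R > 0" for f R w
  proof -
    have "closed_subspace m {f \<in> L2 m. ?lim f (step_box m R w)}"
    proof (rule closed_subspace_tendsto)
      show "cmod (L2_inner m (rho m (\<phi> n) f) (step_box m R w)) \<le> L2_norm m (step_box m R w) * L2_norm m f"
        if "f \<in> L2 m" for n f
        using L2_Cauchy_Schwarz[OF rho_L2[OF that] L2_box, of n R w] L2_norm_rho[OF \<phi> that]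
        by (simp add: mult.commute)
      show "cmod (?B f (step_box m R w)) \<le> (c * L2_norm m (step_box m R w)) * L2_norm m f" if "f \<in> L2 m" for f
        using B_bound[OF that L2_box, of R w] by (simp add: ac_simps)
      show "L2_inner m (rho m (\<phi> n) (\<lambda>x. f x + g x)) (step_box m R w) =
          L2_inner m (rho m (\<phi> n) f) (step_box m R w) + L2_inner m (rho m (\<phi> n) g) (step_box m R w)"
        if "f \<in> L2 m" "g \<in> L2 m" for n f g
        using L2_inner_add_left[OF rho_L2[OF that(1)] rho_L2[OF that(2)] L2_box] by (simp add: rho_eq)
      show "?B (\<lambda>x. f x + g x) (step_box m R w) = ?B f (step_box m R w) + ?B g (step_box m R w)"
        if "f \<in> L2 m" "g \<in> L2 m" for f g
        unfolding rank_two_form_def sum.distrib[symmetric]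
        using that by (intro sum.cong refl) (simp add: L2_inner_add_left tens distrib_left distrib_right)
    qed (auto simp: rho_eq L2_inner_scale_left rank_two_form_def sum_distrib_left ac_simps)
    then have "L2 m \<subseteq> {f \<in> L2 m. ?lim f (step_box m R w)}"
      by (rule L2_box_dense) (simp add: L2_box box_box[OF _ R])
    with f show ?thesis by auto
  qed
  have "?lim f w" if f: "f \<in> L2 m" and w: "w \<in> L2 m" for f w
  proof -
    have rf: "rho m (\<phi> n) f \<in> L2 m" for n using f by (rule rho_L2)
    \<comment> \<open>The inner product is conjugate linear in \<open>w\<close>; passing to
      conjugates gives the linear functionals that the density argument expects.\<close>
    let ?lim' = "\<lambda>w. (\<lambda>n. L2_inner m w (rho m (\<phi> n) f)) \<longlonglongrightarrow> cnj (?B f w)"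
    have lim'_iff: "?lim' w \<longleftrightarrow> ?lim f w" for w
      using lim_cnj[of "\<lambda>n. L2_inner m (rho m (\<phi> n) f) w" "?B f w" sequentially]
      by (simp add: L2_inner_cnj)
    have "closed_subspace m {w \<in> L2 m. ?lim' w}"
    proof (rule closed_subspace_tendsto)
      show "cmod (L2_inner m w (rho m (\<phi> n) f)) \<le> L2_norm m f * L2_norm m w" if "w \<in> L2 m" for n w
        using L2_Cauchy_Schwarz[OF that rf, of n] L2_norm_rho[OF \<phi> f] by (simp add: mult.commute)
      show "cmod (cnj (?B f w)) \<le> (c * L2_norm m f) * L2_norm m w" if "w \<in> L2 m" for w
        using B_bound[OF f that] by (simp add: ac_simps)
      show "L2_inner m (\<lambda>x. w x + z x) (rho m (\<phi> n) f) =
          L2_inner m w (rho m (\<phi> n) f) + L2_inner m z (rho m (\<phi> n) f)"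
        if "w \<in> L2 m" "z \<in> L2 m" for n w z
        using L2_inner_add_left[OF that rf] .
      show "cnj (?B f (\<lambda>x. w x + z x)) = cnj (?B f w) + cnj (?B f z)"
        if "w \<in> L2 m" "z \<in> L2 m" for w z
        unfolding rank_two_form_def complex_cnj_add[symmetric] sum.distrib[symmetric]
        using that by (intro arg_cong[of _ _ cnj] sum.cong refl) (simp add: L2_inner_add_right tens distrib_left)
      show "cnj (?B f (\<lambda>x. d * w x)) = d * cnj (?B f w)" if "w \<in> L2 m" for d w
        unfolding rank_two_form_def L2_inner_scale_right by (simp add: sum_distrib_left ac_simps)
    qed (rule L2_inner_scale_left)
    then have "L2 m \<subseteq> {w \<in> L2 m. ?lim' w}"
      by (rule L2_box_dense) (simp add: L2_box lim'_iff f_box[OF f])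
    with w show ?thesis by (auto simp: lim'_iff)
  qed
  with \<phi> show thesis by (rule that)
qed

section \<open>The homogeneous components\<close>

lemma cube_mp_cong:
  assumes "cube_mp m \<Psi>" "\<And>x. x \<in> space (unit_cube m) \<Longrightarrow> \<Psi> x = \<Psi>' x"
  shows "cube_mp m \<Psi>'"
proof -
  have "distr (unit_cube m) (unit_cube m) \<Psi> = distr (unit_cube m) (unit_cube m) \<Psi>'"
    by (rule distr_cong) (use assms(2) in auto)
  moreover have "\<Psi> \<in> unit_cube m \<rightarrow>\<^sub>M unit_cube m \<longleftrightarrow> \<Psi>' \<in> unit_cube m \<rightarrow>\<^sub>M unit_cube m"
    by (rule measurable_cong) (rule assms(2))
  ultimately show ?thesis using assms(1) by (simp add: cube_mp_def)
qed

lemma cube_mp_permute: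
  assumes "\<sigma> permutes {..<m}"
  shows "cube_mp m (\<lambda>x. x \<circ> \<sigma>)"
proof (rule cube_mp_cong)
  show "cube_mp m (\<lambda>x. \<lambda>i\<in>{..<m}. x (\<sigma> i))"
    by (rule cube_mp_coordinatewise[OF assms mp_map_id])
  show "(\<lambda>i\<in>{..<m}. x (\<sigma> i)) = x \<circ> \<sigma>" if "x \<in> space (unit_cube m)" for x
    using that permutes_not_in[OF assms]
    by (auto simp: space_unit_cube PiE_def extensional_def fun_eq_iff)
qed

section \<open>Symmetric functions\<close>

lemma L2_sym_subset: "f \<in> L2_sym m \<Longrightarrow> f \<in> L2 m"
  by (simp add: L2_sym_def)

lemma L2_sym_ae: "f \<in> L2_sym m \<Longrightarrow> \<sigma> permutes {..<m} \<Longrightarrow> ae_eq m f (\<lambda>x. f (x \<circ> \<sigma>))"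
  by (simp add: L2_sym_def)

lemma L2_inner_permute:
  assumes "\<sigma> permutes {..<m}" "f \<in> L2 m" "g \<in> L2 m"
  shows "L2_inner m (\<lambda>x. f (x \<circ> \<sigma>)) g = L2_inner m f (\<lambda>x. g (x \<circ> inv \<sigma>))"
proof -
  note c = cube_mp_permute[OF permutes_inv[OF assms(1)]]
  have "L2_inner m (\<lambda>x. f (x \<circ> \<sigma>)) g =
      L2_inner m (\<lambda>x. f ((x \<circ> inv \<sigma>) \<circ> \<sigma>)) (\<lambda>x. g (x \<circ> inv \<sigma>))"
    by (rule cube_mp_inner[OF c cube_mp_L2[OF cube_mp_permute[OF assms(1)] assms(2)] assms(3), symmetric])
  also have "(\<lambda>x. f ((x \<circ> inv \<sigma>) \<circ> \<sigma>)) = f"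
    using permutes_inv_o[OF assms(1)] by (simp add: comp_assoc)
  finally show ?thesis .
qed

lemma L2_sym_inner_permute:
  assumes "f \<in> L2_sym m" "\<sigma> permutes {..<m}" "g \<in> L2 m"
  shows "L2_inner m f (\<lambda>x. g (x \<circ> \<sigma>)) = L2_inner m f g"
proof -
  note f = L2_sym_subset[OF assms(1)]
  note c = cube_mp_permute[OF assms(2)]
  have "L2_inner m f (\<lambda>x. g (x \<circ> \<sigma>)) = L2_inner m (\<lambda>x. f (x \<circ> \<sigma>)) (\<lambda>x. g (x \<circ> \<sigma>))"
    using cube_mp_L2[OF c assms(3)]
    by (intro L2_inner_ae_cong f cube_mp_L2[OF c f] L2_sym_ae[OF assms(1,2)] ae_eq_refl)
  also have "\<dots> = L2_inner m f g" by (rule cube_mp_inner[OF c f assms(3)])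
  finally show ?thesis .
qed

text \<open>Symmetric functions are exhibited as an annihilator, which makes closedness
  immediate.\<close>

lemma L2_sym_eq_orthogonal:
  "L2_sym m = {f \<in> L2 m. \<forall>h \<in> {\<lambda>x. g x - g (x \<circ> inv \<sigma>) |g \<sigma>. g \<in> L2 m \<and> \<sigma> permutes {..<m}}. L2_inner m f h = 0}"
  (is "_ = {f \<in> L2 m. \<forall>h \<in> ?S. L2_inner m f h = 0}")
proof (intro set_eqI iffI)
  fix f assume f: "f \<in> L2_sym m"
  have "L2_inner m f h = 0" if hS: "h \<in> ?S" for h
  proof -
    obtain g \<sigma> where h: "h = (\<lambda>x. g x - g (x \<circ> inv \<sigma>))" "g \<in> L2 m" "\<sigma> permutes {..<m}"
      using hS by blast
    note p = permutes_inv[OF h(3)]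
    have "L2_inner m f h = L2_inner m f g - L2_inner m f (\<lambda>x. g (x \<circ> inv \<sigma>))"
      unfolding h(1) by (rule L2_inner_diff_right[OF h(2) cube_mp_L2[OF cube_mp_permute[OF p] h(2)] L2_sym_subset[OF f]])
    then show ?thesis using L2_sym_inner_permute[OF f p h(2)] by simp
  qed
  then show "f \<in> {f \<in> L2 m. \<forall>h \<in> ?S. L2_inner m f h = 0}" using L2_sym_subset[OF f] by blast
next
  fix f assume "f \<in> {f \<in> L2 m. \<forall>h \<in> ?S. L2_inner m f h = 0}"
  then have f: "f \<in> L2 m" and orth: "\<And>h. h \<in> ?S \<Longrightarrow> L2_inner m f h = 0" by blast+
  have "ae_eq m f (\<lambda>x. f (x \<circ> \<sigma>))" if \<sigma>: "\<sigma> permutes {..<m}" for \<sigma>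
  proof -
    note f' = cube_mp_L2[OF cube_mp_permute[OF \<sigma>] f]
    \<comment> \<open>Moving the permutation to the other side gives the squared norm of
      \<open>d\<close> as the inner product of \<open>f\<close> with
      \<open>d - d \<circ> \<sigma>\<close>-inverse, which is one of the test functions.\<close>
    define d where "d = (\<lambda>x. f x - f (x \<circ> \<sigma>))"
    have d: "d \<in> L2 m" unfolding d_def by (rule L2_diff[OF f f'])
    note d' = cube_mp_L2[OF cube_mp_permute[OF permutes_inv[OF \<sigma>]] d]
    have "L2_inner m d d = L2_inner m f d - L2_inner m (\<lambda>x. f (x \<circ> \<sigma>)) d"
      using L2_inner_diff_left[OF f f' d] by (simp add: d_def)
    also have "\<dots> = L2_inner m f d - L2_inner m f (\<lambda>x. d (x \<circ> inv \<sigma>))"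
      by (simp add: L2_inner_permute[OF \<sigma> f d])
    also have "\<dots> = L2_inner m f (\<lambda>x. d x - d (x \<circ> inv \<sigma>))"
      by (rule L2_inner_diff_right[OF d d' f, symmetric])
    also have "\<dots> = 0" by (rule orth) (use d \<sigma> in blast)
    finally have "ae_eq m d (\<lambda>_. 0)" using ae_eq_iff_norm[OF d] by (simp add: L2_inner_self)
    then show ?thesis by (simp add: d_def ae_eq_diff_iff)
  qed
  with f show "f \<in> L2_sym m" by (simp add: L2_sym_def)
qed

lemma closed_subspace_L2_sym: "closed_subspace m (L2_sym m)"
  unfolding L2_sym_eq_orthogonal
proof (rule closed_subspace_orthogonal, rule subsetI)
  fix h assume "h \<in> {\<lambda>x. g x - g (x \<circ> inv \<sigma>) |g \<sigma>. g \<in> L2 m \<and> \<sigma> permutes {..<m}}"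
  then obtain g \<sigma> where "h = (\<lambda>x. g x - g (x \<circ> inv \<sigma>))" "g \<in> L2 m" "\<sigma> permutes {..<m}" by blast
  then show "h \<in> L2 m"
    using cube_mp_L2[OF cube_mp_permute[OF permutes_inv]] by (auto intro: L2_diff)
qed

section \<open>The filtration by number of coordinates, its invariance and its components\<close>

abbreviation few_coordinates :: "nat \<Rightarrow> int \<Rightarrow> cube_fun set" where
  "few_coordinates m k \<equiv> {f \<in> L2 m. \<exists>I\<subseteq>{..<m}. int (card I) \<le> k \<and> depends_only_on m I f}"

lemma closed_subspace_L2_le: "closed_subspace m (L2_le m k)"
  unfolding L2_le_def by (rule closed_subspace_span) auto

lemma few_coordinates_subset: "few_coordinates m k \<subseteq> L2_le m k"
  unfolding L2_le_def by (rule closed_span_superset)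

lemma L2_le_least: "closed_subspace m M \<Longrightarrow> few_coordinates m k \<subseteq> M \<Longrightarrow> L2_le m k \<subseteq> M"
  unfolding L2_le_def by (rule closed_span_least)

lemma L2_le_mono: "k \<le> l \<Longrightarrow> L2_le m k \<subseteq> L2_le m l"
  by (rule L2_le_least[OF closed_subspace_L2_le], rule order_trans[OF _ few_coordinates_subset]) auto

lemma L2_le_top: "L2_le m (int m) = L2 m"
proof
  show "L2_le m (int m) \<subseteq> L2 m" by (rule closed_subspace_subset[OF closed_subspace_L2_le])
  have "depends_only_on m {..<m} f" for f
  proof -
    have "x = y" if "x \<in> space (unit_cube m)" "y \<in> space (unit_cube m)" "\<forall>i\<in>{..<m}. x i = y i" for x y
      using that unfolding space_unit_cube by (intro PiE_ext) auto
    then show ?thesis unfolding depends_only_on_def by metis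
  qed
  then have "L2 m \<subseteq> few_coordinates m (int m)" by (auto intro!: exI[of _ "{..<m}"])
  then show "L2 m \<subseteq> L2_le m (int m)" using few_coordinates_subset by blast
qed

lemma L2_null_eq_orthogonal: "L2_null m = {f \<in> L2 m. \<forall>g\<in>L2 m. L2_inner m f g = 0}"
proof (intro set_eqI iffI)
  fix f assume "f \<in> L2_null m"
  then have f: "f \<in> L2 m" "ae_eq m f (\<lambda>_. 0)" by (auto simp: L2_null_def)
  have "L2_inner m f g = 0" if g: "g \<in> L2 m" for g
    using L2_inner_ae_cong[OF f(1) L2_const g g f(2)] by (simp add: ae_eq_def)
  then show "f \<in> {f \<in> L2 m. \<forall>g\<in>L2 m. L2_inner m f g = 0}" using f by simp
next
  fix f assume f: "f \<in> {f \<in> L2 m. \<forall>g\<in>L2 m. L2_inner m f g = 0}"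
  then have "L2_inner m f f = 0" by simp
  then show "f \<in> L2_null m" using f ae_eq_iff_norm[of f m] by (simp add: L2_null_def L2_inner_self)
qed

lemma closed_subspace_L2_null: "closed_subspace m (L2_null m)"
  unfolding L2_null_eq_orthogonal by (rule closed_subspace_orthogonal) simp

lemma L2_le_minus_one: "L2_le m (-1) \<subseteq> L2_null m"
  by (rule L2_le_least[OF closed_subspace_L2_null]) auto

lemma rho_map_component: "i < m \<Longrightarrow> rho_map m \<phi> x i = inv_into {0..1} \<phi> (x i)"
  by (simp add: rho_map_def)

text \<open>A map acting separately in each coordinate preserves dependence on the coordinates in
  \<open>I\<close>; this settles the generators, and the pullback of a closed subspace the
  rest.\<close>

lemma rho_L2_le:
  assumes \<phi>: "\<phi> \<in> mp_bijections" and f: "f \<in> L2_le m k"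
  shows "rho m \<phi> f \<in> L2_le m k"
proof -
  have "few_coordinates m k \<subseteq> {f \<in> L2 m. (\<lambda>x. f (rho_map m \<phi> x)) \<in> L2_le m k}"
  proof
    fix f assume "f \<in> few_coordinates m k"
    then obtain I where f: "f \<in> L2 m" and I: "I \<subseteq> {..<m}" "int (card I) \<le> k" "depends_only_on m I f" by auto
    have "depends_only_on m I (\<lambda>x. f (rho_map m \<phi> x))"
      unfolding depends_only_on_def
    proof (intro ballI impI)
      fix x y assume xy: "x \<in> space (unit_cube m)" "y \<in> space (unit_cube m)" "\<forall>i\<in>I. x i = y i"
      then have "\<forall>i\<in>I. rho_map m \<phi> x i = rho_map m \<phi> y i"
        using I(1) by (auto simp: rho_map_component subset_iff)
      then show "f (rho_map m \<phi> x) = f (rho_map m \<phi> y)"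
        using I(3) xy cube_mp_space[OF cube_mp_rho_map[OF \<phi>]] unfolding depends_only_on_def by blast
    qed
    then have "(\<lambda>x. f (rho_map m \<phi> x)) \<in> few_coordinates m k"
      using I L2_rho[OF \<phi> f] by (auto simp: rho_eq)
    then show "f \<in> {f \<in> L2 m. (\<lambda>x. f (rho_map m \<phi> x)) \<in> L2_le m k}"
      using f few_coordinates_subset by blast
  qed
  then have "L2_le m k \<subseteq> {f \<in> L2 m. (\<lambda>x. f (rho_map m \<phi> x)) \<in> L2_le m k}"
    by (rule L2_le_least[OF closed_subspace_pullback[OF cube_mp_rho_map[OF \<phi>] closed_subspace_L2_le]])
  with f show ?thesis by (auto simp: rho_eq)
qed

text \<open>Applying the same map in all coordinates commutes with permuting them.\<close>

lemma rho_L2_sym: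
  assumes \<phi>: "\<phi> \<in> mp_bijections" and f: "f \<in> L2_sym m"
  shows "rho m \<phi> f \<in> L2_sym m"
proof -
  note f2 = L2_sym_subset[OF f]
  have "ae_eq m (rho m \<phi> f) (\<lambda>x. rho m \<phi> f (x \<circ> \<sigma>))" if \<sigma>: "\<sigma> permutes {..<m}" for \<sigma>
  proof (rule ae_eq_trans)
    show "ae_eq m (rho m \<phi> f) (\<lambda>x. f (rho_map m \<phi> x \<circ> \<sigma>))"
      unfolding rho_eq
      by (rule cube_mp_ae_eq[OF cube_mp_rho_map[OF \<phi>] f2 _ L2_sym_ae[OF f \<sigma>]])
        (rule cube_mp_L2[OF cube_mp_permute[OF \<sigma>] f2])
    have "rho_map m \<phi> x \<circ> \<sigma> = rho_map m \<phi> (x \<circ> \<sigma>)" for x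
      using permutes_in_image[OF \<sigma>] permutes_not_in[OF \<sigma>] by (auto simp: rho_map_def fun_eq_iff)
    then show "ae_eq m (\<lambda>x. f (rho_map m \<phi> x \<circ> \<sigma>)) (\<lambda>x. rho m \<phi> f (x \<circ> \<sigma>))"
      by (simp add: rho_eq ae_eq_def)
  qed
  then show ?thesis using L2_rho[OF \<phi> f2] by (simp add: L2_sym_def)
qed

text \<open>The adjoint of \<open>rho\<close> at \<open>\<phi>\<close> is \<open>rho\<close> at the
  inverse map, so orthogonal complements of invariant subspaces are invariant.\<close>

lemma L2_inner_rho:
  assumes \<phi>: "\<phi> \<in> mp_bijections" and f: "f \<in> L2 m" and g: "g \<in> L2 m"
  shows "L2_inner m (rho m \<phi> f) g = L2_inner m f (rho m (inv_into {0..1} \<phi>) g)"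
proof -
  let ?i = "inv_into {0..1} \<phi>"
  note i = mp_bijections_inv[OF \<phi>]
  have "L2_inner m (rho m \<phi> f) g = L2_inner m (\<lambda>x. rho m \<phi> f (rho_map m ?i x)) (\<lambda>x. g (rho_map m ?i x))"
    by (rule cube_mp_inner[OF cube_mp_rho_map[OF i] L2_rho[OF \<phi> f] g, symmetric])
  also have "\<dots> = L2_inner m f (rho m ?i g)"
  proof (rule L2_inner_cong)
    fix x assume x: "x \<in> space (unit_cube m)"
    have "rho_map m \<phi> (rho_map m ?i x) = x"
    proof (rule PiE_ext)
      show "rho_map m \<phi> (rho_map m ?i x) \<in> {..<m} \<rightarrow>\<^sub>E {0..1}" "x \<in> {..<m} \<rightarrow>\<^sub>E {0..1}"
        using x cube_mp_space[OF cube_mp_rho_map[OF \<phi>]] cube_mp_space[OF cube_mp_rho_map[OF i]]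
        by (simp_all flip: space_unit_cube)
      show "rho_map m \<phi> (rho_map m ?i x) j = x j" if "j \<in> {..<m}" for j
        using that mp_bijections_inv_right[OF i component_in_unit[OF x, of j]]
        by (simp add: rho_map_component)
    qed
    then show "rho m \<phi> f (rho_map m ?i x) = f x" by (simp add: rho_eq)
  qed (simp add: rho_eq)
  finally show ?thesis .
qed

lemma closed_subspace_L2_sym_le: "closed_subspace m (L2_sym_le m k)"
  unfolding L2_sym_le_def by (rule closed_subspace_Int[OF closed_subspace_L2_sym closed_subspace_L2_le])

lemma L2_sym_le_subset: "f \<in> L2_sym_le m k \<Longrightarrow> f \<in> L2 m"
  using closed_subspace_subset[OF closed_subspace_L2_sym_le] by auto

lemma L2_sym_le_mono: "k \<le> l \<Longrightarrow> L2_sym_le m k \<subseteq> L2_sym_le m l"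
  using L2_le_mono[of k l m] by (auto simp: L2_sym_le_def)

lemma L2_sym_le_top: "L2_sym_le m (int m) = L2_sym m"
  using L2_sym_subset by (auto simp: L2_sym_le_def L2_le_top)

lemma closed_subspace_L2_sym_comp: "closed_subspace m (L2_sym_comp m k)"
proof -
  have "L2_sym_comp m k = L2_sym_le m (int k) \<inter>
      {f \<in> L2 m. \<forall>g\<in>L2_sym_le m (int k - 1). L2_inner m f g = 0}"
    using L2_sym_le_subset by (auto simp: L2_sym_comp_def)
  then show ?thesis
    using closed_subspace_Int[OF closed_subspace_L2_sym_le closed_subspace_orthogonal] L2_sym_le_subset
    by (simp add: subset_iff)
qed

lemma L2_sym_comp_subset: "f \<in> L2_sym_comp m k \<Longrightarrow> f \<in> L2 m"
  using closed_subspace_subset[OF closed_subspace_L2_sym_comp] by auto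

lemma L2_sym_comp_sym: "f \<in> L2_sym_comp m k \<Longrightarrow> f \<in> L2_sym m"
  by (simp add: L2_sym_comp_def L2_sym_le_def)

lemma rho_invariant_L2_sym_comp: "rho_invariant m (L2_sym_comp m k)"
  unfolding rho_invariant_def
proof (intro ballI)
  fix \<phi> f assume \<phi>: "\<phi> \<in> mp_bijections" and f: "f \<in> L2_sym_comp m k"
  have inv: "rho m \<psi> g \<in> L2_sym_le m l" if "\<psi> \<in> mp_bijections" "g \<in> L2_sym_le m l" for \<psi> g l
    using that by (simp add: L2_sym_le_def rho_L2_sym rho_L2_le)
  have "L2_inner m (rho m \<phi> f) g = 0" if g: "g \<in> L2_sym_le m (int k - 1)" for g
    using L2_inner_rho[OF \<phi> L2_sym_comp_subset[OF f] L2_sym_le_subset[OF g]]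
      inv[OF mp_bijections_inv[OF \<phi>] g] f by (simp add: L2_sym_comp_def)
  then show "rho m \<phi> f \<in> L2_sym_comp m k" using f inv[OF \<phi>] by (simp add: L2_sym_comp_def)
qed

lemma L2_sym_comp_orthogonal:
  assumes "j \<noteq> k" "f \<in> L2_sym_comp m j" "g \<in> L2_sym_comp m k"
  shows "L2_inner m f g = 0"
proof -
  have *: "L2_inner m g f = 0" if "j < k" "f \<in> L2_sym_comp m j" "g \<in> L2_sym_comp m k" for j k f g
  proof -
    have "f \<in> L2_sym_le m (int k - 1)"
      using that(2) L2_sym_le_mono[of "int j" "int k - 1" m] that(1) by (auto simp: L2_sym_comp_def)
    then show ?thesis using that(3) by (simp add: L2_sym_comp_def)
  qed
  show ?thesis using *[of j k f g] *[of k j g f] assms L2_inner_eq_0_commute by (metis linorder_neqE_nat)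
qed

text \<open>Projection onto the preceding level peels off the top component, whose residual is
  orthogonal to that level by construction.\<close>

lemma L2_sym_le_decomposition:
  assumes "f \<in> L2_sym_le m (int k)"
  shows "\<exists>F. (\<forall>j\<le>k. F j \<in> L2_sym_comp m j) \<and> ae_eq m f (\<lambda>x. \<Sum>j\<le>k. F j x)"
  using assms
proof (induction k arbitrary: f)
  case 0
  \<comment> \<open>Level -1 contains only null functions, so the orthogonality condition at degree
    0 is vacuous and level 0 is itself a component.\<close>
  have "ae_eq m g (\<lambda>_. 0)" if "g \<in> L2_sym_le m (-1)" for g
    using that L2_le_minus_one by (auto simp: L2_sym_le_def L2_null_def)
  then have "L2_inner m f g = 0" if "g \<in> L2_sym_le m (-1)" for g
    using L2_inner_ae_cong[of f m f g "\<lambda>_. 0"] that L2_sym_le_subset[of _ m] 0 L2_const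
    by (simp add: ae_eq_def)
  then have "f \<in> L2_sym_comp m 0" using 0 by (simp add: L2_sym_comp_def)
  then show ?case by (intro exI[of _ "\<lambda>_. f"]) (simp add: ae_eq_def)
next
  case (Suc k)
  note f = L2_sym_le_subset[OF Suc.prems]
  obtain p where p: "p \<in> L2_sym_le m (int k)" "(\<lambda>x. f x - p x) \<in> L2 m"
    "\<And>g. g \<in> L2_sym_le m (int k) \<Longrightarrow> L2_inner m (\<lambda>x. f x - p x) g = 0"
    using orthogonal_projection[OF closed_subspace_L2_sym_le f] by blast
  have "p \<in> L2_sym_le m (int (Suc k))" using p(1) L2_sym_le_mono[of "int k" "int (Suc k)"] by auto
  then have q: "(\<lambda>x. f x - p x) \<in> L2_sym_comp m (Suc k)"
    using closed_subspace_diff[OF closed_subspace_L2_sym_le Suc.prems] p(3) by (simp add: L2_sym_comp_def)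
  obtain F where F: "\<forall>j\<le>k. F j \<in> L2_sym_comp m j" "ae_eq m p (\<lambda>x. \<Sum>j\<le>k. F j x)"
    using Suc.IH[OF p(1)] by blast
  let ?F = "F(Suc k := \<lambda>x. f x - p x)"
  have "ae_eq m f (\<lambda>x. \<Sum>j\<le>Suc k. ?F j x)"
    using F(2) unfolding ae_eq_def by eventually_elim simp
  then show ?case using F(1) q by (intro exI[of _ ?F]) (auto simp: le_Suc_eq)
qed

section \<open>Elementary symmetric functions of a step function\<close>

definition elem_sym :: "nat \<Rightarrow> nat \<Rightarrow> (nat \<Rightarrow> int) \<Rightarrow> nat \<Rightarrow> cube_fun" where
  "elem_sym m R h k x = (\<Sum>I | I \<subseteq> {..<m} \<and> card I = k. tens R h I x)"

lemma elem_sym_L2: "elem_sym m R h k \<in> L2 m"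
  unfolding elem_sym_def[abs_def] by (intro L2_sum tens_L2) auto

lemma tens_permute:
  assumes "inj \<sigma>"
  shows "tens R h I (x \<circ> \<sigma>) = tens R h (\<sigma> ` I) x"
  unfolding tens_def using assms by (subst prod.reindex) (auto intro: inj_on_subset)

lemma elem_sym_permute:
  assumes \<sigma>: "\<sigma> permutes {..<m}"
  shows "elem_sym m R h k (x \<circ> \<sigma>) = elem_sym m R h k x"
proof -
  let ?A = "{I. I \<subseteq> {..<m} \<and> card I = k}"
  have inj: "inj \<sigma>" using \<sigma> by (rule permutes_inj)
  have "(\<lambda>I. \<sigma> ` I) ` ?A \<subseteq> ?A"
    using permutes_image[OF \<sigma>] by (auto simp: card_image inj_on_subset[OF inj])
  moreover have "inj_on (\<lambda>I. \<sigma> ` I) ?A" by (rule inj_onI) (simp add: inj_image_eq_iff[OF inj])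
  ultimately have bij: "bij_betw (\<lambda>I. \<sigma> ` I) ?A ?A"
    by (intro bij_betw_imageI endo_inj_surj) auto
  have "elem_sym m R h k (x \<circ> \<sigma>) = (\<Sum>I\<in>?A. tens R h (\<sigma> ` I) x)"
    by (simp add: elem_sym_def tens_permute[OF inj])
  also have "\<dots> = (\<Sum>I\<in>?A. tens R h I x)" by (rule sum.reindex_bij_betw[OF bij])
  finally show ?thesis by (simp add: elem_sym_def)
qed

text \<open>Cyclically shifting the cells in a single coordinate \<open>j\<close> preserves \<open>f\<close> and averages
  the factor of the tensor in that coordinate to zero, which replaces an appeal to Fubini.\<close>

lemma tens_orthogonal:
  assumes R: "R > 0" and h0: "(\<Sum>a<R. h a) = 0" and I: "I \<subseteq> {..<m}" and f: "f \<in> L2 m"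
    and J: "depends_only_on m J f" and j: "j \<in> I" "j \<notin> J"
  shows "L2_inner m f (tens R h I) = 0"
proof -
  have jm: "j < m" using I j by auto
  have finI: "finite I" using I by (rule finite_subset) simp
  define \<pi> where "\<pi> t a = (if a < R then (a + t) mod R else a)" for t a
  have \<pi>: "\<pi> t permutes {..<R}" for t
  proof (rule bij_imp_permutes)
    have "inj_on (\<pi> t) {..<R}"
    proof (rule linorder_inj_onI)
      fix a b assume ab: "a < b" "a \<in> {..<R}" "b \<in> {..<R}"
      have "\<not> R dvd b - a" using ab by (intro nat_dvd_not_less) auto
      then show "\<pi> t a \<noteq> \<pi> t b"
        using ab mod_eq_dvd_iff_nat[of "a + t" "b + t" R] by (auto simp: \<pi>_def)
    qed auto
    moreover have "\<pi> t ` {..<R} \<subseteq> {..<R}" using R by (auto simp: \<pi>_def)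
    ultimately show "bij_betw (\<pi> t) {..<R} {..<R}" by (intro bij_betw_imageI endo_inj_surj) auto
  qed (simp add: \<pi>_def)
  define \<Psi> where "\<Psi> t x = (\<lambda>i\<in>{..<m}. (if i = j then exch R (\<pi> t) else (\<lambda>y. y)) (x (id i)))" for t and x :: "nat \<Rightarrow> real"
  have \<Psi>: "cube_mp m (\<Psi> t)" for t
    unfolding \<Psi>_def by (rule cube_mp_coordinatewise[OF permutes_id]) (simp add: exch_mp_map[OF R \<pi>] mp_map_id)
  have tens: "tens R h I \<in> L2 m" by (rule tens_L2[OF I])
  note tens\<Psi> = cube_mp_L2[OF \<Psi> tens]
  have shift: "L2_inner m f (\<lambda>x. tens R h I (\<Psi> t x)) = L2_inner m f (tens R h I)" for t
  proof -
    have "L2_inner m f (\<lambda>x. tens R h I (\<Psi> t x)) = L2_inner m (\<lambda>x. f (\<Psi> t x)) (\<lambda>x. tens R h I (\<Psi> t x))"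
    proof (rule L2_inner_cong)
      fix x assume x: "x \<in> space (unit_cube m)"
      have "\<forall>i\<in>J. x i = \<Psi> t x i"
        using j x by (auto simp: \<Psi>_def space_unit_cube PiE_def extensional_def)
      then show "f x = f (\<Psi> t x)"
        using J x cube_mp_space[OF \<Psi> x] unfolding depends_only_on_def by blast
    qed simp
    also have "\<dots> = L2_inner m f (tens R h I)" by (rule cube_mp_inner[OF \<Psi> f tens])
    finally show ?thesis .
  qed
  have "of_nat R * L2_inner m f (tens R h I) = (\<Sum>t<R. L2_inner m f (\<lambda>x. tens R h I (\<Psi> t x)))"
    by (simp add: shift)
  also have "\<dots> = L2_inner m f (\<lambda>x. \<Sum>t<R. tens R h I (\<Psi> t x))"
    by (rule L2_inner_sum_right[symmetric]) (auto intro: tens\<Psi> f)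
  also have "\<dots> = L2_inner m f (\<lambda>_. 0)"
  proof (rule L2_inner_ae_cong[OF f f])
    \<comment> \<open>Away from the null set \<open>x j = 1\<close> the cell index is below
      \<open>R\<close>, where the cyclic shifts act.\<close>
    have "AE x in PiM {..<m} (\<lambda>_. unit_interval). x j < 1"
      by (rule AE_PiM_component) (use jm in \<open>auto intro: prob_space_unit_interval AE_unit_interval_less_1\<close>)
    then have "AE x in unit_cube m. x j < 1" unfolding unit_cube_def by (rule AE_completion)
    then show "ae_eq m (\<lambda>x. \<Sum>t<R. tens R h I (\<Psi> t x)) (\<lambda>_. 0)"
      unfolding ae_eq_def using AE_space
    proof eventually_elim
      case (elim x)
      define a where "a = nat \<lfloor>real R * x j\<rfloor>"
      have "real R * x j < real R" using elim(1) R by simp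
      then have "\<lfloor>real R * x j\<rfloor> < int R" by (simp add: floor_less_iff)
      then have a: "a < R" using R unfolding a_def by linarith
      have "tens R h I (\<Psi> t x) = tens R h (I - {j}) x * of_int (h (\<pi> t a))" for t
      proof -
        have "tens R h I (\<Psi> t x) = of_int (step R h (\<Psi> t x j)) * (\<Prod>i\<in>I - {j}. of_int (step R h (\<Psi> t x i)))"
          unfolding tens_def by (rule prod.remove[OF finI j(1)])
        also have "(\<Prod>i\<in>I - {j}. of_int (step R h (\<Psi> t x i))) = tens R h (I - {j}) x"
          unfolding tens_def by (rule prod.cong) (use I in \<open>auto simp: \<Psi>_def\<close>)
        also have "step R h (\<Psi> t x j) = h (\<pi> t a)"
          using jm by (simp add: \<Psi>_def step_exch[OF R]) (simp add: step_def a_def)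
        finally show ?thesis by (simp add: mult.commute)
      qed
      \<comment> \<open>For indices below \<open>R\<close> the shift \<open>(a + t) mod R\<close> is
        symmetric in \<open>a\<close> and \<open>t\<close>, so running through all shifts of one
        cell is running through all cells.\<close>
      moreover have "(\<Sum>t<R. h (\<pi> t a)) = (\<Sum>b<R. h (\<pi> a b))"
        using a by (intro sum.cong) (auto simp: \<pi>_def add.commute)
      moreover have "(\<Sum>b<R. h (\<pi> a b)) = 0"
        using sum.permute[OF \<pi>[of a], of h] h0 by (simp add: comp_def)
      ultimately show ?case by (simp flip: sum_distrib_left of_int_sum)
    qed
  qed (auto intro: L2_sum tens\<Psi> L2_const simp: ae_eq_def)
  finally show ?thesis using R by simp
qed

text \<open>A set \<open>J\<close> of fewer than \<open>k\<close> coordinates misses some coordinate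
  of every \<open>I\<close> of size \<open>k\<close>, and there the factor \<open>h\<close> has mean
  zero. Hence the annihilator of the function, being closed, contains the whole level
  \<open>k - 1\<close>.\<close>

lemma elem_sym_in_comp:
  assumes R: "R > 0" and h0: "(\<Sum>a<R. h a) = 0"
  shows "elem_sym m R h k \<in> L2_sym_comp m k"
proof -
  have tens_le: "tens R h I \<in> L2_le m (int k)" if "I \<subseteq> {..<m}" "card I = k" for I
  proof -
    have "depends_only_on m I (tens R h I)"
      unfolding depends_only_on_def tens_def by (auto intro!: prod.cong)
    then have "tens R h I \<in> few_coordinates m (int k)"
      using that tens_L2[of I m R h] by (intro CollectI conjI exI[of _ I]) auto
    then show ?thesis using few_coordinates_subset by blast
  qed
  have "elem_sym m R h k \<in> L2_sym m"
    using elem_sym_L2 by (simp add: L2_sym_def elem_sym_permute ae_eq_def)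
  moreover have "elem_sym m R h k \<in> L2_le m (int k)"
    unfolding elem_sym_def[abs_def]
    by (rule closed_subspace_sum[OF closed_subspace_L2_le tens_le]) auto
  moreover have "L2_inner m (elem_sym m R h k) g = 0" if g: "g \<in> L2_sym_le m (int k - 1)" for g
  proof -
    have "few_coordinates m (int k - 1) \<subseteq> {f \<in> L2 m. \<forall>e\<in>{elem_sym m R h k}. L2_inner m f e = 0}"
    proof
      fix f assume "f \<in> few_coordinates m (int k - 1)"
      then obtain J where f: "f \<in> L2 m" and J: "J \<subseteq> {..<m}" "int (card J) \<le> int k - 1" "depends_only_on m J f"
        by auto
      have "L2_inner m f (tens R h I) = 0" if I: "I \<subseteq> {..<m}" "card I = k" for I
      proof -
        have "\<not> I \<subseteq> J" using J I card_mono[of J I] finite_subset[OF J(1)] by auto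
        then obtain j where "j \<in> I" "j \<notin> J" by auto
        then show ?thesis by (rule tens_orthogonal[OF R h0 I(1) f J(3)])
      qed
      then have "L2_inner m f (elem_sym m R h k) = 0"
        unfolding elem_sym_def[abs_def] using f by (subst L2_inner_sum_right) (auto intro: tens_L2)
      then show "f \<in> {f \<in> L2 m. \<forall>e\<in>{elem_sym m R h k}. L2_inner m f e = 0}" using f by simp
    qed
    then have "L2_le m (int k - 1) \<subseteq> {f \<in> L2 m. \<forall>e\<in>{elem_sym m R h k}. L2_inner m f e = 0}"
      by (intro L2_le_least closed_subspace_orthogonal) (simp add: elem_sym_L2)
    then have "L2_inner m g (elem_sym m R h k) = 0" using g by (auto simp: L2_sym_le_def)
    then show ?thesis using L2_inner_eq_0_commute by blast
  qed
  ultimately show ?thesis by (simp add: L2_sym_comp_def L2_sym_le_def)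
qed

lemma permutes_image_exists:
  assumes I: "I \<subseteq> A" and J: "J \<subseteq> A" and A: "finite A" and card: "card I = card J"
  obtains \<sigma> where "\<sigma> permutes A" "\<sigma> ` I = J"
proof -
  have fin: "finite I" "finite J" using I J A finite_subset by auto
  obtain f where f: "bij_betw f I J" using finite_same_card_bij[OF fin card] by blast
  have "card (A - I) = card (A - J)" using card I J fin by (simp add: card_Diff_subset)
  then obtain g where g: "bij_betw g (A - I) (A - J)" using finite_same_card_bij[of "A - I" "A - J"] A by auto
  define \<sigma> where "\<sigma> x = (if x \<in> I then f x else if x \<in> A then g x else x)" for x
  have 1: "bij_betw \<sigma> I J" using f by (rule bij_betw_cong[THEN iffD1, rotated]) (simp add: \<sigma>_def)
  have 2: "bij_betw \<sigma> (A - I) (A - J)"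
    using g by (rule bij_betw_cong[THEN iffD1, rotated]) (simp add: \<sigma>_def)
  have "bij_betw \<sigma> (I \<union> (A - I)) (J \<union> (A - J))" by (rule bij_betw_combine[OF 1 2]) auto
  moreover have "I \<union> (A - I) = A" "J \<union> (A - J) = A" using I J by auto
  ultimately have "\<sigma> permutes A" using I by (intro bij_imp_permutes) (auto simp: \<sigma>_def)
  moreover have "\<sigma> ` I = J" using 1 by (simp add: bij_betw_def)
  ultimately show thesis by (rule that)
qed

text \<open>A permutation carries \<open>{..<card I}\<close> onto \<open>I\<close> without changing
  pairings with \<open>f\<close>. Only the size of \<open>I\<close> matters, so all coefficients of
  one degree coincide.\<close>

lemma L2_sym_inner_tens:
  assumes f: "f \<in> L2_sym m" and I: "I \<subseteq> {..<m}"
  shows "L2_inner m f (tens R h I) = L2_inner m f (tens R h {..<card I})"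
proof -
  have le: "card I \<le> m" using card_mono[OF _ I] by simp
  obtain \<sigma> where \<sigma>: "\<sigma> permutes {..<m}" "\<sigma> ` {..<card I} = I"
    by (rule permutes_image_exists[of "{..<card I}" "{..<m}" I]) (use le I in auto)
  have "L2_inner m f (\<lambda>x. tens R h {..<card I} (x \<circ> \<sigma>)) = L2_inner m f (tens R h {..<card I})"
    by (rule L2_sym_inner_permute[OF f \<sigma>(1) tens_L2]) (use le in auto)
  then show ?thesis by (simp add: tens_permute[OF permutes_inj[OF \<sigma>(1)]] \<sigma>(2))
qed

lemma L2_sym_inner_elem_sym:
  assumes f: "f \<in> L2_sym m"
  shows "L2_inner m f (elem_sym m R h k) = of_nat (m choose k) * L2_inner m f (tens R h {..<k})"
proof -
  have "L2_inner m f (elem_sym m R h k) = (\<Sum>I | I \<subseteq> {..<m} \<and> card I = k. L2_inner m f (tens R h I))"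
    unfolding elem_sym_def[abs_def]
    by (rule L2_inner_sum_right) (auto intro: tens_L2 L2_sym_subset[OF f])
  also have "\<dots> = (\<Sum>I | I \<subseteq> {..<m} \<and> card I = k. L2_inner m f (tens R h {..<k}))"
  proof (rule sum.cong[OF refl])
    fix I assume "I \<in> {I. I \<subseteq> {..<m} \<and> card I = k}"
    then have "I \<subseteq> {..<m}" "card I = k" by auto
    then show "L2_inner m f (tens R h I) = L2_inner m f (tens R h {..<k})"
      using L2_sym_inner_tens[OF f, of I R h] by simp
  qed
  finally show ?thesis using n_subsets[of "{..<m}" k] by simp
qed

lemma sum_Pow_card:
  fixes F :: "nat set \<Rightarrow> 'a::comm_monoid_add"
  shows "(\<Sum>I\<in>Pow {..<m}. F I) = (\<Sum>k\<le>m. \<Sum>I | I \<subseteq> {..<m} \<and> card I = k. F I)"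
proof -
  have "card ` Pow {..<m} \<subseteq> {..m}" using card_mono[of "{..<m}"] by auto
  then have "(\<Sum>I\<in>Pow {..<m}. F I) = (\<Sum>k\<le>m. \<Sum>I\<in>{I \<in> Pow {..<m}. card I = k}. F I)"
    by (intro sum.group[symmetric]) auto
  then show ?thesis by simp
qed

text \<open>Grouping subsets by size leaves, for symmetric \<open>f\<close>, a polynomial of degree
  at most \<open>m\<close> in \<open>1/q\<close> whose coefficients do not involve
  \<open>q\<close>.\<close>

lemma rank_two_form_sym:
  assumes f: "f \<in> L2_sym m" and w: "w \<in> L2 m"
  shows "rank_two_form m R g h q f w =
    (\<Sum>k\<le>m. L2_inner m f (tens R h {..<k}) * L2_inner m (elem_sym m R g k) w * (1 / of_nat q) ^ k)"
proof -
  have "rank_two_form m R g h q f w = (\<Sum>k\<le>m. \<Sum>I | I \<subseteq> {..<m} \<and> card I = k.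
      (1 / of_nat q) ^ card I * L2_inner m f (tens R h I) * L2_inner m (tens R g I) w)"
    unfolding rank_two_form_def by (rule sum_Pow_card)
  also have "\<dots> = (\<Sum>k\<le>m. \<Sum>I | I \<subseteq> {..<m} \<and> card I = k.
      (1 / of_nat q) ^ k * L2_inner m f (tens R h {..<k}) * L2_inner m (tens R g I) w)"
  proof (intro sum.cong refl)
    fix k I assume "I \<in> {I. I \<subseteq> {..<m} \<and> card I = k}"
    then have "I \<subseteq> {..<m}" "card I = k" by auto
    then show "(1 / of_nat q) ^ card I * L2_inner m f (tens R h I) * L2_inner m (tens R g I) w =
        (1 / of_nat q) ^ k * L2_inner m f (tens R h {..<k}) * L2_inner m (tens R g I) w"
      using L2_sym_inner_tens[OF f, of I R h] by simp
  qed
  also have "\<dots> = (\<Sum>k\<le>m. L2_inner m f (tens R h {..<k}) * L2_inner m (elem_sym m R g k) w * (1 / of_nat q) ^ k)"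
  proof (rule sum.cong[OF refl])
    fix k
    have "L2_inner m (elem_sym m R g k) w = (\<Sum>I | I \<subseteq> {..<m} \<and> card I = k. L2_inner m (tens R g I) w)"
      unfolding elem_sym_def[abs_def] using w by (intro L2_inner_sum_left) (auto intro: tens_L2)
    then show "(\<Sum>I | I \<subseteq> {..<m} \<and> card I = k. (1 / of_nat q) ^ k * L2_inner m f (tens R h {..<k}) * L2_inner m (tens R g I) w) =
        L2_inner m f (tens R h {..<k}) * L2_inner m (elem_sym m R g k) w * (1 / of_nat q) ^ k"
      by (simp add: sum_distrib_left ac_simps)
  qed
  finally show ?thesis .
qed

lemma elem_sym_refine: "s > 0 \<Longrightarrow> elem_sym m R h k = elem_sym m (R * s) (\<lambda>a. h (a div s)) k"
  by (simp only: elem_sym_def[abs_def] tens_refine[of s R h])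

text \<open>Every \<open>w\<close> orthogonal to \<open>M\<close> annihilates the weak limits of the
  orbit of \<open>f\<close>, for all large \<open>q\<close>. All coefficients of the polynomial in
  \<open>1/q\<close> then vanish; in degree \<open>k\<close> one factor is nonzero by assumption, so
  \<open>w\<close> is orthogonal to the target.\<close>

lemma elem_sym_in_invariant_subspace:
  assumes M: "closed_invariant_subspace m M" and sym: "M \<subseteq> L2_sym m" and f: "f \<in> M" and k: "k \<le> m"
    and R: "R > 0" "(\<Sum>a<R. h a) = 0" and S: "S > 0" "(\<Sum>a<S. g a) = 0"
    and nz: "L2_inner m f (elem_sym m R h k) \<noteq> 0"
  shows "elem_sym m S g k \<in> M"
proof -
  have cM: "closed_subspace m M" and inv: "rho_invariant m M"
    using M by (auto simp: closed_invariant_subspace_def)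
  have fs: "f \<in> L2_sym m" using sym f by auto
  \<comment> \<open>The weak limit takes \<open>g\<close> and \<open>h\<close> on the same grid, so
    both are transferred to a common refinement.\<close>
  define Q where "Q = R * S"
  define h' where "h' a = h (a div S)" for a
  define g' where "g' a = g (a div R)" for a
  have Q: "Q > 0" using R S by (simp add: Q_def)
  have h'0: "(\<Sum>a<Q. h' a) = 0" using sum_div_blocks[OF S(1), of h R] R by (simp add: Q_def h'_def)
  have g'0: "(\<Sum>a<Q. g' a) = 0"
    using sum_div_blocks[OF R(1), of g S] S by (simp add: Q_def g'_def mult.commute)
  have eh: "elem_sym m R h k = elem_sym m Q h' k"
    unfolding Q_def h'_def by (rule elem_sym_refine[OF S(1)])
  have eg: "elem_sym m S g k = elem_sym m Q g' k"
    unfolding Q_def g'_def mult.commute[of R S] by (rule elem_sym_refine[OF R(1)])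
  have ch: "L2_inner m f (tens Q h' {..<k}) \<noteq> 0"
    using nz unfolding eh L2_sym_inner_elem_sym[OF fs] by auto
  \<comment> \<open>A crude bound for all products \<open>h' a * g' b\<close>; every
    \<open>q\<close> above it gives a table with nonnegative entries.\<close>
  define B where "B = (\<Sum>a<Q. \<bar>h' a\<bar>) * (\<Sum>b<Q. \<bar>g' b\<bar>)"
  have B: "\<bar>h' a * g' b\<bar> \<le> B" if "a < Q" "b < Q" for a b
    unfolding B_def abs_mult using that
    by (intro mult_mono member_le_sum sum_nonneg) auto
  have "elem_sym m Q g' k \<in> M"
  proof (rule closed_subspace_biorthogonal[OF cM elem_sym_L2])
    fix w assume w: "w \<in> L2 m" and orth: "\<And>u. u \<in> M \<Longrightarrow> L2_inner m u w = 0"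
    define c where "c j = L2_inner m f (tens Q h' {..<j}) * L2_inner m (elem_sym m Q g' j) w" for j
    have root: "(\<Sum>j\<le>m. c j * (1 / of_nat q) ^ j) = 0" if q: "q > nat B" for q
    proof -
      have "\<bar>h' a * g' b\<bar> \<le> int q" if "a < Q" "b < Q" for a b using B[OF that] q by linarith
      moreover have "q > 0" using q by simp
      ultimately obtain \<phi> where \<phi>: "\<And>n::nat. \<phi> n \<in> mp_bijections"
        "\<And>f w. f \<in> L2 m \<Longrightarrow> w \<in> L2 m \<Longrightarrow>
          (\<lambda>n. L2_inner m (rho m (\<phi> n) f) w) \<longlonglongrightarrow> rank_two_form m Q g' h' q f w"
        using rho_weak_limit[OF Q _ g'0 h'0] by metis
      have "rho m (\<phi> n) f \<in> M" for n using inv f \<phi>(1) by (simp add: rho_invariant_def)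
      then have "(\<lambda>n. 0) \<longlonglongrightarrow> rank_two_form m Q g' h' q f w"
        using \<phi>(2)[OF L2_sym_subset[OF fs] w] orth by simp
      then have "rank_two_form m Q g' h' q f w = 0" by (simp add: LIMSEQ_const_iff)
      then show ?thesis by (simp add: rank_two_form_sym[OF fs w] c_def)
    qed
    have "infinite ((\<lambda>q::nat. 1 / of_nat q :: complex) ` {q. q > nat B})"
    proof (subst finite_image_iff)
      show "inj_on (\<lambda>q::nat. 1 / of_nat q :: complex) {q. q > nat B}"
        by (rule inj_onI) (auto simp: divide_simps split: if_splits)
      show "infinite {q. q > nat B}" using infinite_Ioi[of "nat B"] by (simp add: greaterThan_def)
    qed
    moreover have "(\<lambda>q::nat. 1 / of_nat q :: complex) ` {q. q > nat B} \<subseteq> {z. (\<Sum>j\<le>m. c j * z ^ j) = 0}"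
      using root by auto
    ultimately have "infinite {z. (\<Sum>j\<le>m. c j * z ^ j) = 0}" by (rule infinite_super[rotated])
    then have "c k = 0" using k polyfun_finite_roots[of c m] by auto
    then show "L2_inner m (elem_sym m Q g' k) w = 0" using ch by (simp add: c_def)
  qed
  then show ?thesis by (simp add: eg)
qed

section \<open>Classification of the invariant subspaces\<close>

text \<open>The product of sums expands over maps from \<open>{..<m}\<close> to \<open>S\<close>.
  For a map with image \<open>T\<close> the signs of all \<open>S\<close> containing
  \<open>T\<close> cancel unless \<open>T\<close> is everything, so only surjections, that is
  permutations, survive.\<close>

lemma permanent_inclusion_exclusion:
  fixes a :: "nat \<Rightarrow> nat \<Rightarrow> 'a::comm_ring_1"
  shows "(\<Sum>S\<in>Pow {..<m}. (-1) ^ card S * (\<Prod>i<m. \<Sum>s\<in>S. a i s)) =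
    (-1) ^ m * (\<Sum>c | c \<in> {..<m} \<rightarrow>\<^sub>E {..<m} \<and> c ` {..<m} = {..<m}. \<Prod>i<m. a i (c i))"
proof -
  let ?A = "{..<m}"
  let ?P = "?A \<rightarrow>\<^sub>E ?A"
  have fin: "finite ?P" by (intro finite_PiE) auto
  have expand: "(\<Prod>i<m. \<Sum>s\<in>S. a i s) = (\<Sum>c\<in>?P. if c ` ?A \<subseteq> S then \<Prod>i<m. a i (c i) else 0)"
    if S: "S \<subseteq> ?A" for S
  proof -
    have "(\<Prod>i<m. \<Sum>s\<in>S. a i s) = (\<Sum>c\<in>?A \<rightarrow>\<^sub>E S. \<Prod>i<m. a i (c i))"
      using finite_subset[OF S] by (intro prod_sum_PiE) auto
    also have "?A \<rightarrow>\<^sub>E S = {c \<in> ?P. c ` ?A \<subseteq> S}" 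
      using S by (intro set_eqI) (simp add: PiE_iff image_subset_iff, blast)
    finally show ?thesis using sum.inter_filter[OF fin, of "\<lambda>c. \<Prod>i<m. a i (c i)"] by simp
  qed
  \<comment> \<open>The alternating sum is the expansion of a product with factor \<open>-1\<close>
    for elements of \<open>T\<close> and \<open>-1 + 1\<close> for all others.\<close>
  have inner: "(\<Sum>S\<in>Pow ?A. if T \<subseteq> S then (-1) ^ card S else 0) = (if T = ?A then (-1) ^ m else (0::'a))"
    if T: "T \<subseteq> ?A" for T
  proof -
    have "(\<Sum>S\<in>Pow ?A. if T \<subseteq> S then (-1) ^ card S else 0) =
        (\<Sum>S\<in>Pow ?A. (\<Prod>x\<in>S. -1) * (\<Prod>x\<in>?A - S. of_bool (x \<notin> T)) :: 'a)"
    proof (rule sum.cong[OF refl])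
      fix S assume "S \<in> Pow ?A"
      have "(\<Prod>x\<in>?A - S. of_bool (x \<notin> T)) = (of_bool (T \<subseteq> S) :: 'a)"
      proof (cases "T \<subseteq> S")
        case True
        then show ?thesis by (auto intro!: prod.neutral)
      next
        case False
        then obtain x where "x \<in> T" "x \<notin> S" by auto
        then show ?thesis using T False by (auto intro!: prod_zero bexI[of _ x])
      qed
      then show "(if T \<subseteq> S then (-1) ^ card S else 0) =
          (\<Prod>x\<in>S. -1) * (\<Prod>x\<in>?A - S. of_bool (x \<notin> T) :: 'a)" by simp
    qed
    also have "\<dots> = (\<Prod>x\<in>?A. -1 + of_bool (x \<notin> T))" by (rule prod_add[symmetric]) simp
    also have "\<dots> = (if T = ?A then (-1) ^ m else 0)"
    proof (cases "T = ?A")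
      case False
      then obtain x where "x \<in> ?A" "x \<notin> T" using T by auto
      then have "(\<Prod>x\<in>?A. -1 + of_bool (x \<notin> T)) = (0::'a)" by (intro prod_zero) auto
      then show ?thesis using False by simp
    qed simp
    finally show ?thesis .
  qed
  have "(\<Sum>S\<in>Pow ?A. (-1) ^ card S * (\<Prod>i<m. \<Sum>s\<in>S. a i s)) =
      (\<Sum>S\<in>Pow ?A. \<Sum>c\<in>?P. (if c ` ?A \<subseteq> S then (-1) ^ card S else 0) * (\<Prod>i<m. a i (c i)))"
    by (rule sum.cong[OF refl]) (auto simp: expand sum_distrib_left intro!: sum.cong)
  also have "\<dots> = (\<Sum>c\<in>?P. (\<Sum>S\<in>Pow ?A. if c ` ?A \<subseteq> S then (-1) ^ card S else 0) * (\<Prod>i<m. a i (c i)))"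
    by (subst sum.swap) (simp add: sum_distrib_right)
  also have "\<dots> = (\<Sum>c\<in>?P. if c ` ?A = ?A then (-1) ^ m * (\<Prod>i<m. a i (c i)) else 0)"
  proof (rule sum.cong[OF refl])
    fix c assume "c \<in> ?P"
    then have "c ` ?A \<subseteq> ?A" by auto
    then show "(\<Sum>S\<in>Pow ?A. if c ` ?A \<subseteq> S then (-1) ^ card S else 0) * (\<Prod>i<m. a i (c i)) =
        (if c ` ?A = ?A then (-1) ^ m * (\<Prod>i<m. a i (c i)) else 0)"
      by (simp only: inner) simp
  qed
  also have "\<dots> = (-1) ^ m * (\<Sum>c | c \<in> ?P \<and> c ` ?A = ?A. \<Prod>i<m. a i (c i))"
    using sum.inter_filter[OF fin, of "\<lambda>c. (-1) ^ m * (\<Prod>i<m. a i (c i))" "\<lambda>c. c ` ?A = ?A"]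
    by (simp add: sum_distrib_left)
  finally show ?thesis .
qed

text \<open>Orthogonality spreads from \<open>elem_sym\<close> with mean-zero \<open>h\<close> to
  the single tensors, then to full tensor powers of arbitrary integer step functions, and by
  polarization to products of different indicators, which are total.\<close>

lemma elem_sym_total:
  assumes f: "f \<in> L2_sym m"
    and orth: "\<And>k R h. k \<le> m \<Longrightarrow> R > 0 \<Longrightarrow> (\<Sum>a<R. h a) = 0 \<Longrightarrow> L2_inner m f (elem_sym m R h k) = 0"
  shows "ae_eq m f (\<lambda>_. 0)"
proof -
  note f2 = L2_sym_subset[OF f]
  let ?A = "{..<m}"
  have zero_sum: "L2_inner m f (tens R h I) = 0"
    if R: "R > 0" "(\<Sum>a<R. h a) = 0" and I: "I \<subseteq> ?A" for R h I
  proof -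
    have "card I \<le> m" using card_mono[OF _ I] by simp
    then have "L2_inner m f (tens R h {..<card I}) = 0"
      using orth[OF _ R, of "card I"] L2_sym_inner_elem_sym[OF f, of R h "card I"] by simp
    then show ?thesis using L2_sym_inner_tens[OF f I] by simp
  qed
  have power: "L2_inner m f (tens R u ?A) = 0" if R: "R > 0" for R u
  proof -
    define c where "c = (\<Sum>a<R. u a)"
    \<comment> \<open>Centering \<open>u\<close> while staying among the integers: multiplying by
      \<open>R\<close> replaces division of the sum \<open>c\<close> by \<open>R\<close>. Expanding
      \<open>R u = h + c\<close> in every coordinate reduces to mean-zero tensors.\<close>
    define h where "h a = int R * u a - c" for a
    have h0: "(\<Sum>a<R. h a) = 0" by (simp add: h_def sum_subtractf c_def flip: sum_distrib_left)
    have "(\<lambda>x. of_nat (R ^ m) * tens R u ?A x) = (\<lambda>x. \<Sum>I\<in>Pow ?A. of_int c ^ card (?A - I) * tens R h I x)"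
    proof
      fix x
      have "of_nat (R ^ m) * tens R u ?A x = (\<Prod>i<m. of_nat R * complex_of_int (step R u (x i)))"
        by (simp add: tens_def prod.distrib)
      also have "\<dots> = (\<Prod>i<m. of_int (step R h (x i)) + of_int c)"
        by (simp add: step_def h_def)
      also have "\<dots> = (\<Sum>I\<in>Pow ?A. (\<Prod>i\<in>I. of_int (step R h (x i))) * (\<Prod>i\<in>?A - I. of_int c))"
        by (rule prod_add) simp
      finally show "of_nat (R ^ m) * tens R u ?A x = (\<Sum>I\<in>Pow ?A. of_int c ^ card (?A - I) * tens R h I x)"
        by (simp add: tens_def mult.commute)
    qed
    then have "L2_inner m f (\<lambda>x. of_nat (R ^ m) * tens R u ?A x) =
        (\<Sum>I\<in>Pow ?A. L2_inner m f (\<lambda>x. of_int c ^ card (?A - I) * tens R h I x))"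
      by (simp only:) (rule L2_inner_sum_right, auto intro: L2_scale tens_L2 f2)
    also have "\<dots> = 0"
      by (rule sum.neutral) (simp only: L2_inner_scale_right, use zero_sum[OF R h0] in auto)
    finally show ?thesis using R by (simp add: L2_inner_scale_right)
  qed
  let ?C = "{c \<in> ?A \<rightarrow>\<^sub>E ?A. c ` ?A = ?A}"
  have finC: "finite ?C" by (rule finite_subset[of _ "?A \<rightarrow>\<^sub>E ?A"]) (auto intro: finite_PiE)
  show ?thesis
  proof (rule L2_box_total[OF f2])
    fix R :: nat and S :: "nat \<Rightarrow> nat set" assume R: "R > 0"
    define v :: "nat \<Rightarrow> nat \<Rightarrow> int" where "v i a = of_bool (a \<in> S i)" for i a
    define b where "b c = step_box m R (\<lambda>i a. of_int (v (c i) a))" for c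
    have b_L2: "b c \<in> L2 m" for c by (simp add: b_def L2_box)
    have id_b: "b (\<lambda>i. i) = step_box m R (\<lambda>i a. of_bool (a \<in> S i))"
      unfolding b_def v_def by (intro arg_cong[of _ _ "step_box m R"] ext) simp
    \<comment> \<open>Distributing the indicators differently over the coordinates does not change
      the pairing with a symmetric function, so the permanent collapses to a positive multiple of
      the wanted inner product.\<close>
    have b_perm: "L2_inner m f (b c) = L2_inner m f (b (\<lambda>i. i))" if c: "c \<in> ?C" for c
    proof -
      \<comment> \<open>As an extensional function \<open>c\<close> is undefined outside
        \<open>{..<m}\<close>, whereas \<open>permutes\<close> asks for the identity there.\<close>
      define \<sigma> where "\<sigma> i = (if i < m then c i else i)" for i
      have img: "\<sigma> ` ?A = ?A" using c by (auto simp: \<sigma>_def image_def)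
      have "bij_betw \<sigma> ?A ?A" using img by (intro bij_betw_imageI finite_surj_inj) auto
      then have \<sigma>: "\<sigma> permutes ?A" by (rule bij_imp_permutes) (simp add: \<sigma>_def)
      have "b (\<lambda>i. i) (x \<circ> inv \<sigma>) = b c x" for x
      proof -
        have "b (\<lambda>i. i) (x \<circ> inv \<sigma>) = (\<Prod>i<m. of_int (step R (v i) (x (inv \<sigma> i))))"
          by (simp add: b_def step_box_def step_def)
        also have "\<dots> = (\<Prod>i<m. of_int (step R (v (\<sigma> i)) (x (inv \<sigma> (\<sigma> i)))))"
          using prod.permute[OF \<sigma>, of "\<lambda>i. of_int (step R (v i) (x (inv \<sigma> i)))"] by (simp add: comp_def)
        also have "\<dots> = b c x"
          by (simp add: b_def step_box_def step_def permutes_inverses[OF \<sigma>]) (simp add: \<sigma>_def)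
        finally show ?thesis .
      qed
      then show ?thesis using L2_sym_inner_permute[OF f permutes_inv[OF \<sigma>] b_L2, of "\<lambda>i. i"] by simp
    qed
    have "(\<lambda>x. \<Sum>T\<in>Pow ?A. (-1) ^ card T * tens R (\<lambda>a. \<Sum>s\<in>T. v s a) ?A x) =
        (\<lambda>x. (-1) ^ m * (\<Sum>c\<in>?C. b c x))"
    proof
      fix x
      show "(\<Sum>T\<in>Pow ?A. (-1) ^ card T * tens R (\<lambda>a. \<Sum>s\<in>T. v s a) ?A x) = (-1) ^ m * (\<Sum>c\<in>?C. b c x)"
        using permanent_inclusion_exclusion[where m=m and a="\<lambda>i s. of_int (step R (v s) (x i))"]
        by (simp add: tens_def b_def step_box_def step_def)
    qed
    then have "L2_inner m f (\<lambda>x. (-1) ^ m * (\<Sum>c\<in>?C. b c x)) =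
        L2_inner m f (\<lambda>x. \<Sum>T\<in>Pow ?A. (-1) ^ card T * tens R (\<lambda>a. \<Sum>s\<in>T. v s a) ?A x)" by simp
    also have "\<dots> = (\<Sum>T\<in>Pow ?A. L2_inner m f (\<lambda>x. (-1) ^ card T * tens R (\<lambda>a. \<Sum>s\<in>T. v s a) ?A x))"
      by (rule L2_inner_sum_right) (auto intro: L2_scale tens_L2 f2)
    also have "\<dots> = 0" by (rule sum.neutral) (simp add: L2_inner_scale_right power[OF R])
    finally have "L2_inner m f (\<lambda>x. \<Sum>c\<in>?C. b c x) = 0" by (simp add: L2_inner_scale_right)
    then have "(\<Sum>c\<in>?C. L2_inner m f (b c)) = 0"
      by (subst (asm) L2_inner_sum_right) (auto intro: b_L2 f2)
    then have "of_nat (card ?C) * L2_inner m f (b (\<lambda>i. i)) = 0" using b_perm by simp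
    moreover have "restrict id ?A \<in> ?C" by auto
    then have "card ?C \<noteq> 0" unfolding card_0_eq[OF finC] by (metis empty_iff)
    ultimately show "L2_inner m f (step_box m R (\<lambda>i a. of_bool (a \<in> S i))) = 0" by (simp add: id_b)
  qed
qed

text \<open>For the other degrees orthogonality is automatic, since \<open>elem_sym\<close> of
  degree \<open>j\<close> lies in component \<open>j\<close>.\<close>

lemma elem_sym_total_comp:
  assumes f: "f \<in> L2_sym_comp m k"
    and orth: "\<And>R h. R > 0 \<Longrightarrow> (\<Sum>a<R. h a) = 0 \<Longrightarrow> L2_inner m f (elem_sym m R h k) = 0"
  shows "ae_eq m f (\<lambda>_. 0)"
proof (rule elem_sym_total[OF L2_sym_comp_sym[OF f]])
  fix j R :: nat and h :: "nat \<Rightarrow> int" assume "R > 0" "(\<Sum>a<R. h a) = 0"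
  then show "L2_inner m f (elem_sym m R h j) = 0"
    using orth L2_sym_comp_orthogonal[OF _ f elem_sym_in_comp, of j R h] by (cases "j = k") auto
qed

text \<open>Projecting onto the intersection of \<open>M\<close> with the component leaves a
  residual inside the component and orthogonal to every \<open>elem_sym\<close> of degree
  \<open>k\<close>, hence null.\<close>

lemma L2_sym_comp_generated:
  assumes M: "closed_subspace m M"
    and e: "\<And>R h. R > 0 \<Longrightarrow> (\<Sum>a<R. h a) = 0 \<Longrightarrow> elem_sym m R h k \<in> M"
  shows "L2_sym_comp m k \<subseteq> M"
proof
  fix f assume f: "f \<in> L2_sym_comp m k"
  note V = closed_subspace_L2_sym_comp[of m k]
  obtain p where p: "p \<in> M \<inter> L2_sym_comp m k" "(\<lambda>x. f x - p x) \<in> L2 m"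
    "\<And>g. g \<in> M \<inter> L2_sym_comp m k \<Longrightarrow> L2_inner m (\<lambda>x. f x - p x) g = 0"
    using orthogonal_projection[OF closed_subspace_Int[OF M V] L2_sym_comp_subset[OF f]] by blast
  have "(\<lambda>x. f x - p x) \<in> L2_sym_comp m k" using closed_subspace_diff[OF V f] p(1) by simp
  then have "ae_eq m (\<lambda>x. f x - p x) (\<lambda>_. 0)"
    by (rule elem_sym_total_comp) (use p(3) e elem_sym_in_comp in auto)
  then have "ae_eq m p f" using ae_eq_diff_iff ae_eq_sym by blast
  with p(1) show "f \<in> M" by (intro closed_subspace_ae_cong[OF M _ L2_sym_comp_subset[OF f]]) auto
qed

text \<open>The second alternative speaks of \<open>elem_sym\<close> only;
  \<open>elem_sym_total_comp\<close> turns it into vanishing of the degree \<open>k\<close> part.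
  Irreducibility and the direct sum both rest on this.\<close>

lemma invariant_subspace_dichotomy:
  assumes M: "closed_invariant_subspace m M" and sym: "M \<subseteq> L2_sym m" and k: "k \<le> m"
  shows "L2_sym_comp m k \<subseteq> M \<or>
    (\<forall>f\<in>M. \<forall>R>0. \<forall>h. (\<Sum>a<R. h a) = 0 \<longrightarrow> L2_inner m f (elem_sym m R h k) = 0)"
proof (rule disjCI)
  assume "\<not> (\<forall>f\<in>M. \<forall>R>0. \<forall>h. (\<Sum>a<R. h a) = 0 \<longrightarrow> L2_inner m f (elem_sym m R h k) = 0)"
  then obtain f R h where f: "f \<in> M" and R: "R > 0" "(\<Sum>a<R. h a) = 0"
    and nz: "L2_inner m f (elem_sym m R h k) \<noteq> 0" by blast
  show "L2_sym_comp m k \<subseteq> M"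
  proof (rule L2_sym_comp_generated)
    show "closed_subspace m M" using M by (simp add: closed_invariant_subspace_def)
    show "elem_sym m S g k \<in> M" if "S > 0" "(\<Sum>a<S. g a) = 0" for S g
      by (rule elem_sym_in_invariant_subspace[OF M sym f k R that nz])
  qed
qed

lemma closed_invariant_L2_sym_comp: "closed_invariant_subspace m (L2_sym_comp m k)"
  by (simp add: closed_invariant_subspace_def closed_subspace_L2_sym_comp rho_invariant_L2_sym_comp)

lemma L2_null_subset: "closed_subspace m M \<Longrightarrow> L2_null m \<subseteq> M"
  using closed_subspace_ae_cong[OF _ closed_subspace_zero] ae_eq_sym by (fastforce simp: L2_null_def)

lemma rho_irreducible_L2_sym_comp:
  assumes k: "k \<le> m"
  shows "rho_irreducible_on m (L2_sym_comp m k)"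
  unfolding rho_irreducible_on_def
proof (intro conjI allI impI closed_invariant_L2_sym_comp)
  fix N assume N: "closed_invariant_subspace m N \<and> N \<subseteq> L2_sym_comp m k"
  then have sym: "N \<subseteq> L2_sym m" using L2_sym_comp_sym by blast
  show "N = L2_null m \<or> N = L2_sym_comp m k"
    using invariant_subspace_dichotomy[OF conjunct1[OF N] sym k]
  proof
    assume "L2_sym_comp m k \<subseteq> N"
    then show ?thesis using N by auto
  next
    assume *: "\<forall>f\<in>N. \<forall>R>0. \<forall>h. (\<Sum>a<R. h a) = 0 \<longrightarrow> L2_inner m f (elem_sym m R h k) = 0"
    have "N \<subseteq> L2_null m"
    proof
      fix f assume f: "f \<in> N"
      then have V: "f \<in> L2_sym_comp m k" using N by auto
      then have "ae_eq m f (\<lambda>_. 0)" by (rule elem_sym_total_comp) (use * f in auto)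
      then show "f \<in> L2_null m" using L2_sym_comp_subset[OF V] by (simp add: L2_null_def)
    qed
    moreover have "L2_null m \<subseteq> N" using N L2_null_subset[of m N] by (simp add: closed_invariant_subspace_def)
    ultimately show ?thesis by auto
  qed
qed

section \<open>Walsh functions and non-equivalence of the components\<close>

text \<open>The first Rademacher function on two cells. Its tensors are Walsh functions, hence
  orthonormal, and its values of modulus 1 make every \<open>q \<ge> 1\<close> admissible in the
  weak limit.\<close>

definition sign_fun :: "nat \<Rightarrow> int" where
  "sign_fun a = (if a = 0 then 1 else - 1)"

lemma sign_fun_zero_sum: "(\<Sum>a<2. sign_fun a) = 0"
  by (simp add: sign_fun_def numeral_2_eq_2)

lemma tens_sign_fun_inner:
  assumes "I \<subseteq> {..<m}" "J \<subseteq> {..<m}"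
  shows "L2_inner m (tens 2 sign_fun I) (tens 2 sign_fun J) = of_bool (I = J)"
proof -
  have "L2_inner m (tens 2 sign_fun I) (tens 2 sign_fun J) =
      (\<Prod>i<m. of_bool (i \<in> I \<longleftrightarrow> i \<in> J))"
    unfolding tens_eq_box[OF assms(1)] tens_eq_box[OF assms(2)]
    by (subst L2_inner_box) (auto intro!: prod.cong simp: numeral_2_eq_2 sign_fun_def)
  also have "\<dots> = of_bool (\<forall>i<m. i \<in> I \<longleftrightarrow> i \<in> J)"
  proof (cases "\<forall>i<m. i \<in> I \<longleftrightarrow> i \<in> J")
    case False
    then obtain i where "i < m" "\<not> (i \<in> I \<longleftrightarrow> i \<in> J)" by blast
    then have "(\<Prod>i<m. of_bool (i \<in> I \<longleftrightarrow> i \<in> J)) = (0::complex)" by (intro prod_zero bexI[of _ i]) auto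
    then show ?thesis using False by simp
  qed simp
  also have "(\<forall>i<m. i \<in> I \<longleftrightarrow> i \<in> J) \<longleftrightarrow> I = J" using assms by blast
  finally show ?thesis .
qed

text \<open>Among the orthonormal summands only \<open>I = {..<k}\<close> contributes. This
  certifies that component \<open>k\<close> is not null and normalizes a coefficient in the
  non-equivalence proof.\<close>

lemma elem_sym_sign_fun_inner:
  assumes k: "k \<le> m"
  shows "L2_inner m (elem_sym m 2 sign_fun k) (tens 2 sign_fun {..<k}) = 1"
proof -
  have K: "{..<k} \<subseteq> {..<m}" using k by auto
  have "L2_inner m (elem_sym m 2 sign_fun k) (tens 2 sign_fun {..<k}) =
      (\<Sum>I | I \<subseteq> {..<m} \<and> card I = k. L2_inner m (tens 2 sign_fun I) (tens 2 sign_fun {..<k}))"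
    unfolding elem_sym_def[abs_def] by (rule L2_inner_sum_left) (use k in \<open>auto intro: tens_L2\<close>)
  also have "\<dots> = (\<Sum>I | I \<subseteq> {..<m} \<and> card I = k. if I = {..<k} then 1 else 0)"
    by (rule sum.cong) (auto simp: tens_sign_fun_inner[OF _ K])
  also have "\<dots> = 1" using K by (subst sum.delta) (auto intro: finite_subset[of _ "Pow {..<m}"])
  finally show ?thesis .
qed

text \<open>Within one component all other degrees drop out by orthogonality, so the weak limit is
  \<open>(1/q)^k\<close> times a form that does not depend on \<open>q\<close>.\<close>

lemma rank_two_form_comp:
  assumes f: "f \<in> L2_sym_comp m k" and k: "k \<le> m" and w: "w \<in> L2 m"
    and R: "R > 0" "(\<Sum>a<R. h a) = 0"
  shows "rank_two_form m R g h q f w =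
    L2_inner m f (tens R h {..<k}) * L2_inner m (elem_sym m R g k) w * (1 / of_nat q) ^ k"
proof -
  have "L2_inner m f (tens R h {..<j}) = 0" if "j \<le> m" "j \<noteq> k" for j
    using L2_sym_comp_orthogonal[OF _ f elem_sym_in_comp[OF R, of m j]] that
      L2_sym_inner_elem_sym[OF L2_sym_comp_sym[OF f], of R h j] by simp
  then have "rank_two_form m R g h q f w = (\<Sum>j\<le>m. if j = k
      then L2_inner m f (tens R h {..<k}) * L2_inner m (elem_sym m R g k) w * (1 / of_nat q) ^ k else 0)"
    unfolding rank_two_form_sym[OF L2_sym_comp_sym[OF f] w] by (intro sum.cong) auto
  then show ?thesis using k by simp
qed

text \<open>A normalized vector \<open>e\<close> of component \<open>k\<close> is shown to have null
  image: comparing the weak limits before and after \<open>T\<close> for two values of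
  \<open>q\<close> leaves no other possibility. The bounded inverse \<open>S\<close> then makes
  \<open>e\<close> null, a contradiction.\<close>

lemma not_rho_equivalent_L2_sym_comp:
  assumes k: "k \<le> m" and l: "l \<le> m" and kl: "k \<noteq> l"
  shows "\<not> rho_equivalent m (L2_sym_comp m k) (L2_sym_comp m l)"
proof
  assume "rho_equivalent m (L2_sym_comp m k) (L2_sym_comp m l)"
  then obtain T S where T: "bounded_operator m (L2_sym_comp m k) (L2_sym_comp m l) T"
    and S: "bounded_operator m (L2_sym_comp m l) (L2_sym_comp m k) S"
    and ST: "\<And>f. f \<in> L2_sym_comp m k \<Longrightarrow> ae_eq m (S (T f)) f"
    and inter: "\<And>\<phi> f. \<phi> \<in> mp_bijections \<Longrightarrow> f \<in> L2_sym_comp m k \<Longrightarrow>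
        ae_eq m (T (rho m \<phi> f)) (rho m \<phi> (T f))"
    unfolding rho_equivalent_def by blast
  let ?V = "L2_sym_comp m k"
  have T_in: "T f \<in> L2_sym_comp m l" if "f \<in> ?V" for f
    using T that by (auto simp: bounded_operator_def)
  have T_L2: "T f \<in> L2 m" if "f \<in> ?V" for f using T_in[OF that] by (rule L2_sym_comp_subset)
  obtain C where C: "\<And>f. f \<in> ?V \<Longrightarrow> L2_norm m (T f) \<le> C * L2_norm m f"
    using T unfolding bounded_operator_def by blast
  have V_rho: "rho m \<phi> f \<in> ?V" if "\<phi> \<in> mp_bijections" "f \<in> ?V" for \<phi> f
    using rho_invariant_L2_sym_comp that by (simp add: rho_invariant_def)
  note sgn0 = sign_fun_zero_sum
  define e where "e = elem_sym m 2 sign_fun k"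
  have e: "e \<in> ?V" unfolding e_def by (rule elem_sym_in_comp) (simp_all add: sgn0)
  have c1: "L2_inner m e (tens 2 sign_fun {..<k}) = 1" unfolding e_def by (rule elem_sym_sign_fun_inner[OF k])
  have orth: "L2_inner m (T e) w = 0" if w: "w \<in> L2 m" for w
  proof -
    \<comment> \<open>Weak limits test against a fixed vector, so \<open>T\<close> has to be moved
      off the orbit: \<open>r\<close> represents the adjoint of \<open>T\<close> applied to
      \<open>w\<close>.\<close>
    obtain r where r: "r \<in> L2 m" "\<And>f. f \<in> ?V \<Longrightarrow> L2_inner m (T f) w = L2_inner m f r"
    proof (rule Riesz_representation[OF closed_subspace_L2_sym_comp[of m k], of "\<lambda>f. L2_inner m (T f) w" "C * L2_norm m w"])
      fix f g assume fg: "f \<in> ?V" "g \<in> ?V"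
      have "ae_eq m (T (\<lambda>x. f x + g x)) (\<lambda>x. T f x + T g x)"
        using T fg by (simp add: bounded_operator_def)
      then have "L2_inner m (T (\<lambda>x. f x + g x)) w = L2_inner m (\<lambda>x. T f x + T g x) w"
        using fg w by (intro L2_inner_ae_cong ae_eq_refl T_L2 L2_add closed_subspace_add[OF closed_subspace_L2_sym_comp])
      then show "L2_inner m (T (\<lambda>x. f x + g x)) w = L2_inner m (T f) w + L2_inner m (T g) w"
        using fg w by (simp add: L2_inner_add_left T_L2)
    next
      fix c f assume f: "f \<in> ?V"
      have "ae_eq m (T (\<lambda>x. c * f x)) (\<lambda>x. c * T f x)"
        using T f by (simp add: bounded_operator_def)
      then have "L2_inner m (T (\<lambda>x. c * f x)) w = L2_inner m (\<lambda>x. c * T f x) w"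
        using f w by (intro L2_inner_ae_cong ae_eq_refl T_L2 L2_scale closed_subspace_scale[OF closed_subspace_L2_sym_comp])
      then show "L2_inner m (T (\<lambda>x. c * f x)) w = c * L2_inner m (T f) w"
        by (simp add: L2_inner_scale_left)
    next
      fix f assume f: "f \<in> ?V"
      have "cmod (L2_inner m (T f) w) \<le> L2_norm m (T f) * L2_norm m w"
        by (rule L2_Cauchy_Schwarz[OF T_L2[OF f] w])
      also have "\<dots> \<le> (C * L2_norm m f) * L2_norm m w" by (intro mult_right_mono C f) simp
      finally show "cmod (L2_inner m (T f) w) \<le> C * L2_norm m w * L2_norm m f" by (simp add: ac_simps)
    qed (rule that)
    define c' where "c' = L2_inner m (T e) (tens 2 sign_fun {..<l}) * L2_inner m (elem_sym m 2 sign_fun l) w"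
    have scaling: "L2_inner m (T e) w * (1 / of_nat q) ^ k = c' * (1 / of_nat q) ^ l" if q: "q > 0" for q
    proof -
      have "\<bar>sign_fun a * sign_fun b\<bar> \<le> int q" for a b using q by (simp add: sign_fun_def)
      then obtain \<phi> where \<phi>: "\<And>n::nat. \<phi> n \<in> mp_bijections"
        and lim: "\<And>f w. f \<in> L2 m \<Longrightarrow> w \<in> L2 m \<Longrightarrow>
          (\<lambda>n. L2_inner m (rho m (\<phi> n) f) w) \<longlonglongrightarrow> rank_two_form m 2 sign_fun sign_fun q f w"
        using rho_weak_limit[of 2 q sign_fun sign_fun m, OF _ q sgn0 sgn0] by auto
      have "L2_inner m (rho m (\<phi> n) e) r = L2_inner m (rho m (\<phi> n) (T e)) w" for n
      proof -
        have "L2_inner m (rho m (\<phi> n) e) r = L2_inner m (T (rho m (\<phi> n) e)) w"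
          by (rule r(2)[OF V_rho[OF \<phi> e], symmetric])
        also have "\<dots> = L2_inner m (rho m (\<phi> n) (T e)) w"
          by (intro L2_inner_ae_cong T_L2 V_rho \<phi> e w L2_rho inter ae_eq_refl)
        finally show ?thesis .
      qed
      then have "rank_two_form m 2 sign_fun sign_fun q e r = rank_two_form m 2 sign_fun sign_fun q (T e) w"
        using LIMSEQ_unique[OF lim[OF L2_sym_comp_subset[OF e] r(1)]] lim[OF T_L2[OF e] w] by simp
      then show ?thesis
        unfolding rank_two_form_comp[OF e k r(1) zero_less_numeral sgn0]
          rank_two_form_comp[OF T_in[OF e] l w zero_less_numeral sgn0]
        using r(2)[OF e] by (simp add: c1 c'_def flip: e_def)
    qed
    \<comment> \<open>At \<open>q = 1\<close> both powers are 1 and the two constants agree;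
      \<open>q = 2\<close> then separates the exponents \<open>k\<close> and
      \<open>l\<close>.\<close>
    have 1: "L2_inner m (T e) w = c'" using scaling[of 1] by simp
    have "L2_inner m (T e) w * ((1/2) ^ k - (1/2) ^ l) = 0"
      using scaling[of 2] by (simp add: 1 right_diff_distrib)
    moreover have "(1/2 :: complex) ^ k \<noteq> (1/2) ^ l"
    proof
      assume "(1/2 :: complex) ^ k = (1/2) ^ l"
      then have "cmod ((1/2) ^ k) = cmod ((1/2) ^ l)" by simp
      then have "(1/2 :: real) ^ k = (1/2) ^ l" by (simp only: norm_power) simp
      then show False using kl power_strict_decreasing_iff[of "1/2 :: real" k l]
          power_strict_decreasing_iff[of "1/2 :: real" l k] by linarith
    qed
    ultimately show ?thesis by simp
  qed
  \<comment> \<open>Testing with \<open>w = T e\<close>. The operators are linear only up to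
    \<open>ae_eq\<close>, so boundedness of \<open>S\<close> carries nullity over to
    \<open>S (T e)\<close>.\<close>
  have "L2_norm m (T e) = 0" using orth[OF T_L2[OF e]] by (simp add: L2_inner_self)
  moreover obtain D where "\<And>g. g \<in> L2_sym_comp m l \<Longrightarrow> L2_norm m (S g) \<le> D * L2_norm m g"
    using S unfolding bounded_operator_def by blast
  ultimately have "L2_norm m (S (T e)) \<le> 0" using T_in[OF e] by fastforce
  moreover have STe: "S (T e) \<in> L2 m"
    using S T_in[OF e] by (intro L2_sym_comp_subset[of _ m k]) (simp add: bounded_operator_def)
  ultimately have "L2_norm m e = 0"
    using L2_norm_ae_cong[OF STe L2_sym_comp_subset[OF e] ST[OF e]] L2_norm_nonneg[of m "S (T e)"] by linarith
  then have "ae_eq m e (\<lambda>_. 0)" using ae_eq_iff_norm[OF L2_sym_comp_subset[OF e]] by simp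
  then have "L2_inner m e (tens 2 sign_fun {..<k}) = L2_inner m (\<lambda>_. 0) (tens 2 sign_fun {..<k})"
    using k by (intro L2_inner_ae_cong ae_eq_refl L2_const tens_L2 L2_sym_comp_subset[OF e]) auto
  then show False using c1 by simp
qed

section \<open>Direct sums of components and constants\<close>

text \<open>\<open>K\<close> collects all components contained in \<open>M\<close>. By the dichotomy
  every other component of a vector of \<open>M\<close> is orthogonal to all \<open>elem_sym\<close>
  of its degree and so null.\<close>

lemma invariant_subspace_direct_sum:
  assumes M: "closed_invariant_subspace m M" and sym: "M \<subseteq> L2_sym m"
    and K: "K = {k. k \<le> m \<and> L2_sym_comp m k \<subseteq> M}"
  shows "orthogonal_direct_sum m M K (L2_sym_comp m)"
proof -
  have cM: "closed_subspace m M" using M by (simp add: closed_invariant_subspace_def)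
  have "M = {f \<in> L2 m. \<exists>g. (\<forall>k\<in>K. g k \<in> L2_sym_comp m k) \<and> ae_eq m f (\<lambda>x. \<Sum>k\<in>K. g k x)}" (is "M = ?D")
  proof
    show "M \<subseteq> ?D"
    proof
      fix f assume f: "f \<in> M"
      note fs = subsetD[OF sym f]
      note f2 = L2_sym_subset[OF fs]
      obtain F where F: "\<And>j. j \<le> m \<Longrightarrow> F j \<in> L2_sym_comp m j" and eq: "ae_eq m f (\<lambda>x. \<Sum>j\<le>m. F j x)"
        using L2_sym_le_decomposition[of f m m] fs by (auto simp: L2_sym_le_top)
      have F2: "F j \<in> L2 m" if "j \<le> m" for j using F[OF that] by (rule L2_sym_comp_subset)
      \<comment> \<open>Pairing \<open>f\<close> with a vector of component \<open>k\<close> sees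
        only the summand \<open>F k\<close>, so information about \<open>f\<close> in
        \<open>M\<close> becomes information about \<open>F k\<close>.\<close>
      have null: "ae_eq m (F k) (\<lambda>_. 0)" if k: "k \<le> m" "k \<notin> K" for k
      proof (rule elem_sym_total_comp[OF F[OF k(1)]])
        fix R :: nat and h :: "nat \<Rightarrow> int" assume R: "R > 0" "(\<Sum>a<R. h a) = 0"
        note e = elem_sym_in_comp[OF R, of m k]
        have "L2_inner m f (elem_sym m R h k) = L2_inner m (\<lambda>x. \<Sum>j\<le>m. F j x) (elem_sym m R h k)"
          by (intro L2_inner_ae_cong f2 L2_sum F2 elem_sym_L2 eq ae_eq_refl) auto
        also have "\<dots> = (\<Sum>j\<le>m. L2_inner m (F j) (elem_sym m R h k))"
          by (intro L2_inner_sum_left F2 elem_sym_L2) auto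
        also have "\<dots> = (\<Sum>j\<le>m. if j = k then L2_inner m (F k) (elem_sym m R h k) else 0)"
          using L2_sym_comp_orthogonal[OF _ F e] by (intro sum.cong) auto
        also have "\<dots> = L2_inner m (F k) (elem_sym m R h k)" using k by simp
        finally show "L2_inner m (F k) (elem_sym m R h k) = 0"
          using invariant_subspace_dichotomy[OF M sym k(1)] k f R by (auto simp: K)
      qed
      have "AE x in unit_cube m. \<forall>k\<in>{..m} - K. F k x = 0"
        by (rule AE_finite_allI) (use null in \<open>auto simp: ae_eq_def\<close>)
      then have "ae_eq m f (\<lambda>x. \<Sum>k\<in>K. F k x)"
        using eq unfolding ae_eq_def
      proof eventually_elim
        case (elim x)
        have "(\<Sum>j\<le>m. F j x) = (\<Sum>k\<in>K. F k x)"
          by (rule sum.mono_neutral_right) (use elim(1) in \<open>auto simp: K\<close>)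
        then show ?case using elim(2) by simp
      qed
      moreover have "\<forall>k\<in>K. F k \<in> L2_sym_comp m k" using F by (simp add: K)
      ultimately show "f \<in> ?D" using f2 by blast
    qed
    show "?D \<subseteq> M"
    proof
      fix f assume "f \<in> ?D"
      then obtain g where f: "f \<in> L2 m" and g: "\<And>k. k \<in> K \<Longrightarrow> g k \<in> L2_sym_comp m k"
        and eq: "ae_eq m f (\<lambda>x. \<Sum>k\<in>K. g k x)" by blast
      have "(\<lambda>x. \<Sum>k\<in>K. g k x) \<in> M"
        by (rule closed_subspace_sum[OF cM]) (use g in \<open>auto simp: K\<close>)
      then show "f \<in> M" by (rule closed_subspace_ae_cong[OF cM _ f ae_eq_sym[OF eq]])
    qed
  qed
  moreover have "\<forall>k\<in>K. \<forall>l\<in>K. k \<noteq> l \<longrightarrow>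
      (\<forall>f\<in>L2_sym_comp m k. \<forall>g\<in>L2_sym_comp m l. L2_inner m f g = 0)"
    using L2_sym_comp_orthogonal by blast
  ultimately show ?thesis unfolding orthogonal_direct_sum_def by blast
qed

text \<open>In degree 0 every \<open>elem_sym\<close> is the constant 1, so subtracting the mean of
  \<open>f\<close> leaves a vector of the component that is orthogonal to all of them.\<close>

lemma L2_sym_comp_0_constant:
  assumes f: "f \<in> L2_sym_comp m 0"
  shows "\<exists>c. ae_eq m f (\<lambda>_. c)"
proof -
  have one: "elem_sym m R h 0 = (\<lambda>_. 1)" for R h
  proof
    fix x
    have "{I. I \<subseteq> {..<m} \<and> card I = 0} = {{}}" by (auto dest: finite_subset)
    then show "elem_sym m R h 0 x = 1" by (simp add: elem_sym_def tens_def)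
  qed
  define c where "c = L2_inner m f (\<lambda>_. 1)"
  note V = closed_subspace_L2_sym_comp[of m 0]
  have one_V: "(\<lambda>_. 1) \<in> L2_sym_comp m 0" using elem_sym_in_comp[of 1 "\<lambda>_. 0" m 0] by (simp add: one)
  have c_V: "(\<lambda>_. c) \<in> L2_sym_comp m 0" using closed_subspace_scale[OF V one_V, of c] by simp
  have 11: "L2_inner m (\<lambda>_. c) (\<lambda>_. 1) = c"
  proof -
    interpret prob_space "unit_cube m" by (rule prob_space_unit_cube)
    show ?thesis by (simp add: L2_inner_def prob_space)
  qed
  have "ae_eq m (\<lambda>x. f x - c) (\<lambda>_. 0)"
    by (rule elem_sym_total_comp[OF closed_subspace_diff[OF V f c_V]])
      (simp add: one L2_inner_diff_left[OF L2_sym_comp_subset[OF f] L2_const L2_const] 11 flip: c_def)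
  then show ?thesis using ae_eq_diff_iff by blast
qed

theorem theorem4p4:
  fixes m :: nat
  shows "(\<forall>k\<le>m. rho_irreducible_on m (L2_sym_comp m k)) \<and>
    (\<forall>k\<le>m. \<forall>l\<le>m. k \<noteq> l \<longrightarrow> \<not> rho_equivalent m (L2_sym_comp m k) (L2_sym_comp m l)) \<and>
    (\<forall>M. closed_invariant_subspace m M \<and> M \<subseteq> L2_sym m \<longrightarrow>
      (\<exists>K\<subseteq>{0..m}. orthogonal_direct_sum m M K (L2_sym_comp m)) \<and>
      ((\<exists>f\<in>M. \<not> (\<exists>c. ae_eq m f (\<lambda>_. c))) \<longrightarrow> (\<exists>k\<in>{1..m}. L2_sym_comp m k \<subseteq> M)))"
proof (intro conjI allI impI)
  show "rho_irreducible_on m (L2_sym_comp m k)" if "k \<le> m" for k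
    using that by (rule rho_irreducible_L2_sym_comp)
  show "\<not> rho_equivalent m (L2_sym_comp m k) (L2_sym_comp m l)" if "k \<le> m" "l \<le> m" "k \<noteq> l" for k l
    using that by (rule not_rho_equivalent_L2_sym_comp)
next
  fix M assume M: "closed_invariant_subspace m M \<and> M \<subseteq> L2_sym m"
  define K where "K = {k. k \<le> m \<and> L2_sym_comp m k \<subseteq> M}"
  have sum: "orthogonal_direct_sum m M K (L2_sym_comp m)"
    using M K_def by (blast intro: invariant_subspace_direct_sum)
  show "\<exists>K\<subseteq>{0..m}. orthogonal_direct_sum m M K (L2_sym_comp m)"
    using sum by (intro exI[of _ K]) (auto simp: K_def)
  assume "\<exists>f\<in>M. \<not> (\<exists>c. ae_eq m f (\<lambda>_. c))"
  then obtain f where f: "f \<in> M" "\<And>c. \<not> ae_eq m f (\<lambda>_. c)" by blast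
  then obtain g where g: "\<And>k. k \<in> K \<Longrightarrow> g k \<in> L2_sym_comp m k" "ae_eq m f (\<lambda>x. \<Sum>k\<in>K. g k x)"
    using sum unfolding orthogonal_direct_sum_def by blast
  show "\<exists>k\<in>{1..m}. L2_sym_comp m k \<subseteq> M"
  proof (rule ccontr)
    assume none: "\<not> (\<exists>k\<in>{1..m}. L2_sym_comp m k \<subseteq> M)"
    have "K \<subseteq> {0}"
    proof
      fix k assume "k \<in> K"
      then show "k \<in> {0}" using none by (cases "k = 0") (auto simp: K_def)
    qed
    \<comment> \<open>With no summand \<open>f\<close> is null, and with degree 0 alone it is a.e.
      constant; both contradict the choice of \<open>f\<close>.\<close>
    then have "K = {} \<or> K = {0}" by auto
    then show False
    proof
      assume "K = {}"
      then show False using g(2) f(2)[of 0] by simp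
    next
      assume "K = {0}"
      then show False using g L2_sym_comp_0_constant[of "g 0" m] ae_eq_trans f(2) by fastforce
    qed
  qed
qed

end
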